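(* The class of finitely presented residually free groups does not admit a uniform polynomial isoperimetric function; that is, there is no polynomial $p(n)$ such that $\delta_G(n)\preccurlyeq p(n)$ for every finitely presented residually free group $G$.
   Context: A group $G$ is residually free if for every $g\in G\setminus\{1\}$ there is a homomorphism $\phi:G\to F_2$ to the free group of rank $2$ with $\phi(g)\neq1$. For a finitely presented group $G$ with finite presentation $\mathcal{P}=\langle X\mid R\rangle$, a word $w$ in $X^{\pm1}$ is null-homotopic if it represents $1\in G$. Its area $\mathrm{Area}_{\mathcal{P}}(w)$ is the minimal $k$ such that $w$ is equal in the free group on $X$ to a product $\prod_{i=1}^k\theta_i r_i\theta_i^{-1}$ with $r_i\in R^{\pm1}$ and $\theta_i$ words in $X^{\pm 1}$. The Dehn function is $\delta_G(n)=\max\{\mathrm{Area}_{\mathcal{P}}(w)\mid w \text{ null-homotopic of word length}\leq n\}$. For non-decreasing functions $f,g:\mathbb{N}\to\mathbb{R}_{\geq0}$ write $f\preccurlyeq g$ if there is a constant $C\geq1$ such that $f(n)\leq Cg(Cn)+Cn+C$ for all $n\in\mathbb{N}$. Up to the resulting equivalence, $\delta_G$ does not depend on the choice of finite presentation. *)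

theory Defs
  imports "HOL-Algebra.Generated_Groups" "HOL-Computational_Algebra.Polynomial"
begin

text \<open>The letter \<open>(x, True)\<close> stands for \<open>x\<close> and \<open>(x, False)\<close> for its formal inverse.\<close>

type_synonym 'x word = "('x \<times> bool) list"

definition words :: "'x set \<Rightarrow> 'x word set" where
  "words X = lists (X \<times> UNIV)"

definition inv_letter :: "'x \<times> bool \<Rightarrow> 'x \<times> bool" where
  "inv_letter a = (fst a, \<not> snd a)"

definition inv_word :: "'x word \<Rightarrow> 'x word" where
  "inv_word w = rev (map inv_letter w)"

definition reduced :: "'x word \<Rightarrow> bool" where
  "reduced w \<longleftrightarrow> (\<forall>u a v. w \<noteq> u @ [a, inv_letter a] @ v)"

fun cons_red :: "'x \<times> bool \<Rightarrow> 'x word \<Rightarrow> 'x word" where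
  "cons_red a [] = [a]"
| "cons_red a (b # w) = (if b = inv_letter a then w else a # b # w)"

definition reduce :: "'x word \<Rightarrow> 'x word" where
  "reduce w = foldr cons_red w []"

text \<open>The elements of the free group are the reduced words; an arbitrary word \<open>w\<close> represents
  the element \<open>reduce w\<close>.\<close>

definition free_group :: "'x set \<Rightarrow> 'x word monoid" where
  "free_group X =
     \<lparr>carrier = {w \<in> words X. reduced w}, monoid.mult = (\<lambda>u v. reduce (u @ v)), one = []\<rparr>"

definition normal_closure :: "('a, 'm) monoid_scheme \<Rightarrow> 'a set \<Rightarrow> 'a set" where
  "normal_closure G S =
     generate G {g \<otimes>\<^bsub>G\<^esub> s \<otimes>\<^bsub>G\<^esub> inv\<^bsub>G\<^esub> g | g s. g \<in> carrier G \<and> s \<in> S}"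

definition presented_group :: "'x set \<Rightarrow> 'x word set \<Rightarrow> 'x word set monoid" where
  "presented_group X R = free_group X Mod normal_closure (free_group X) (reduce ` R)"

definition finite_presentation ::
  "('a, 'm) monoid_scheme \<Rightarrow> 'x set \<Rightarrow> 'x word set \<Rightarrow> bool" where
  "finite_presentation G X R \<longleftrightarrow>
     finite X \<and> finite R \<and> R \<subseteq> words X \<and> presented_group X R \<cong> G"

text \<open>Generators are taken from \<^typ>\<open>nat\<close>; a finite generating set can always be relabelled.
  Likewise every finitely presented group is countable, hence isomorphic to a group whose carrier
  is a set of natural numbers, so \<^typ>\<open>nat monoid\<close> covers all of them up to isomorphism.\<close>

definition finitely_presented :: "('a, 'm) monoid_scheme \<Rightarrow> bool" where
  "finitely_presented G \<longleftrightarrow> (\<exists>(X :: nat set) R. finite_presentation G X R)"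

definition residually_free :: "('a, 'm) monoid_scheme \<Rightarrow> bool" where
  "residually_free G \<longleftrightarrow>
     (\<forall>g \<in> carrier G. g \<noteq> \<one>\<^bsub>G\<^esub> \<longrightarrow>
        (\<exists>\<phi> \<in> hom G (free_group {0, 1 :: nat}). \<phi> g \<noteq> \<one>\<^bsub>free_group {0, 1 :: nat}\<^esub>))"

definition null_homotopic :: "'x set \<Rightarrow> 'x word set \<Rightarrow> 'x word \<Rightarrow> bool" where
  "null_homotopic X R w \<longleftrightarrow>
     w \<in> words X \<and>
     normal_closure (free_group X) (reduce ` R) #>\<^bsub>free_group X\<^esub> reduce w
       = \<one>\<^bsub>presented_group X R\<^esub>"

definition area :: "'x set \<Rightarrow> 'x word set \<Rightarrow> 'x word \<Rightarrow> nat" where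
  "area X R w =
     (LEAST k. \<exists>ps. length ps = k \<and>
        (\<forall>(\<theta>, r) \<in> set ps. \<theta> \<in> words X \<and> r \<in> R \<union> inv_word ` R) \<and>
        reduce w = reduce (concat (map (\<lambda>(\<theta>, r). \<theta> @ r @ inv_word \<theta>) ps)))"

definition dehn :: "'x set \<Rightarrow> 'x word set \<Rightarrow> nat \<Rightarrow> nat" where
  "dehn X R n = Max {area X R w | w. null_homotopic X R w \<and> length w \<le> n}"

text \<open>A group determines its Dehn function only up to equivalence, so being one is a relation:
  \<open>\<delta>\<close> is a Dehn function of \<open>G\<close> if it comes from some finite presentation of \<open>G\<close>.\<close>

definition is_dehn_function :: "('a, 'm) monoid_scheme \<Rightarrow> (nat \<Rightarrow> nat) \<Rightarrow> bool" where
  "is_dehn_function G \<delta> \<longleftrightarrow>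
     (\<exists>(X :: nat set) R. finite_presentation G X R \<and> \<delta> = dehn X R)"

text \<open>The constant is a natural number because \<open>C * n\<close> has to be an argument of \<open>g\<close>.\<close>

definition dominated :: "(nat \<Rightarrow> real) \<Rightarrow> (nat \<Rightarrow> real) \<Rightarrow> bool" (infix \<open>\<preceq>\<^sub>D\<close> 50) where
  "f \<preceq>\<^sub>D g \<longleftrightarrow>
     (\<exists>C :: nat. C \<ge> 1 \<and> (\<forall>n. f n \<le> real C * g (C * n) + real C * real n + real C))"


subsection \<open>Sanity checks\<close>

lemma inv_letter_inv_letter [simp]: "inv_letter (inv_letter a) = a"
  by (simp add: inv_letter_def)

lemma inv_letter_neq [simp]: "inv_letter a \<noteq> a" "a \<noteq> inv_letter a"
  by (cases a; simp add: inv_letter_def)+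

lemma reduced_Nil [simp]: "reduced []"
  by (simp add: reduced_def)

lemma reduced_single [simp]: "reduced [a]"
  by (auto simp: reduced_def Cons_eq_append_conv)

lemma reduced_Cons_Cons [simp]:
  "reduced (a # b # w) \<longleftrightarrow> b \<noteq> inv_letter a \<and> reduced (b # w)"
proof
  assume r: "reduced (a # b # w)"
  have "b \<noteq> inv_letter a"
    using r unfolding reduced_def by (metis append_Cons append_Nil)
  moreover have "reduced (b # w)"
    using r unfolding reduced_def by (metis append_Cons)
  ultimately show "b \<noteq> inv_letter a \<and> reduced (b # w)" by simp
next
  assume "b \<noteq> inv_letter a \<and> reduced (b # w)"
  then show "reduced (a # b # w)"
    unfolding reduced_def by (auto simp: Cons_eq_append_conv)
qed

lemma reduced_tl: "reduced (a # w) \<Longrightarrow> reduced w"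
  by (cases w) auto

lemma reduced_cons_red: "reduced w \<Longrightarrow> reduced (cons_red a w)"
  by (cases w) (auto dest: reduced_tl)

lemma reduced_foldr: "reduced w \<Longrightarrow> reduced (foldr cons_red u w)"
  by (induction u) (auto intro: reduced_cons_red)

lemma reduced_reduce [simp]: "reduced (reduce w)"
  unfolding reduce_def by (simp add: reduced_foldr)

lemma reduce_eq: "reduced w \<Longrightarrow> reduce w = w"
  unfolding reduce_def
proof (induction w)
  case (Cons a w)
  then show ?case by (cases w) (auto dest: reduced_tl)
qed simp

lemma cons_red_inv: "reduced w \<Longrightarrow> cons_red a (cons_red (inv_letter a) w) = w"
proof (cases w)
  case (Cons b v)
  assume "reduced w"
  then show ?thesis using Cons by (cases v) auto
qed simp

lemma foldr_cons_red:
  "reduced w \<Longrightarrow> foldr cons_red (cons_red a u) w = cons_red a (foldr cons_red u w)"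
proof (cases u)
  case (Cons b v)
  assume "reduced w"
  then have "foldr cons_red v w = cons_red a (cons_red (inv_letter a) (foldr cons_red v w))"
    by (simp add: cons_red_inv reduced_foldr)
  then show ?thesis using Cons by auto
qed simp

lemma foldr_reduce:
  assumes "reduced w"
  shows "foldr cons_red (reduce u) w = foldr cons_red u w"
proof (induction u)
  case (Cons a u)
  have "reduce (a # u) = cons_red a (reduce u)"
    by (simp add: reduce_def)
  then show ?case
    using Cons foldr_cons_red[OF assms] by simp
qed (simp add: reduce_def)

lemma reduce_append_left: "reduce (reduce u @ v) = reduce (u @ v)"
  using foldr_reduce[OF reduced_reduce, of u v] by (simp add: reduce_def)

lemma reduce_append_right: "reduce (u @ reduce v) = reduce (u @ v)"
  using reduce_eq[OF reduced_reduce, of v] by (simp add: reduce_def)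

lemma reduce_cancel: "reduce (u @ [a, inv_letter a] @ v) = reduce (u @ v)"
  using cons_red_inv[OF reduced_reduce, of a v] by (simp add: reduce_def)

lemma reduce_inv_word: "reduce (inv_word w @ w) = []"
proof (induction w)
  case (Cons a w)
  have "inv_word (a # w) @ a # w = inv_word w @ [inv_letter a, inv_letter (inv_letter a)] @ w"
    by (simp add: inv_word_def)
  then show ?case using Cons reduce_cancel by metis
qed (simp add: inv_word_def reduce_def)

lemma words_Nil [simp]: "[] \<in> words X"
  by (simp add: words_def)

lemma words_append [simp]: "u @ v \<in> words X \<longleftrightarrow> u \<in> words X \<and> v \<in> words X"
  by (auto simp: words_def)

lemma inv_word_words: "w \<in> words X \<Longrightarrow> inv_word w \<in> words X"
  by (fastforce simp: words_def inv_word_def inv_letter_def)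

lemma reduce_words: "w \<in> words X \<Longrightarrow> reduce w \<in> words X"
proof (induction w)
  case (Cons a w)
  then have "a \<in> X \<times> UNIV" "reduce w \<in> words X"
    by (auto simp: words_def)
  then show ?case
    by (cases "reduce w") (auto simp: reduce_def words_def)
qed (simp add: reduce_def)

lemma group_free_group: "group (free_group X)"
proof (rule groupI)
  fix u v w
  assume "u \<in> carrier (free_group X)" "v \<in> carrier (free_group X)" "w \<in> carrier (free_group X)"
  show "u \<otimes>\<^bsub>free_group X\<^esub> v \<otimes>\<^bsub>free_group X\<^esub> w = u \<otimes>\<^bsub>free_group X\<^esub> (v \<otimes>\<^bsub>free_group X\<^esub> w)"
    by (simp add: free_group_def reduce_append_left reduce_append_right)
next
  fix w
  assume "w \<in> carrier (free_group X)"
  then have w: "w \<in> words X"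
    by (simp add: free_group_def)
  show "\<exists>v \<in> carrier (free_group X). v \<otimes>\<^bsub>free_group X\<^esub> w = \<one>\<^bsub>free_group X\<^esub>"
    by (rule bexI[of _ "reduce (inv_word w)"])
       (use w in \<open>auto simp: free_group_def reduce_append_left reduce_inv_word
          intro: reduce_words inv_word_words\<close>)
qed (simp_all add: free_group_def reduce_words reduce_eq words_Nil)

lemma normal_normal_closure:
  assumes "group G" and S: "S \<subseteq> carrier G"
  shows "normal_closure G S \<lhd> G"
proof -
  interpret group G by fact
  show ?thesis
    unfolding normal_closure_def
  proof (rule normal_generateI)
    show "{g \<otimes>\<^bsub>G\<^esub> s \<otimes>\<^bsub>G\<^esub> inv\<^bsub>G\<^esub> g | g s. g \<in> carrier G \<and> s \<in> S} \<subseteq> carrier G"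
      using S by auto
  next
    fix h k
    assume "h \<in> {g \<otimes>\<^bsub>G\<^esub> s \<otimes>\<^bsub>G\<^esub> inv\<^bsub>G\<^esub> g | g s. g \<in> carrier G \<and> s \<in> S}" and k: "k \<in> carrier G"
    then obtain g s where gs: "g \<in> carrier G" "s \<in> S" and h: "h = g \<otimes>\<^bsub>G\<^esub> s \<otimes>\<^bsub>G\<^esub> inv\<^bsub>G\<^esub> g"
      by blast
    have "k \<otimes>\<^bsub>G\<^esub> h \<otimes>\<^bsub>G\<^esub> inv\<^bsub>G\<^esub> k = (k \<otimes>\<^bsub>G\<^esub> g) \<otimes>\<^bsub>G\<^esub> s \<otimes>\<^bsub>G\<^esub> inv\<^bsub>G\<^esub> (k \<otimes>\<^bsub>G\<^esub> g)"
      using gs S k by (auto simp: h m_assoc inv_mult_group)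
    then show "k \<otimes>\<^bsub>G\<^esub> h \<otimes>\<^bsub>G\<^esub> inv\<^bsub>G\<^esub> k \<in> {g \<otimes>\<^bsub>G\<^esub> s \<otimes>\<^bsub>G\<^esub> inv\<^bsub>G\<^esub> g | g s. g \<in> carrier G \<and> s \<in> S}"
      using gs k by blast
  qed
qed

lemma group_presented_group:
  assumes "R \<subseteq> words X"
  shows "group (presented_group X R)"
proof -
  have "reduce ` R \<subseteq> carrier (free_group X)"
    using assms by (auto simp: free_group_def reduce_words)
  then show ?thesis
    unfolding presented_group_def
    by (intro normal.factorgroup_is_group normal_normal_closure group_free_group)
qed

lemma null_homotopic_Nil:
  assumes "R \<subseteq> words X"
  shows "null_homotopic X R []"
proof -
  interpret F: group "free_group X" by (rule group_free_group)
  have "reduce ` R \<subseteq> carrier (free_group X)"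
    using assms by (auto simp: free_group_def reduce_words)
  then have "normal_closure (free_group X) (reduce ` R) \<lhd> free_group X"
    by (intro normal_normal_closure group_free_group)
  then have "normal_closure (free_group X) (reduce ` R) \<subseteq> carrier (free_group X)"
    by (meson normal_imp_subgroup subgroup.subset)
  moreover have "reduce [] = \<one>\<^bsub>free_group X\<^esub>"
    by (simp add: reduce_def free_group_def)
  ultimately show ?thesis
    by (simp add: null_homotopic_def presented_group_def FactGroup_def words_def)
qed

lemma finite_null_homotopic:
  assumes "finite X"
  shows "finite {w. null_homotopic X R w \<and> length w \<le> n}"
proof (rule finite_subset)
  show "finite {w. set w \<subseteq> X \<times> (UNIV :: bool set) \<and> length w \<le> n}"
    using assms by (intro finite_lists_length_le) simp
qed (auto simp: null_homotopic_def words_def)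

end

theory Submission
  imports Defs "HOL-Computational_Algebra.Formal_Power_Series" "HOL-Library.Countable_Set"
begin

text \<open>For every \<open>m \<ge> 2\<close> there is a finitely presented residually free group such that, for each of its
  finite presentations, the Dehn function at \<open>L * n\<close> is at least a positive multiple of \<open>n ^ m\<close>, where
  \<open>L\<close> does not depend on \<open>n\<close>. A polynomial \<open>p\<close> fails for the group with \<open>m = degree p + 2\<close>.

  \<^emph>\<open>The groups.\<close> Let \<open>F\<close> be the free group of rank two. Consider the free group on symbols \<open>x^f\<close>, where
  \<open>x\<close> is a basis element of \<open>F\<close> and \<open>f\<close> is one of the functions \<open>1, t_1, \<dots>, t_m\<close> on the cube \<open>{0,1}^m\<close>.
  Evaluating \<open>f\<close> at a vertex of the cube maps this group to \<open>F\<close>. All vertices together give the Host--Kra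
  cube group in the product of \<open>2 ^ m\<close> copies of \<open>F\<close>; the group used here is its image in the product over
  all vertices but the top one. A subgroup of a direct product of free groups is residually free.

  \<^emph>\<open>Finite presentability.\<close> The image in the product of any two of the copies of \<open>F\<close> is everything
  (\<open>vertex_kernels_span\<close>). By a theorem of Bridson, Howie, Miller and Short this implies finite
  presentability. The case needed is \<open>fng_Inter_kernels\<close>: if \<open>\<Phi>\<close> is finitely generated and has finitely
  many homomorphisms to a free group whose kernels pairwise generate \<open>\<Phi>\<close>, then the intersection of the
  kernels is the normal closure of a finite set. It is proved by induction on the number of kernels. Let
  \<open>M'\<close> be the intersection of the kernels already treated and \<open>K\<close> the next kernel. Then \<open>\<Phi> / K M'\<close> is
  nilpotent, because a commutator of elements that vanish on different factors vanishes on all of them.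
  A finite set of relators makes \<open>K\<close> and \<open>M'\<close> commute, and then \<open>K \<inter> M'\<close> is central in \<open>M'\<close>. The image
  of \<open>M'\<close> under the map with kernel \<open>K\<close> is a subgroup of a free group, hence projective
  (\<open>free_subgroup_projective\<close>); so \<open>M'\<close> splits over \<open>K \<inter> M'\<close>, and \<open>K \<inter> M'\<close> embeds into the
  abelianization of \<open>M'\<close>. That is a finitely generated module over the group ring of the polycyclic group
  \<open>\<Phi> / K M'\<close>, and by P. Hall's version of the Hilbert basis theorem (\<open>noeth_extension\<close>) its submodules
  are finitely generated.

  \<^emph>\<open>The lower bound.\<close> Let \<open>F\<close> act on formal power series by the affine maps \<open>z \<mapsto> z + 1\<close> and
  \<open>z \<mapsto> (1 + X) z\<close>. For an element of the cube group, the coefficients of this action are functions of the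
  vertex, and as polynomials in \<open>t_1, \<dots>, t_m\<close> their degree is controlled by the \<open>X\<close>-adic order of the
  coefficients (\<open>cube_poly_vertex\<close>). An element that is trivial at all vertices but the top one therefore
  acts at the top by \<open>z \<mapsto> a z + b\<close> with \<open>a - 1\<close> divisible by \<open>X ^ m\<close> and \<open>b\<close> by \<open>X ^ (m - 1)\<close>. The
  coefficient of \<open>X ^ (m - 1)\<close> in \<open>b\<close> is then additive and invariant under conjugation; in other words, it
  comes from a central extension of the group. Such an invariant of null-homotopic words is at most a
  constant times the area (\<open>area_lower_bound\<close>). The iterated commutator of the \<open>n\<close>-th powers of
  \<open>x^t_1, y^t_2, \<dots>, y^t_m\<close> has length linear in \<open>n\<close>, is trivial at every vertex but the top, and its
  invariant is \<open>\<plusminus> n ^ m\<close> (\<open>icomm_side_gens\<close>).\<close>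

section \<open>Subgroups\<close>

text \<open>Groups are written additively, because \<^class>\<open>group_add\<close> is the type class of groups that are not assumed
  to be commutative. Quotients are not formed: statements about a quotient are stated modulo a normal subgroup
  of the ambient type.\<close>

definition subgrp :: "'g::group_add set \<Rightarrow> bool" where
  "subgrp H \<longleftrightarrow> 0 \<in> H \<and> (\<forall>a\<in>H. \<forall>b\<in>H. a - b \<in> H)"

inductive_set gen :: "'g::group_add set \<Rightarrow> 'g set" for S where
  gen_zero: "0 \<in> gen S"
| gen_incl: "a \<in> S \<Longrightarrow> a \<in> gen S"
| gen_diff: "a \<in> gen S \<Longrightarrow> b \<in> gen S \<Longrightarrow> a - b \<in> gen S"

definition cj :: "'g::group_add \<Rightarrow> 'g \<Rightarrow> 'g" where
  "cj p a = p + a - p"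

definition sumset :: "'g::group_add set \<Rightarrow> 'g set \<Rightarrow> 'g set" (infixl \<open>\<boxplus>\<close> 65) where
  "A \<boxplus> B = {a + b | a b. a \<in> A \<and> b \<in> B}"

definition nsub :: "'g::group_add set \<Rightarrow> 'g set \<Rightarrow> bool" where
  "nsub \<Phi> N \<longleftrightarrow> subgrp N \<and> N \<subseteq> \<Phi> \<and> (\<forall>p\<in>\<Phi>. \<forall>n\<in>N. cj p n \<in> N)"

definition ncl :: "'g::group_add set \<Rightarrow> 'g set \<Rightarrow> 'g set" where
  "ncl \<Phi> S = gen {cj p s | p s. p \<in> \<Phi> \<and> s \<in> S}"

text \<open>Finitely generated as a normal subgroup; for the kernel of a map from a finitely generated
  free group onto a group this is finite presentability of that group.\<close>

definition fng :: "'g::group_add set \<Rightarrow> 'g set \<Rightarrow> bool" where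
  "fng \<Phi> N \<longleftrightarrow> (\<exists>S. finite S \<and> S \<subseteq> N \<and> N = ncl \<Phi> S)"

text \<open>Normalizing to sums of signed terms decides identities that hold in all groups; the
  default rule \<open>add_uminus_conv_diff\<close> has to be switched off to avoid a loop.\<close>

lemmas group_add_simps = diff_conv_add_uminus add.assoc minus_add minus_minus

lemma subgrp_zero: "subgrp H \<Longrightarrow> 0 \<in> H"
  by (simp add: subgrp_def)

lemma subgrp_diff: "subgrp H \<Longrightarrow> a \<in> H \<Longrightarrow> b \<in> H \<Longrightarrow> a - b \<in> H"
  by (simp add: subgrp_def)

lemma subgrp_uminus: "subgrp H \<Longrightarrow> a \<in> H \<Longrightarrow> - a \<in> H"
  using subgrp_diff[of H 0 a] subgrp_zero[of H] by simp

lemma subgrp_add: "subgrp H \<Longrightarrow> a \<in> H \<Longrightarrow> b \<in> H \<Longrightarrow> a + b \<in> H"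
  using subgrp_diff[of H a "- b"] subgrp_uminus[of H b] by simp

lemmas subgrp_closed = subgrp_zero subgrp_diff subgrp_uminus subgrp_add

lemma subgrp_gen: "subgrp (gen S)"
  by (simp add: subgrp_def gen.intros)

lemma gen_least: "S \<subseteq> H \<Longrightarrow> subgrp H \<Longrightarrow> gen S \<subseteq> H"
proof
  fix a assume "a \<in> gen S" and "S \<subseteq> H" "subgrp H"
  then show "a \<in> H" by (induction) (auto intro: subgrp_closed)
qed

lemma gen_mono: "S \<subseteq> T \<Longrightarrow> gen S \<subseteq> gen T"
  by (rule gen_least) (auto intro: gen_incl subgrp_gen)

lemma gen_subgrp: "subgrp H \<Longrightarrow> gen H = H"
  using gen_least[of H H] by (auto intro: gen_incl)

lemma subgrp_Int: "subgrp A \<Longrightarrow> subgrp B \<Longrightarrow> subgrp (A \<inter> B)"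
  by (auto simp: subgrp_def)

lemma cj_zero_left [simp]: "cj 0 a = a" by (simp add: cj_def)
lemma cj_zero_right [simp]: "cj p 0 = 0" by (simp add: cj_def)
lemma cj_add: "cj p (a + b) = cj p a + cj p b"
  by (simp add: cj_def group_add_simps del: add_uminus_conv_diff)
lemma cj_diff: "cj p (a - b) = cj p a - cj p b"
  by (simp add: cj_def group_add_simps del: add_uminus_conv_diff)
lemma cj_cj: "cj p (cj q a) = cj (p + q) a"
  by (simp add: cj_def group_add_simps del: add_uminus_conv_diff)
lemma cj_minus_cancel [simp]: "cj (- p) (cj p a) = a" "cj p (cj (- p) a) = a"
  by (simp_all add: cj_cj)
lemma cj_add_swap: "p + a = cj p a + p"
  by (simp add: cj_def group_add_simps del: add_uminus_conv_diff)

lemma cj_mem: "subgrp H \<Longrightarrow> p \<in> H \<Longrightarrow> a \<in> H \<Longrightarrow> cj p a \<in> H"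
  by (simp add: cj_def subgrp_closed)

lemma gen_cj_closed:
  assumes "\<And>s. s \<in> S \<Longrightarrow> cj p s \<in> gen S" "a \<in> gen S"
  shows "cj p a \<in> gen S"
  using assms(2)
  by induction (auto simp: cj_diff intro: assms(1) gen_zero gen_diff)

lemma sumsetI: "a \<in> A \<Longrightarrow> b \<in> B \<Longrightarrow> a + b \<in> A \<boxplus> B"
  by (auto simp: sumset_def)

lemma sumsetE: assumes "x \<in> A \<boxplus> B" obtains a b where "a \<in> A" "b \<in> B" "x = a + b"
  using assms by (auto simp: sumset_def)

lemma subgrp_sumset:
  assumes A: "subgrp A" and B: "subgrp B" and n: "\<And>b a. b \<in> B \<Longrightarrow> a \<in> A \<Longrightarrow> cj b a \<in> A"
  shows "subgrp (A \<boxplus> B)"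
  unfolding subgrp_def
proof (intro conjI ballI)
  show "0 \<in> A \<boxplus> B" using sumsetI[of 0 A 0 B] A B by (simp add: subgrp_closed)
  fix x y assume "x \<in> A \<boxplus> B" "y \<in> A \<boxplus> B"
  then obtain a b a' b' where *: "a \<in> A" "b \<in> B" "x = a + b" "a' \<in> A" "b' \<in> B" "y = a' + b'"
    by (metis sumsetE)
  have "x - y = (a - cj (b - b') a') + (b - b')"
    by (simp add: * cj_def group_add_simps del: add_uminus_conv_diff)
  then show "x - y \<in> A \<boxplus> B"
    using * A B n by (auto intro!: sumsetI subgrp_closed)
qed

lemma sumset_upper1: "subgrp B \<Longrightarrow> A \<subseteq> A \<boxplus> B"
  using sumsetI[of _ A 0 B] by (fastforce simp: subgrp_closed)

lemma sumset_upper2: "subgrp A \<Longrightarrow> B \<subseteq> A \<boxplus> B"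
  using sumsetI[of 0 A _ B] by (fastforce simp: subgrp_closed)

lemma sumset_least: "subgrp C \<Longrightarrow> A \<subseteq> C \<Longrightarrow> B \<subseteq> C \<Longrightarrow> A \<boxplus> B \<subseteq> C"
  by (auto elim!: sumsetE intro: subgrp_closed)

lemma sumset_mono: "A \<subseteq> A' \<Longrightarrow> B \<subseteq> B' \<Longrightarrow> A \<boxplus> B \<subseteq> A' \<boxplus> B'"
  by (auto simp: sumset_def)

section \<open>Normal subgroups\<close>

lemma nsubD:
  assumes "nsub \<Phi> N"
  shows "subgrp N" "N \<subseteq> \<Phi>" "\<And>p n. p \<in> \<Phi> \<Longrightarrow> n \<in> N \<Longrightarrow> cj p n \<in> N"
  using assms by (auto simp: nsub_def)

lemma nsub_Int: "nsub \<Phi> A \<Longrightarrow> nsub \<Phi> B \<Longrightarrow> nsub \<Phi> (A \<inter> B)"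
  by (auto simp: nsub_def subgrp_Int)

lemma nsub_sumset:
  assumes "nsub \<Phi> A" "nsub \<Phi> B" "subgrp \<Phi>"
  shows "nsub \<Phi> (A \<boxplus> B)"
  unfolding nsub_def
proof (intro conjI ballI)
  show "subgrp (A \<boxplus> B)"
    using assms by (intro subgrp_sumset) (auto simp: nsub_def)
  show "A \<boxplus> B \<subseteq> \<Phi>"
    using assms by (intro sumset_least) (auto simp: nsub_def)
  fix p n assume "p \<in> \<Phi>" "n \<in> A \<boxplus> B"
  then show "cj p n \<in> A \<boxplus> B"
    using assms by (auto elim!: sumsetE simp: cj_add nsub_def intro!: sumsetI)
qed

lemma nsub_ncl:
  assumes "subgrp \<Phi>" "S \<subseteq> \<Phi>" shows "nsub \<Phi> (ncl \<Phi> S)"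
  unfolding nsub_def
proof (intro conjI ballI)
  show "subgrp (ncl \<Phi> S)" by (simp add: ncl_def subgrp_gen)
  show "ncl \<Phi> S \<subseteq> \<Phi>" unfolding ncl_def
    using assms by (intro gen_least) (auto intro!: cj_mem)
  fix p n assume p: "p \<in> \<Phi>" and "n \<in> ncl \<Phi> S"
  then show "cj p n \<in> ncl \<Phi> S" unfolding ncl_def
    by (elim gen_cj_closed[rotated])
       (use p in \<open>force simp: cj_cj intro!: gen_incl intro: subgrp_add[OF assms(1)]\<close>)
qed

lemma ncl_incl: "subgrp \<Phi> \<Longrightarrow> S \<subseteq> ncl \<Phi> S"
proof
  fix s assume "subgrp \<Phi>" "s \<in> S"
  then have "cj 0 s \<in> ncl \<Phi> S"
    unfolding ncl_def by (intro gen_incl) (blast intro: subgrp_zero)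
  then show "s \<in> ncl \<Phi> S" by simp
qed

lemma ncl_least: "S \<subseteq> N \<Longrightarrow> nsub \<Phi> N \<Longrightarrow> ncl \<Phi> S \<subseteq> N"
  unfolding ncl_def by (rule gen_least) (auto simp: nsub_def)

lemma ncl_mono: "S \<subseteq> T \<Longrightarrow> ncl \<Phi> S \<subseteq> ncl \<Phi> T"
  unfolding ncl_def by (rule gen_mono) auto

lemma le_subgrp_of_generators:
  assumes "subgrp H" "gen X = H" "X \<subseteq> Q" "subgrp Q" shows "H \<subseteq> Q"
  using assms gen_least by blast

text \<open>The next two lemmas carry out all arguments of the form ``check commutation on generators''. They differ in the
  argument of the commutator that varies.\<close>

lemma subgrp_commutes_mod:
  assumes \<Phi>: "subgrp \<Phi>" and Q: "nsub \<Phi> Q"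
  shows "subgrp {p \<in> \<Phi>. cj p t - t \<in> Q}"
  unfolding subgrp_def
proof (intro conjI ballI)
  show "0 \<in> {p \<in> \<Phi>. cj p t - t \<in> Q}"
    using \<Phi> nsubD[OF Q] by (simp add: subgrp_closed)
  fix p q assume "p \<in> {p \<in> \<Phi>. cj p t - t \<in> Q}" "q \<in> {p \<in> \<Phi>. cj p t - t \<in> Q}"
  then have *: "p \<in> \<Phi>" "q \<in> \<Phi>" "cj p t - t \<in> Q" "cj q t - t \<in> Q" by auto
  have pq: "p - q \<in> \<Phi>" using * \<Phi> by (simp add: subgrp_closed)
  have "cj (p - q) t - t = cj (p - q) (- (cj q t - t)) + (cj p t - t)"
    by (simp add: cj_def group_add_simps del: add_uminus_conv_diff)
  moreover have "\<dots> \<in> Q"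
    by (intro subgrp_add nsubD(1)[OF Q] nsubD(3)[OF Q] pq subgrp_uminus) (use * in auto)
  ultimately show "p - q \<in> {p \<in> \<Phi>. cj p t - t \<in> Q}" using pq by simp
qed

definition central_mod :: "'g::group_add set \<Rightarrow> 'g set \<Rightarrow> 'g set" where
  "central_mod \<Phi> Q = {a \<in> \<Phi>. \<forall>p\<in>\<Phi>. cj p a - a \<in> Q}"

lemma subgrp_centralizer_mod:
  assumes \<Phi>: "subgrp \<Phi>" and Q: "nsub \<Phi> Q" and K: "K \<subseteq> \<Phi>"
  shows "subgrp {a \<in> \<Phi>. \<forall>p\<in>K. cj p a - a \<in> Q}"
  unfolding subgrp_def
proof (intro conjI ballI)
  show "0 \<in> {a \<in> \<Phi>. \<forall>p\<in>K. cj p a - a \<in> Q}"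
    using \<Phi> nsubD[OF Q] by (simp add: subgrp_closed)
  fix a b assume "a \<in> {a \<in> \<Phi>. \<forall>p\<in>K. cj p a - a \<in> Q}" "b \<in> {a \<in> \<Phi>. \<forall>p\<in>K. cj p a - a \<in> Q}"
  then have *: "a \<in> \<Phi>" "b \<in> \<Phi>" "\<And>p. p \<in> K \<Longrightarrow> cj p a - a \<in> Q" "\<And>p. p \<in> K \<Longrightarrow> cj p b - b \<in> Q"
    by auto
  have ab: "a - b \<in> \<Phi>" using * \<Phi> by (simp add: subgrp_closed)
  have "cj p (a - b) - (a - b) \<in> Q" if "p \<in> K" for p
  proof -
    have "cj p (a - b) - (a - b) = (cj p a - a) + cj (a - b) (- (cj p b - b))"
      by (simp add: cj_def group_add_simps del: add_uminus_conv_diff)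
    moreover have "\<dots> \<in> Q"
      by (intro subgrp_add nsubD(1)[OF Q] nsubD(3)[OF Q] ab subgrp_uminus *(3,4) that)
    ultimately show ?thesis by simp
  qed
  then show "a - b \<in> {a \<in> \<Phi>. \<forall>p\<in>K. cj p a - a \<in> Q}" using ab by simp
qed

lemma subgrp_central_mod: "subgrp \<Phi> \<Longrightarrow> nsub \<Phi> Q \<Longrightarrow> subgrp (central_mod \<Phi> Q)"
  unfolding central_mod_def by (rule subgrp_centralizer_mod) auto

text \<open>The image of \<open>H\<close> in the quotient by \<open>Q\<close> is central, and subgroups of the
  center are normal.\<close>

lemma nsub_between_central:
  assumes "subgrp H" "Q \<subseteq> H" "H \<subseteq> central_mod \<Phi> Q"
  shows "nsub \<Phi> H"
  unfolding nsub_def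
proof (intro conjI ballI assms)
  show "H \<subseteq> \<Phi>" using assms by (auto simp: central_mod_def)
  fix p n assume "p \<in> \<Phi>" "n \<in> H"
  then have "cj p n - n \<in> Q" using assms by (auto simp: central_mod_def)
  then have "(cj p n - n) + n \<in> H" using assms \<open>n \<in> H\<close> by (blast intro: subgrp_add)
  then show "cj p n \<in> H" by simp
qed

lemma central_mod_upper: "nsub \<Phi> Q \<Longrightarrow> Q \<subseteq> central_mod \<Phi> Q"
  by (auto simp: central_mod_def nsub_def intro: subgrp_closed)

section \<open>Cyclic subgroups\<close>

definition nmul :: "nat \<Rightarrow> 'g::group_add \<Rightarrow> 'g" where
  "nmul n t = ((+) t ^^ n) 0"

lemma nmul_simps [simp]: "nmul 0 t = 0" "nmul (Suc n) t = t + nmul n t"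
  by (simp_all add: nmul_def)

lemma nmul_add: "nmul (m + n) t = nmul m t + nmul n t"
  by (induction m) (simp_all add: add.assoc)

lemma nmul_mult: "nmul (m * n) t = nmul m (nmul n t)"
  by (induction m) (simp_all add: nmul_add)

lemma nmul_mem: "subgrp H \<Longrightarrow> t \<in> H \<Longrightarrow> nmul n t \<in> H"
  by (induction n) (auto intro: subgrp_closed)

lemma nmul_diff: "n \<le> m \<Longrightarrow> nmul m t - nmul n t = nmul (m - n) t"
  using nmul_add[of "m - n" n t] by simp

lemma nmul_minus_add: "n \<le> m \<Longrightarrow> - nmul n t + nmul m t = nmul (m - n) t"
  using nmul_add[of n "m - n" t] by (simp add: add.assoc[symmetric])

lemma nmul_diff_cases: "\<exists>k. nmul m t - nmul n t = nmul k t \<or> nmul m t - nmul n t = - nmul k t"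
proof (cases "n \<le> m")
  case False
  then have "nmul m t - nmul n t = - nmul (n - m) t"
    using nmul_diff[of m n t] by (metis linorder_le_cases minus_diff_eq)
  then show ?thesis by blast
qed (auto simp: nmul_diff)

lemma nmul_minus_add_cases: "\<exists>k. - nmul n t + nmul m t = nmul k t \<or> - nmul n t + nmul m t = - nmul k t"
proof (cases "n \<le> m")
  case False
  then have "- nmul n t + nmul m t = - nmul (n - m) t"
    using nmul_minus_add[of m n t] by (metis linorder_le_cases minus_add minus_minus)
  then show ?thesis by blast
qed (auto simp: nmul_minus_add)

lemma gen_single: assumes "a \<in> gen {t}" obtains n where "a = nmul n t \<or> a = - nmul n t"
proof -
  from assms have "\<exists>n. a = nmul n t \<or> a = - nmul n t"
  proof induction
    case gen_zero then show ?case by (metis nmul_simps(1))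
  next
    case (gen_incl a) then show ?case by (intro exI[of _ 1]) simp
  next
    case (gen_diff a b)
    then obtain m n where *: "a = nmul m t \<or> a = - nmul m t" "b = nmul n t \<or> b = - nmul n t" by blast
    have 1: "- nmul m t - nmul n t = - nmul (n + m) t"
      by (simp add: nmul_add minus_add)
    show ?case
      using * nmul_diff_cases[of m t n] nmul_minus_add_cases[of m t n] nmul_add[of m n t] 1 by (auto; metis)
  qed
  then show ?thesis using that by blast
qed

text \<open>As for ideals of the integers: the least positive multiple of \<open>t\<close> in \<open>H\<close>
  generates \<open>H\<close>.\<close>

lemma subgrp_of_cyclic:
  assumes H: "subgrp H" and sub: "H \<subseteq> gen {t}"
  obtains d where "H = gen {d}"
proof (cases "\<exists>n>0. nmul n t \<in> H")
  case False
  have "H \<subseteq> {0}"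
  proof
    fix a assume a: "a \<in> H"
    then obtain n where n: "a = nmul n t \<or> a = - nmul n t" using sub gen_single by blast
    then have "nmul n t \<in> H" using a subgrp_uminus[OF H a] by auto
    then have "n = 0" using False by auto
    then show "a \<in> {0}" using n by simp
  qed
  then have "H = gen {0}" using gen_least[of "{0}" H] H by (auto simp: subgrp_closed gen_zero)
  then show ?thesis using that by blast
next
  case True
  define n where "n = (LEAST n. n > 0 \<and> nmul n t \<in> H)"
  have n: "n > 0" "nmul n t \<in> H" and least: "\<And>k. k > 0 \<Longrightarrow> nmul k t \<in> H \<Longrightarrow> n \<le> k"
    using LeastI_ex[of "\<lambda>n. n > 0 \<and> nmul n t \<in> H"] True Least_le[of "\<lambda>n. n > 0 \<and> nmul n t \<in> H"]
    unfolding n_def by auto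
  let ?D = "gen {nmul n t}"
  have D: "subgrp ?D" by (rule subgrp_gen)
  have pos: "nmul k t \<in> ?D" if k: "nmul k t \<in> H" for k
  proof -
    have "nmul k t = nmul (k div n) (nmul n t) + nmul (k mod n) t"
      using nmul_add[of "k div n * n" "k mod n" t] by (simp add: nmul_mult)
    moreover have "nmul (k div n) (nmul n t) \<in> H" using n H by (simp add: nmul_mem)
    moreover have "nmul (k mod n) t = - nmul (k div n) (nmul n t) + nmul k t"
      unfolding calculation(1) by (simp add: add.assoc[symmetric])
    ultimately have "nmul (k mod n) t \<in> H"
      using k subgrp_add[OF H subgrp_uminus[OF H]] by metis
    then have "k mod n = 0" using least[of "k mod n"] mod_less_divisor[OF n(1), of k] by linarith
    then have "nmul k t = nmul (k div n) (nmul n t)"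
      using nmul_mult[of "k div n" n t] n(1) by auto
    then show ?thesis using D by (simp add: nmul_mem gen_incl)
  qed
  have "H \<subseteq> ?D"
  proof
    fix a assume a: "a \<in> H"
    then obtain k where k: "a = nmul k t \<or> a = - nmul k t" using sub gen_single by blast
    then have "nmul k t \<in> H" using a subgrp_uminus[OF H a] by auto
    then show "a \<in> ?D" using k pos D subgrp_uminus by blast
  qed
  moreover have "?D \<subseteq> H" using n H by (intro gen_least) auto
  ultimately show ?thesis using that by blast
qed

section \<open>Central cyclic extensions\<close>

text \<open>A chain of steps from \<open>Z\<close> up to \<open>\<Phi>\<close> shows that \<open>\<Phi> / Z\<close> is polycyclic (and nilpotent). Splitting a central
  series into cyclic steps makes both inductions below, down the chain for finite normal generation and up the
  chain for the Noetherian property, adjoin a single element at a time.\<close>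

definition cstep :: "'g::group_add set \<Rightarrow> 'g set \<Rightarrow> 'g set \<Rightarrow> bool" where
  "cstep \<Phi> P P' \<longleftrightarrow> nsub \<Phi> P \<and> (\<exists>t\<in>central_mod \<Phi> P. P' = P \<boxplus> gen {t})"

lemma sumset_gen_central:
  assumes "subgrp \<Phi>" "nsub \<Phi> P" "t \<in> central_mod \<Phi> P"
  shows "nsub \<Phi> (P \<boxplus> gen {t})"
proof -
  have t: "gen {t} \<subseteq> central_mod \<Phi> P"
    using assms by (intro gen_least subgrp_central_mod) auto
  then have "gen {t} \<subseteq> \<Phi>" by (auto simp: central_mod_def)
  then have s: "subgrp (P \<boxplus> gen {t})"
    using nsubD[OF assms(2)] by (intro subgrp_sumset subgrp_gen) auto
  have "P \<boxplus> gen {t} \<subseteq> central_mod \<Phi> P"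
    by (rule sumset_least[OF subgrp_central_mod[OF assms(1,2)] central_mod_upper[OF assms(2)] t])
  then show ?thesis
    by (rule nsub_between_central[OF s sumset_upper1[OF subgrp_gen]])
qed

lemma cstep_nsub: "subgrp \<Phi> \<Longrightarrow> cstep \<Phi> P P' \<Longrightarrow> nsub \<Phi> P \<and> nsub \<Phi> P'"
  by (auto simp: cstep_def sumset_gen_central)

text \<open>Finitely many relators express the generators of \<open>P'\<close> by \<open>t\<close> modulo \<open>P\<close>, make \<open>t\<close> central, and give the
  order of \<open>t\<close> modulo \<open>P\<close> if it is finite. Modulo these, \<open>P'\<close> is cyclic and \<open>P\<close> is trivial.\<close>

lemma fng_cstep_down:
  assumes \<Phi>: "subgrp \<Phi>" and X: "finite X" "gen X = \<Phi>" and st: "cstep \<Phi> P P'" and f: "fng \<Phi> P'"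
  shows "fng \<Phi> P"
proof -
  obtain t where P: "nsub \<Phi> P" and t: "t \<in> central_mod \<Phi> P" and P': "P' = P \<boxplus> gen {t}"
    using st by (auto simp: cstep_def)
  obtain Y where Y: "finite Y" "P' = ncl \<Phi> Y" "Y \<subseteq> P'" using f by (auto simp: fng_def)
  have "\<forall>y\<in>Y. \<exists>p c. p \<in> P \<and> c \<in> gen {t} \<and> y = p + c"
    using Y(3) unfolding P' sumset_def by blast
  then obtain p c where pc: "\<And>y. y \<in> Y \<Longrightarrow> p y \<in> P \<and> c y \<in> gen {t} \<and> y = p y + c y" by metis
  have "subgrp (P \<inter> gen {t})" using P by (intro subgrp_Int subgrp_gen) (simp add: nsub_def)
  \<comment> \<open>\<open>d\<close> is the multiple of \<open>t\<close> given by its order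
    modulo \<open>P\<close>, and \<open>0\<close> if the order is infinite\<close>
  then obtain d where d: "P \<inter> gen {t} = gen {d}" using subgrp_of_cyclic[of "P \<inter> gen {t}" t] by blast
  define R where "R = p ` Y \<union> (\<lambda>x. cj x t - t) ` X \<union> {d}"
  have XF: "X \<subseteq> \<Phi>" using X gen_incl by blast
  have RP: "R \<subseteq> P"
    using pc t XF d gen_incl[of d "{d}"] by (auto simp: R_def central_mod_def)
  then have RF: "R \<subseteq> \<Phi>" using P by (auto simp: nsub_def)
  define Q where "Q = ncl \<Phi> R"
  have Q: "nsub \<Phi> Q" and RQ: "R \<subseteq> Q"
    using nsub_ncl[OF \<Phi> RF] ncl_incl[OF \<Phi>] by (auto simp: Q_def)
  have QP: "Q \<subseteq> P" unfolding Q_def by (rule ncl_least[OF RP P])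
  have tF: "t \<in> \<Phi>" using t by (auto simp: central_mod_def)
  have "X \<subseteq> {p \<in> \<Phi>. cj p t - t \<in> Q}" using XF RQ by (auto simp: R_def)
  then have "\<Phi> \<subseteq> {p \<in> \<Phi>. cj p t - t \<in> Q}"
    using gen_least[OF _ subgrp_commutes_mod[OF \<Phi> Q]] X(2) by blast
  then have tc: "t \<in> central_mod \<Phi> Q" using tF by (auto simp: central_mod_def)
  have QN: "nsub \<Phi> (Q \<boxplus> gen {t})" by (rule sumset_gen_central[OF \<Phi> Q tc])
  have "y \<in> Q \<boxplus> gen {t}" if "y \<in> Y" for y
    using pc[OF that] RQ that sumsetI[of "p y" Q "c y" "gen {t}"] by (auto simp: R_def)
  then have "Y \<subseteq> Q \<boxplus> gen {t}" by blast
  then have P'Q: "P' \<subseteq> Q \<boxplus> gen {t}" using Y(2) ncl_least[OF _ QN] by blast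
  have "P \<subseteq> Q"
  proof
    fix a assume a: "a \<in> P"
    then have "a \<in> P'" using sumset_upper1[OF subgrp_gen] P' by blast
    then obtain q e where qe: "q \<in> Q" "e \<in> gen {t}" "a = q + e" using P'Q sumsetE by blast
    then have "e = - q + a" by (simp add: add.assoc[symmetric])
    moreover have "- q + a \<in> P"
      by (intro subgrp_add subgrp_uminus nsubD(1)[OF P] a) (use qe QP in auto)
    ultimately have "e \<in> P" by simp
    then have "e \<in> gen {d}" using qe d by blast
    moreover have "gen {d} \<subseteq> Q" using RQ nsubD(1)[OF Q] by (intro gen_least) (auto simp: R_def)
    ultimately show "a \<in> Q" using qe nsubD(1)[OF Q] by (auto intro: subgrp_closed)
  qed
  then have "P = ncl \<Phi> R" using QP Q_def by blast
  moreover have "finite R" using Y X by (simp add: R_def)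
  ultimately show ?thesis using RP by (auto simp: fng_def)
qed

lemma fng_chain_down:
  assumes \<Phi>: "subgrp \<Phi>" and X: "finite X" "gen X = \<Phi>"
    and ch: "(cstep \<Phi>)\<^sup>*\<^sup>* P \<Phi>"
  shows "fng \<Phi> P"
  using ch
proof (induction rule: converse_rtranclp_induct)
  case base
  have "X \<subseteq> \<Phi>" using X gen_incl by blast
  moreover have "\<Phi> = ncl \<Phi> X"
    using ncl_incl[OF \<Phi>, of X] nsub_ncl[OF \<Phi>, of X] \<open>X \<subseteq> \<Phi>\<close> X
      le_subgrp_of_generators[OF \<Phi> X(2)] by (auto simp: nsub_def)
  ultimately show ?case using X by (auto simp: fng_def)
next
  case (step P P')
  then show ?case using fng_cstep_down[OF \<Phi> X] by blast
qed

text \<open>Modulo \<open>N1\<close> the conjugates of the finitely many normal generators of \<open>N\<close> are the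
  generators themselves, so adjoining these one by one reaches \<open>N\<close>.\<close>

lemma chain_of_central:
  assumes \<Phi>: "subgrp \<Phi>" and N: "fng \<Phi> N" and N1: "nsub \<Phi> N1" and sub: "N1 \<subseteq> N"
    and c: "N \<subseteq> central_mod \<Phi> N1"
  shows "(cstep \<Phi>)\<^sup>*\<^sup>* N1 N"
proof -
  obtain Y where Y: "finite Y" "N = ncl \<Phi> Y" "Y \<subseteq> N" using N by (auto simp: fng_def)
  have cm: "subgrp (central_mod \<Phi> N1)" by (rule subgrp_central_mod[OF \<Phi> N1])
  have "(cstep \<Phi>)\<^sup>*\<^sup>* N1 (gen (N1 \<union> Z))" if "finite Z" "Z \<subseteq> Y" for Z
    using that
  proof (induction Z rule: finite_induct)
    case empty
    then show ?case using N1 by (simp add: gen_subgrp nsub_def)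
  next
    case (insert y Z)
    let ?P = "gen (N1 \<union> Z)"
    have NZ: "N1 \<union> Z \<subseteq> central_mod \<Phi> N1"
      using insert.prems Y(3) c central_mod_upper[OF N1] by blast
    have P: "nsub \<Phi> ?P"
      by (rule nsub_between_central[OF subgrp_gen _ gen_least[OF NZ cm]]) (simp add: gen_incl subsetI)
    have y: "y \<in> central_mod \<Phi> ?P"
      using insert.prems Y(3) c by (auto simp: central_mod_def intro: gen_incl)
    have "cstep \<Phi> ?P (?P \<boxplus> gen {y})" using P y by (auto simp: cstep_def)
    moreover have "?P \<boxplus> gen {y} = gen (N1 \<union> insert y Z)"
    proof
      show "?P \<boxplus> gen {y} \<subseteq> gen (N1 \<union> insert y Z)"
        by (intro sumset_least subgrp_gen gen_mono) auto
      have "subgrp (?P \<boxplus> gen {y})" using sumset_gen_central[OF \<Phi> P y] by (simp add: nsub_def)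
      moreover have "N1 \<union> insert y Z \<subseteq> ?P \<boxplus> gen {y}"
        using sumset_upper1[OF subgrp_gen, of ?P "{y}"] sumset_upper2[OF subgrp_gen, of "gen {y}" "N1 \<union> Z"]
        by (auto intro: gen_incl)
      ultimately show "gen (N1 \<union> insert y Z) \<subseteq> ?P \<boxplus> gen {y}" by (intro gen_least)
    qed
    ultimately have "cstep \<Phi> ?P (gen (N1 \<union> insert y Z))" by simp
    then show ?case using insert.IH insert.prems by (auto intro: rtranclp.rtrancl_into_rtrancl)
  qed
  from this[OF Y(1) order_refl] have ch: "(cstep \<Phi>)\<^sup>*\<^sup>* N1 (gen (N1 \<union> Y))" .
  have 1: "gen (N1 \<union> Y) \<subseteq> N"
    using sub Y nsub_ncl[OF \<Phi>, of Y] c by (intro gen_least) (auto simp: nsub_def central_mod_def)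
  have "nsub \<Phi> (gen (N1 \<union> Y))"
    by (rule nsub_between_central[OF subgrp_gen _ subset_trans[OF 1 c]]) (simp add: gen_incl subsetI)
  then have "N \<subseteq> gen (N1 \<union> Y)" unfolding Y(2) by (intro ncl_least) (auto intro: gen_incl)
  then have "gen (N1 \<union> Y) = N" using 1 by (rule subset_antisym[rotated])
  then show ?thesis using ch by simp
qed

section \<open>Noetherian modules\<close>

text \<open>The module is \<open>W / V\<close>, on which every subgroup of \<open>\<Phi>\<close> acts by conjugation. Submodules are represented by their
  preimages, which lie between \<open>V\<close> and \<open>W\<close>.\<close>

locale abelian_section =
  fixes \<Phi> V W :: "'g::group_add set"
  assumes \<Phi>: "subgrp \<Phi>" and V: "nsub \<Phi> V" and W: "nsub \<Phi> W" and VW: "V \<subseteq> W"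
    and abelian: "\<And>a b. a \<in> W \<Longrightarrow> b \<in> W \<Longrightarrow> cj a b - b \<in> V"
begin

definition submod :: "'g set \<Rightarrow> 'g set \<Rightarrow> bool" where
  "submod P A \<longleftrightarrow> subgrp A \<and> V \<subseteq> A \<and> A \<subseteq> W \<and> (\<forall>p\<in>P. \<forall>a\<in>A. cj p a \<in> A)"

definition modspan :: "'g set \<Rightarrow> 'g set \<Rightarrow> 'g set" where
  "modspan P Y = gen (V \<union> {cj p y | p y. p \<in> P \<and> y \<in> Y})"

definition noeth :: "'g set \<Rightarrow> bool" where
  "noeth P \<longleftrightarrow> (\<forall>Y A. finite Y \<and> Y \<subseteq> W \<and> submod P A \<and> A \<subseteq> modspan P Y \<longrightarrow>
     (\<exists>Z. finite Z \<and> Z \<subseteq> A \<and> A = modspan P Z))"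

lemma noethD:
  assumes "noeth P" "finite Y" "Y \<subseteq> W" "submod P A" "A \<subseteq> modspan P Y"
  obtains Z where "finite Z" "Z \<subseteq> A" "A = modspan P Z"
  using assms(1)[unfolded noeth_def, rule_format, of Y A] assms(2-5) that by blast

lemma submodD:
  assumes "submod P A"
  shows "subgrp A" "V \<subseteq> A" "A \<subseteq> W" "\<And>p a. p \<in> P \<Longrightarrow> a \<in> A \<Longrightarrow> cj p a \<in> A"
  using assms by (auto simp: submod_def)

lemma cj_W: "p \<in> \<Phi> \<Longrightarrow> a \<in> W \<Longrightarrow> cj p a \<in> W"
  by (rule nsubD(3)[OF W])

lemma cj_V: "p \<in> \<Phi> \<Longrightarrow> a \<in> V \<Longrightarrow> cj p a \<in> V"
  by (rule nsubD(3)[OF V])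

lemma cj_normalizes:
  assumes "subgrp A" "V \<subseteq> A" "A \<subseteq> W" "w \<in> W" "a \<in> A" shows "cj w a \<in> A"
proof -
  have "(cj w a - a) + a \<in> A"
    using abelian[of w a] assms by (intro subgrp_add) auto
  then show ?thesis by simp
qed

lemma subgrp_sum:
  assumes "subgrp A" "V \<subseteq> A" "A \<subseteq> W" "subgrp B" "B \<subseteq> W"
  shows "subgrp (A \<boxplus> B)"
proof (rule subgrp_sumset[OF assms(1,4)])
  fix b a assume "b \<in> B" "a \<in> A"
  then show "cj b a \<in> A" using assms(5) by (blast intro: cj_normalizes[OF assms(1-3)])
qed

lemma submod_sum:
  assumes "submod P A" "submod P B"
  shows "submod P (A \<boxplus> B)"
  unfolding submod_def
proof (intro conjI ballI)
  show "subgrp (A \<boxplus> B)" using submodD[OF assms(1)] submodD[OF assms(2)] by (intro subgrp_sum)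
  show "V \<subseteq> A \<boxplus> B" using submodD[OF assms(1)] sumset_upper1[OF submodD(1)[OF assms(2)]] by blast
  show "A \<boxplus> B \<subseteq> W"
    using submodD[OF assms(1)] submodD[OF assms(2)] nsubD[OF W] by (intro sumset_least)
  fix p a assume "p \<in> P" "a \<in> A \<boxplus> B"
  then show "cj p a \<in> A \<boxplus> B"
    using submodD(4)[OF assms(1)] submodD(4)[OF assms(2)]
    by (auto elim!: sumsetE simp: cj_add intro!: sumsetI)
qed

lemma submod_Int: "submod P A \<Longrightarrow> submod P B \<Longrightarrow> submod P (A \<inter> B)"
  by (auto simp: submod_def subgrp_Int)

lemma modspan_upper: "Y \<subseteq> modspan P Y" if "0 \<in> P"
proof
  fix y assume "y \<in> Y"
  then have "cj 0 y \<in> modspan P Y"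
    unfolding modspan_def using that by (intro gen_incl) blast
  then show "y \<in> modspan P Y" by simp
qed

lemma V_modspan: "V \<subseteq> modspan P Y"
  by (auto simp: modspan_def intro: gen_incl)

lemma modspan_least: "submod P A \<Longrightarrow> Y \<subseteq> A \<Longrightarrow> modspan P Y \<subseteq> A"
  unfolding modspan_def by (rule gen_least) (auto simp: submod_def)

lemma submod_modspan:
  assumes P: "subgrp P" "P \<subseteq> \<Phi>" and Y: "Y \<subseteq> W"
  shows "submod P (modspan P Y)"
  unfolding submod_def
proof (intro conjI ballI V_modspan)
  show "subgrp (modspan P Y)" by (simp add: modspan_def subgrp_gen)
  show "modspan P Y \<subseteq> W"
    unfolding modspan_def using VW Y P nsubD(1)[OF W] by (intro gen_least) (auto intro!: cj_W)
  fix p a assume p: "p \<in> P" and "a \<in> modspan P Y"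
  then show "cj p a \<in> modspan P Y"
    unfolding modspan_def
  proof (elim gen_cj_closed[rotated])
    fix s assume "s \<in> V \<union> {cj p y |p y. p \<in> P \<and> y \<in> Y}"
    then have "cj p s \<in> V \<or> (\<exists>q y. q \<in> P \<and> y \<in> Y \<and> s = cj q y)"
      using cj_V p P by auto
    then show "cj p s \<in> gen (V \<union> {cj p y |p y. p \<in> P \<and> y \<in> Y})"
      using p subgrp_add[OF P(1)] by (force simp: cj_cj intro!: gen_incl)
  qed
qed

text \<open>Over a group that acts trivially, submodules are subgroups of an abelian group; this is the fact that subgroups
  of finitely generated abelian groups are finitely generated.\<close>

lemma noeth_trivial_action:
  assumes Z: "subgrp Z" and ZF: "Z \<subseteq> \<Phi>" and triv: "\<And>z w. z \<in> Z \<Longrightarrow> w \<in> W \<Longrightarrow> cj z w - w \<in> V"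
  shows "noeth Z"
proof -
  have sub: "submod Z A" if "subgrp A" "V \<subseteq> A" "A \<subseteq> W" for A
    unfolding submod_def
  proof (intro conjI that ballI)
    fix z a assume "z \<in> Z" "a \<in> A"
    then have "(cj z a - a) + a \<in> A" using triv[of z a] that by (intro subgrp_add) auto
    then show "cj z a \<in> A" by simp
  qed
  have span: "modspan Z Y = gen (V \<union> Y)" if "Y \<subseteq> W" for Y
  proof
    show "gen (V \<union> Y) \<subseteq> modspan Z Y"
      using V_modspan[of Z Y] modspan_upper[OF subgrp_zero[OF Z], of Y]
      by (intro gen_least) (auto simp: modspan_def subgrp_gen)
    have "gen (V \<union> Y) \<subseteq> W" using that VW nsubD[OF W] by (intro gen_least) auto
    then show "modspan Z Y \<subseteq> gen (V \<union> Y)"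
      by (intro modspan_least sub subgrp_gen) (auto intro: gen_incl)
  qed
  have main: "\<exists>Z. finite Z \<and> Z \<subseteq> A \<and> A = gen (V \<union> Z)"
    if "finite Y" "Y \<subseteq> W" "subgrp A" "V \<subseteq> A" "A \<subseteq> gen (V \<union> Y)" for Y A
    using that
  proof (induction Y arbitrary: A rule: finite_induct)
    case empty
    then have "A = gen (V \<union> {})" using nsubD(1)[OF V] by (simp add: gen_subgrp subset_antisym)
    then show ?case by blast
  next
    case (insert y Y)
    let ?E = "gen (V \<union> Y)"
    have yW: "y \<in> W" "Y \<subseteq> W" using insert.prems by blast+
    have "V \<union> Y \<subseteq> W" "{y} \<subseteq> W" using VW yW by simp_all
    then have EW: "?E \<subseteq> W" and CW: "gen {y} \<subseteq> W"
      using nsubD(1)[OF W] by (simp_all only: gen_least)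
    have "V \<subseteq> ?E" by (rule subsetI, rule gen_incl) simp
    note E = subgrp_gen[of "V \<union> Y"] this EW
    note C = subgrp_gen[of "{y}"] CW
    have AW: "A \<subseteq> W"
    proof -
      have "gen (V \<union> insert y Y) \<subseteq> W" using insert.prems VW nsubD(1)[OF W] by (intro gen_least) auto
      then show ?thesis using insert.prems by blast
    qed
    have "gen (V \<union> insert y Y) \<subseteq> ?E \<boxplus> gen {y}"
      using sumset_upper1[OF C(1), of ?E] sumset_upper2[OF E(1), of "gen {y}"]
      by (intro gen_least subgrp_sum E C) (auto intro: gen_incl)
    then have AE: "A \<subseteq> ?E \<boxplus> gen {y}" using insert.prems by blast
    have EA: "subgrp (?E \<boxplus> A)" using E insert.prems AW by (intro subgrp_sum)
    \<comment> \<open>the coefficients of \<open>y\<close> that occur in elements of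
      \<open>A\<close> form a cyclic group\<close>
    obtain d where d: "gen {y} \<inter> (?E \<boxplus> A) = gen {d}"
      using subgrp_of_cyclic[OF subgrp_Int[OF C(1) EA]] by blast
    then have "d \<in> ?E \<boxplus> A" using gen_incl[of d "{d}"] by blast
    then obtain e a where ea: "e \<in> ?E" "a \<in> A" "d = e + a" by (rule sumsetE)
    have "\<exists>Z. finite Z \<and> Z \<subseteq> A \<inter> ?E \<and> A \<inter> ?E = gen (V \<union> Z)"
      using insert.prems E by (intro insert.IH) (auto intro: subgrp_Int)
    then obtain Z where Z: "finite Z" "Z \<subseteq> A \<inter> ?E" "A \<inter> ?E = gen (V \<union> Z)" by blast
    have aW: "gen {a} \<subseteq> W" using AW ea nsubD(1)[OF W] by (intro gen_least) auto
    have Ea: "subgrp (?E \<boxplus> gen {a})" by (intro subgrp_sum E subgrp_gen aW)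
    have dE: "gen {d} \<subseteq> ?E \<boxplus> gen {a}"
      using ea by (intro gen_least Ea) (auto intro: sumsetI gen_incl)
    have aA: "gen {a} \<subseteq> A" using ea insert.prems by (intro gen_least) auto
    have "A \<subseteq> gen (V \<union> insert a Z)"
    proof
      fix x assume x: "x \<in> A"
      then obtain e' c where ec: "e' \<in> ?E" "c \<in> gen {y}" "x = e' + c" using AE sumsetE by blast
      have "c = - e' + x" using ec by (simp add: add.assoc[symmetric])
      then have "c \<in> ?E \<boxplus> A" using sumsetI[OF subgrp_uminus[OF E(1) ec(1)] x] by simp
      then have "c \<in> gen {d}" unfolding d[symmetric] using ec by simp
      then have "c \<in> ?E \<boxplus> gen {a}" by (rule subsetD[OF dE])
      then obtain e2 a2 where e2: "e2 \<in> ?E" "a2 \<in> gen {a}" "c = e2 + a2" by (rule sumsetE)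
      have "x - a2 = e' + e2" using ec e2 by (simp add: add.assoc[symmetric])
      then have "x - a2 \<in> ?E" using subgrp_add[OF E(1) ec(1) e2(1)] by simp
      moreover have "x - a2 \<in> A" using aA e2 by (intro subgrp_diff insert.prems(2) x) blast
      ultimately have "x - a2 \<in> A \<inter> ?E" by simp
      then have "x - a2 \<in> gen (V \<union> insert a Z)"
        using Z gen_mono[of "V \<union> Z" "V \<union> insert a Z"] by blast
      moreover have "a2 \<in> gen (V \<union> insert a Z)"
        using e2 gen_mono[of "{a}" "V \<union> insert a Z"] by blast
      ultimately have "(x - a2) + a2 \<in> gen (V \<union> insert a Z)" by (intro subgrp_add subgrp_gen)
      then show "x \<in> gen (V \<union> insert a Z)" by simp
    qed
    moreover have "gen (V \<union> insert a Z) \<subseteq> A"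
      using insert.prems ea Z by (intro gen_least) auto
    ultimately show ?case using Z ea by (intro exI[of _ "insert a Z"]) auto
  qed
  show ?thesis unfolding noeth_def
  proof (intro allI impI, elim conjE)
    fix Y A assume "finite Y" "Y \<subseteq> W" "submod Z A" "A \<subseteq> modspan Z Y"
    then show "\<exists>Z'. finite Z' \<and> Z' \<subseteq> A \<and> A = modspan Z Z'"
      using main[of Y A] span submodD[of Z A] by (metis subset_trans)
  qed
qed

end

lemma funpow_cj_diff: "(cj t ^^ n) (a - b) = (cj t ^^ n) a - (cj t ^^ n) b"
  by (induction n) (simp_all add: cj_diff)

lemma cj_cj_twist: "cj t (cj p a) = cj (cj t p) (cj t a)"
  by (simp add: cj_def group_add_simps del: add_uminus_conv_diff)

lemma funpow_cj_cj: "(cj t ^^ n) (cj p a) = cj ((cj t ^^ n) p) ((cj t ^^ n) a)"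
proof (induction n)
  case (Suc n)
  have "(cj t ^^ Suc n) (cj p a) = cj t (cj ((cj t ^^ n) p) ((cj t ^^ n) a))" by (simp add: Suc)
  also have "\<dots> = cj (cj t ((cj t ^^ n) p)) (cj t ((cj t ^^ n) a))" by (rule cj_cj_twist)
  finally show ?case by simp
qed simp

lemma funpow_cj_mem: "(\<And>a. a \<in> A \<Longrightarrow> cj t a \<in> A) \<Longrightarrow> a \<in> A \<Longrightarrow> (cj t ^^ n) a \<in> A"
  by (induction n) auto

lemma funpow_cj_inverse: "(cj (- t) ^^ n) ((cj t ^^ n) a) = a"
proof (induction n)
  case (Suc n)
  have "(cj (- t) ^^ Suc n) ((cj t ^^ Suc n) a) = (cj (- t) ^^ n) (cj (- t) (cj t ((cj t ^^ n) a)))"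
    by (simp add: funpow_swap1)
  then show ?case using Suc by simp
qed simp

lemma gen_invariant:
  assumes "\<And>s x. s \<in> S \<Longrightarrow> x \<in> D \<Longrightarrow> cj s x \<in> D \<and> cj (- s) x \<in> D"
    and "p \<in> gen S"
  shows "\<forall>x\<in>D. cj p x \<in> D \<and> cj (- p) x \<in> D"
  using assms(2)
proof induction
  case (gen_diff a b)
  have "cj (a - b) x = cj a (cj (- b) x)" "cj (- (a - b)) x = cj b (cj (- a) x)" for x
    by (simp_all add: cj_cj)
  then show ?case using gen_diff by simp
qed (use assms(1) in auto)

context abelian_section
begin

lemma submod_image:
  assumes A: "submod P A" and t: "t \<in> \<Phi>" and P: "\<And>p. p \<in> P \<Longrightarrow> cj (- t) p \<in> P"
  shows "submod P (cj t ` A)"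
  unfolding submod_def
proof (intro conjI ballI)
  note A = submodD[OF A]
  show "subgrp (cj t ` A)" unfolding subgrp_def
  proof (intro conjI ballI)
    show "0 \<in> cj t ` A" using subgrp_zero[OF A(1)] by force
    fix x y assume "x \<in> cj t ` A" "y \<in> cj t ` A"
    then obtain a b where "a \<in> A" "b \<in> A" "x = cj t a" "y = cj t b" by blast
    then show "x - y \<in> cj t ` A" using subgrp_diff[OF A(1)] by (metis cj_diff imageI)
  qed
  have "- t \<in> \<Phi>" using t \<Phi> by (simp add: subgrp_closed)
  show "V \<subseteq> cj t ` A"
  proof
    fix v assume "v \<in> V"
    then have "cj (- t) v \<in> A" using A(2) cj_V[OF \<open>- t \<in> \<Phi>\<close>] by blast
    then have "cj t (cj (- t) v) \<in> cj t ` A" by (rule imageI)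
    then show "v \<in> cj t ` A" by simp
  qed
  show "cj t ` A \<subseteq> W" using A(3) cj_W[OF t] by blast
  fix p x assume p: "p \<in> P" and "x \<in> cj t ` A"
  then obtain a where a: "a \<in> A" "x = cj t a" by blast
  have "cj p x = cj t (cj (cj (- t) p) a)"
    using cj_cj_twist[of t "cj (- t) p" a] a(2) by simp
  then show "cj p x \<in> cj t ` A" using A(4)[OF P[OF p] a(1)] by simp
qed

text \<open>P. Hall's theorem: the Noetherian property passes from \<open>P0\<close> to an extension by one element \<open>t\<close> that normalizes
  \<open>P0\<close>. The proof is that of the Hilbert basis theorem, with conjugation by \<open>t\<close> as the variable. If \<open>B0\<close> is the
  \<open>P0\<close>-module generated by the given generators, then \<open>B n\<close> plays the role of the polynomials of degree less
  than \<open>n\<close>, and \<open>L A n\<close> that of the coefficients of degree \<open>n\<close> of elements of \<open>A\<close> of degree at most \<open>n\<close>.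
  The \<open>L A n \<inter> B0\<close> form an ascending chain of \<open>P0\<close>-modules, which becomes stationary. Negative powers of \<open>t\<close>
  are harmless: multiplying by a power of \<open>t\<close> moves every element into some \<open>B n\<close>.\<close>

lemma noeth_extension:
  assumes P0: "subgrp P0" "P0 \<subseteq> \<Phi>" and n0: "noeth P0" and t: "t \<in> \<Phi>"
    and norm: "\<And>p. p \<in> P0 \<Longrightarrow> cj t p \<in> P0" "\<And>p. p \<in> P0 \<Longrightarrow> cj (- t) p \<in> P0"
    and P1: "subgrp P1" "P1 \<subseteq> \<Phi>" "P0 \<subseteq> P1" "t \<in> P1" "P1 \<subseteq> gen (insert t P0)"
  shows "noeth P1"
  unfolding noeth_def
proof (intro allI impI, elim conjE)
  fix Y A assume Y: "finite Y" "Y \<subseteq> W" and A: "submod P1 A" and AY: "A \<subseteq> modspan P1 Y"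
  define T where "T n = (cj t ^^ n)" for n
  have T_Suc: "T (Suc n) a = cj t (T n a)" "T (Suc n) a = T n (cj t a)" for n a
    by (simp_all add: T_def funpow_swap1)
  have T_0 [simp]: "T 0 a = a" for a by (simp add: T_def)
  have T_add: "T (m + n) a = T m (T n a)" for m n a by (simp add: T_def funpow_add)
  have T_diff: "T n (a - b) = T n a - T n b" for n a b by (simp add: T_def funpow_cj_diff)
  have T_cj: "T n (cj p a) = cj (T n p) (T n a)" for n p a by (simp add: T_def funpow_cj_cj)
  have T_P0: "T n p \<in> P0" if "p \<in> P0" for n p
    using norm(1) that unfolding T_def by (rule funpow_cj_mem)
  have T_V: "T n v \<in> V" if "v \<in> V" for n v
    using cj_V[OF t] that unfolding T_def by (rule funpow_cj_mem)
  have T_W: "T n v \<in> W" if "v \<in> W" for n v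
    using cj_W[OF t] that unfolding T_def by (rule funpow_cj_mem)
  have restr: "submod P0 X" if "submod P1 X" for X
    using that P1(3) by (auto simp: submod_def)
  define B0 where "B0 = modspan P0 Y"
  have B0: "submod P0 B0" unfolding B0_def by (rule submod_modspan[OF P0 Y(2)])
  have TB0: "submod P0 (T n ` B0)" for n
  proof (induction n)
    case (Suc n)
    have "T (Suc n) ` B0 = cj t ` (T n ` B0)" by (auto simp: T_Suc(1) image_image)
    then show ?case using submod_image[OF Suc t norm(2)] by simp
  qed (use B0 in simp)
  define B where "B = rec_nat V (\<lambda>n X. X \<boxplus> T n ` B0)"
  have B_simps: "B 0 = V" "B (Suc n) = B n \<boxplus> T n ` B0" for n by (simp_all add: B_def)
  have VP0: "submod P0 V" using nsubD[OF V] VW P0(2) by (auto simp: submod_def)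
  have B: "submod P0 (B n)" for n
    by (induction n) (simp_all add: B_simps VP0 submod_sum TB0)
  have B_Suc: "B n \<subseteq> B (Suc n)" for n
    unfolding B_simps by (rule sumset_upper1[OF submodD(1)[OF TB0]])
  have B_mono: "B n \<subseteq> B (n + k)" for n k
    by (induction k) (use B_Suc in auto)
  have T_B: "cj t b \<in> B (Suc n)" if "b \<in> B n" for n b
    using that
  proof (induction n arbitrary: b)
    case 0
    then have "cj t b \<in> V" using cj_V[OF t] by (simp add: B_simps)
    then show ?case using submodD(2)[OF B] by blast
  next
    case (Suc n)
    then obtain c d where "c \<in> B n" "d \<in> B0" "b = c + T n d"
      unfolding B_simps by (auto elim!: sumsetE)
    then show ?case using Suc.IH
      by (subst B_simps) (auto simp: cj_add T_Suc(1)[symmetric] intro!: sumsetI)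
  qed
  have T_B': "T k b \<in> B (n + k)" if "b \<in> B n" for k n b
    by (induction k) (use that T_B in \<open>auto simp: T_Suc(1)\<close>)
  define L where "L X n = {b \<in> W. T n b \<in> B n \<boxplus> X}" for X n
  have BX: "submod P0 (B n \<boxplus> X)" if "submod P1 X" for X n
    by (intro submod_sum B restr that)
  have L: "submod P0 (L X n)" if X: "submod P1 X" for X n
    unfolding submod_def
  proof (intro conjI ballI)
    note BX = submodD[OF BX[OF X, of n]]
    show "subgrp (L X n)"
      using subgrp_closed(1,2)[OF nsubD(1)[OF W]] subgrp_closed(1,2)[OF BX(1)] T_V[of 0 n]
        subgrp_zero[OF nsubD(1)[OF V]] BX(2)
      by (auto simp: subgrp_def L_def T_diff)
    show "V \<subseteq> L X n" using VW T_V BX(2) by (auto simp: L_def)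
    show "L X n \<subseteq> W" by (auto simp: L_def)
    fix p b assume "p \<in> P0" "b \<in> L X n"
    then show "cj p b \<in> L X n"
      using BX(4) T_P0 cj_W P0(2) by (auto simp: L_def T_cj)
  qed
  have L_Suc: "L X n \<subseteq> L X (Suc n)" if X: "submod P1 X" for X n
  proof
    fix b assume "b \<in> L X n"
    then obtain c x where b: "b \<in> W" "c \<in> B n" "x \<in> X" "T n b = c + x"
      by (auto simp: L_def elim!: sumsetE)
    then have "T (Suc n) b = cj t c + cj t x" by (simp add: T_Suc(1) cj_add)
    then show "b \<in> L X (Suc n)"
      using b T_B submodD(4)[OF X P1(4)] by (auto simp: L_def intro!: sumsetI)
  qed
  have L_mono: "L X m \<subseteq> L X n" if X: "submod P1 X" and "m \<le> n" for X m n
    using that(2) L_Suc[OF X] by (rule lift_Suc_mono_le[rotated])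
  \<comment> \<open>the modules of leading coefficients\<close>
  define M where "M n = B0 \<inter> L A n" for n
  have M: "submod P0 (M n)" for n unfolding M_def by (intro submod_Int B0 L A)
  have M_mono: "M m \<subseteq> M n" if "m \<le> n" for m n
    using L_mono[OF A that] by (auto simp: M_def)
  have U: "submod P0 (\<Union>n. M n)"
    unfolding submod_def
  proof (intro conjI ballI)
    show "subgrp (\<Union>n. M n)"
      unfolding subgrp_def
    proof (intro conjI ballI)
      show "0 \<in> (\<Union>n. M n)" using subgrp_zero[OF submodD(1)[OF M[of 0]]] by blast
      fix a b assume "a \<in> (\<Union>n. M n)" "b \<in> (\<Union>n. M n)"
      then obtain m n where "a \<in> M m" "b \<in> M n" by blast
      then have "a \<in> M (max m n)" "b \<in> M (max m n)"
        using M_mono[of m "max m n"] M_mono[of n "max m n"] by auto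
      then have "a - b \<in> M (max m n)" by (rule subgrp_diff[OF submodD(1)[OF M]])
      then show "a - b \<in> (\<Union>n. M n)" by blast
    qed
    show "V \<subseteq> (\<Union>n. M n)" using submodD(2)[OF M[of 0]] by blast
    show "(\<Union>n. M n) \<subseteq> W" using submodD(3)[OF M] by blast
    fix p a assume "p \<in> P0" "a \<in> (\<Union>n. M n)"
    then show "cj p a \<in> (\<Union>n. M n)" using submodD(4)[OF M] by blast
  qed
  obtain Z where Z: "finite Z" "Z \<subseteq> (\<Union>n. M n)" "(\<Union>n. M n) = modspan P0 Z"
    by (rule noethD[OF n0 Y U]) (auto simp: M_def B0_def)
  obtain N where N: "Z \<subseteq> M N"
  proof -
    have "\<exists>N. Z' \<subseteq> M N" if "finite Z'" "Z' \<subseteq> Z" for Z'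
      using that
    proof (induction Z' rule: finite_induct)
      case (insert z Z')
      then obtain N where "Z' \<subseteq> M N" by auto
      moreover obtain n where "z \<in> M n" using insert.prems Z(2) by blast
      ultimately have "insert z Z' \<subseteq> M (max n N)"
        using M_mono[of n "max n N"] M_mono[of N "max n N"] by auto
      then show ?case by blast
    qed simp
    then show ?thesis using that Z(1) by blast
  qed
  have stable: "M n \<subseteq> M N" for n
    using Z(3) modspan_least[OF M N] by blast
  have "\<exists>Z. finite Z \<and> Z \<subseteq> M n \<and> M n = modspan P0 Z" for n
    by (rule noethD[OF n0 Y M[of n]]) (auto simp: M_def B0_def)
  from choice[OF allI[OF this]]
  obtain G where "\<forall>n. finite (G n) \<and> G n \<subseteq> M n \<and> M n = modspan P0 (G n)" ..
  then have G: "finite (G n)" "G n \<subseteq> M n" "M n = modspan P0 (G n)" for n by blast+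
  have "\<exists>\<alpha>. \<alpha> \<in> A \<and> (\<exists>\<beta>\<in>B n. T n b = \<beta> + \<alpha>)" if "b \<in> M n" for n b
    using that by (auto simp: M_def L_def elim!: sumsetE)
  note ex = this
  define \<alpha> where "\<alpha> n b = (SOME \<alpha>. \<alpha> \<in> A \<and> (\<exists>\<beta>\<in>B n. T n b = \<beta> + \<alpha>))" for n b
  have \<alpha>: "\<alpha> n b \<in> A \<and> (\<exists>\<beta>\<in>B n. T n b = \<beta> + \<alpha> n b)" if "b \<in> M n" for n b
    using someI_ex[OF ex[OF that]] unfolding \<alpha>_def .
  \<comment> \<open>elements of \<open>A\<close> whose leading coefficients generate the
    modules \<open>M n\<close> up to the point where these become stationary\<close>
  define Y' where "Y' = (\<Union>n\<le>N. \<alpha> n ` G n)"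
  have Y': "finite Y'" "Y' \<subseteq> A"
    using G(1) \<alpha>[OF subsetD[OF G(2)]] by (auto simp: Y'_def simp del: G(3))
  define A' where "A' = modspan P1 Y'"
  have A': "submod P1 A'" unfolding A'_def
    using Y' submodD(3)[OF A] by (intro submod_modspan P1) auto
  have A'A: "A' \<subseteq> A" unfolding A'_def by (rule modspan_least[OF A Y'(2)])
  have Y'A': "Y' \<subseteq> A'" unfolding A'_def by (rule modspan_upper[OF subgrp_zero[OF P1(1)]])
  have low: "M n \<subseteq> L A' n" if "n \<le> N" for n
  proof -
    have "G n \<subseteq> L A' n"
    proof
      fix b assume b: "b \<in> G n"
      then have "\<alpha> n b \<in> A'" using Y'A' that by (auto simp: Y'_def)
      moreover obtain \<beta> where "\<beta> \<in> B n" "T n b = \<beta> + \<alpha> n b" using \<alpha> G b by blast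
      moreover have "b \<in> W" using submodD(3)[OF M] G b by blast
      ultimately show "b \<in> L A' n" by (auto simp: L_def intro: sumsetI)
    qed
    then show ?thesis using G(3) modspan_least[OF L[OF A']] by blast
  qed
  have M_L: "M n \<subseteq> L A' n" for n
  proof (cases "n \<le> N")
    case False
    then show ?thesis using stable[of n] low[of N] L_mono[OF A', of N n] by auto
  qed (rule low)
  have AB: "A \<inter> B n \<subseteq> A'" for n
  proof (induction n)
    case 0 then show ?case using submodD(2)[OF A'] by (auto simp: B_simps)
  next
    case (Suc n)
    show ?case
    proof
      fix a assume a: "a \<in> A \<inter> B (Suc n)"
      then obtain c b where cb: "c \<in> B n" "b \<in> B0" "a = c + T n b"
        by (auto simp: B_simps elim!: sumsetE)
      have Bn: "subgrp (B n)" using submodD(1)[OF B] .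
      have "T n b = - c + a" using cb by (simp add: add.assoc[symmetric])
      then have "T n b \<in> B n \<boxplus> A" using sumsetI[OF subgrp_uminus[OF Bn cb(1)], of a A] a by simp
      then have "b \<in> M n" using cb submodD(3)[OF B0] by (auto simp: M_def L_def)
      then have "T n b \<in> B n \<boxplus> A'" using M_L[of n] by (auto simp: L_def)
      then obtain c' a' where c': "c' \<in> B n" "a' \<in> A'" "T n b = c' + a'" by (rule sumsetE)
      have "a - a' = c + c'" using cb c' by (simp add: add.assoc[symmetric])
      moreover have "a - a' \<in> A" using a c' A'A subgrp_diff[OF submodD(1)[OF A]] by blast
      moreover have "c + c' \<in> B n" using cb c' subgrp_add[OF Bn] by blast
      ultimately have "a - a' \<in> A'" using Suc by auto
      then have "(a - a') + a' \<in> A'" using c' by (intro subgrp_add submodD(1)[OF A'])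
      then show "a \<in> A'" by simp
    qed
  qed
  \<comment> \<open>the elements that become polynomials after multiplication
    by a power of \<open>t\<close>; they form a \<open>P1\<close>-submodule containing the generators\<close>
  define D where "D = {x \<in> W. \<exists>k n. T k x \<in> B n}"
  have D_up: "T (k + j) x \<in> B (n + j + i)" if "T k x \<in> B n" for k j n x i
    using T_B'[OF that, of j] B_mono[of "n + j" i] T_add[of j k x] by (auto simp: add.commute)
  have D_P0: "cj p x \<in> D" if p: "p \<in> P0" and x: "x \<in> D" for p x
  proof -
    obtain k n where "T k x \<in> B n" using x by (auto simp: D_def)
    then have "T k (cj p x) \<in> B n" using submodD(4)[OF B T_P0[OF p]] by (simp add: T_cj)
    then show ?thesis using x p P0(2) cj_W by (auto simp: D_def)
  qed
  have D_t: "cj t x \<in> D" if x: "x \<in> D" for x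
  proof -
    obtain k n where "T k x \<in> B n" using x by (auto simp: D_def)
    then have "T k (cj t x) \<in> B (Suc n)" using T_B T_Suc[of k x] by simp
    then show ?thesis using x cj_W[OF t] by (auto simp: D_def)
  qed
  have mt: "- t \<in> \<Phi>" using t \<Phi> by (simp add: subgrp_closed)
  have D_mt: "cj (- t) x \<in> D" if x: "x \<in> D" for x
  proof -
    obtain k n where "T k x \<in> B n" using x by (auto simp: D_def)
    then have "T (Suc k) (cj (- t) x) \<in> B n" by (simp add: T_Suc(2))
    then show ?thesis using x cj_W[OF mt] by (auto simp: D_def)
  qed
  have D: "submod P1 D"
    unfolding submod_def
  proof (intro conjI ballI)
    show "subgrp D"
      unfolding subgrp_def
    proof (intro conjI ballI)
      have "T 0 0 \<in> B 0" using subgrp_zero[OF submodD(1)[OF B]] by simp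
      then show "0 \<in> D" using subgrp_zero[OF nsubD(1)[OF W]] unfolding D_def by blast
      fix a b assume ab: "a \<in> D" "b \<in> D"
      then obtain k n l m where "T k a \<in> B n" "T l b \<in> B m" by (auto simp: D_def)
      then have "T (k + l) a \<in> B (n + l + (m + k))" "T (l + k) b \<in> B (m + k + (n + l))"
        using D_up by blast+
      then have "T (k + l) (a - b) \<in> B (n + l + (m + k))"
        using subgrp_diff[OF submodD(1)[OF B]] by (simp add: T_diff add_ac)
      then show "a - b \<in> D" using ab subgrp_diff[OF nsubD(1)[OF W]] unfolding D_def by blast
    qed
    show "V \<subseteq> D"
    proof
      fix v assume "v \<in> V"
      then have "T 0 v \<in> B 0" by (simp add: B_simps)
      then show "v \<in> D" using VW \<open>v \<in> V\<close> unfolding D_def by blast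
    qed
    show "D \<subseteq> W" by (auto simp: D_def)
    fix p x assume p: "p \<in> P1" and x: "x \<in> D"
    have "cj s x \<in> D \<and> cj (- s) x \<in> D" if "s \<in> insert t P0" "x \<in> D" for s x
      using that D_t D_mt D_P0 subgrp_uminus[OF P0(1)] by auto
    then show "cj p x \<in> D" using gen_invariant[of "insert t P0" D p] p x P1(5) by blast
  qed
  have "Y \<subseteq> D"
  proof
    fix y assume y: "y \<in> Y"
    then have "y \<in> B0" using modspan_upper[OF subgrp_zero[OF P0(1)]] by (auto simp: B0_def)
    then have "0 + T 0 y \<in> B (Suc 0)"
      unfolding B_simps using subgrp_zero[OF nsubD(1)[OF V]] by (intro sumsetI) auto
    then have "T 0 y \<in> B (Suc 0)" by simp
    then show "y \<in> D" using y Y(2) unfolding D_def by blast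
  qed
  then have AD: "A \<subseteq> D" using AY modspan_least[OF D] by blast
  have "A \<subseteq> A'"
  proof
    fix a assume a: "a \<in> A"
    then obtain k n where kn: "T k a \<in> B n" using AD by (auto simp: D_def)
    have "T k a \<in> A" unfolding T_def
      by (rule funpow_cj_mem[OF submodD(4)[OF A P1(4)] a])
    then have "T k a \<in> A'" using AB kn by blast
    then have "(cj (- t) ^^ k) (T k a) \<in> A'"
      by (rule funpow_cj_mem[OF submodD(4)[OF A' subgrp_uminus[OF P1(1,4)]], rotated])
    then show "a \<in> A'" by (simp add: T_def funpow_cj_inverse)
  qed
  then have "A = modspan P1 Y'" using A'A A'_def by blast
  then show "\<exists>Z. finite Z \<and> Z \<subseteq> A \<and> A = modspan P1 Z" using Y' by blast
qed

lemma noeth_chain: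
  assumes "(cstep \<Phi>)\<^sup>*\<^sup>* Z P" and Z: "nsub \<Phi> Z" "noeth Z"
  shows "nsub \<Phi> P \<and> noeth P"
  using assms(1)
proof (induction rule: rtranclp_induct)
  case base then show ?case using Z by blast
next
  case (step P P')
  then obtain t where t: "t \<in> central_mod \<Phi> P" "P' = P \<boxplus> gen {t}" by (auto simp: cstep_def)
  have P: "nsub \<Phi> P" "noeth P" and P': "nsub \<Phi> P'"
    using step cstep_nsub[OF \<Phi>] by blast+
  have tF: "t \<in> \<Phi>" "- t \<in> \<Phi>" using t \<Phi> by (auto simp: central_mod_def intro: subgrp_closed)
  have "noeth P'"
  proof (rule noeth_extension[OF nsubD(1,2)[OF P(1)] P(2) tF(1)])
    show "P' \<subseteq> gen (insert t P)" unfolding t(2)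
      by (intro sumset_least subgrp_gen gen_mono) (simp_all add: gen_incl subsetI)
    show "P \<subseteq> P'" unfolding t(2) by (rule sumset_upper1[OF subgrp_gen])
    have "t \<in> gen {t}" by (rule gen_incl) simp
    then show "t \<in> P'" unfolding t(2) by (rule subsetD[OF sumset_upper2[OF nsubD(1)[OF P(1)]]])
    show "cj t p \<in> P" "cj (- t) p \<in> P" if "p \<in> P" for p
      using nsubD(3)[OF P(1) _ that] tF by blast+
    show "subgrp P'" "P' \<subseteq> \<Phi>" using nsubD(1,2)[OF P'] .
  qed
  then show ?case using P' by blast
qed

end

section \<open>Free groups\<close>

text \<open>The free group on the whole type \<^typ>\<open>'x\<close>; the free group on a subset of the type becomes a subgroup,
  \<open>fgrp_on X\<close> below.\<close>

typedef 'x fgrp = "{w :: 'x word. reduced w}"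
  by (rule exI[of _ "[]"]) simp

instantiation fgrp :: (type) group_add
begin

definition "0 = Abs_fgrp []"
definition "a + b = Abs_fgrp (reduce (Rep_fgrp a @ Rep_fgrp b))"
definition "- a = Abs_fgrp (reduce (inv_word (Rep_fgrp a)))"
definition "a - b = a + - b" for a b :: "'a fgrp"

instance
proof
  fix a b c :: "'a fgrp"
  show "a + b + c = a + (b + c)"
    by (simp add: plus_fgrp_def Abs_fgrp_inverse reduce_append_left reduce_append_right)
  show "0 + a = a" "a + 0 = a"
    using Rep_fgrp[of a]
    by (simp_all add: plus_fgrp_def zero_fgrp_def Abs_fgrp_inverse reduce_eq Rep_fgrp_inverse)
  show "- a + a = 0"
    by (simp add: plus_fgrp_def zero_fgrp_def uminus_fgrp_def Abs_fgrp_inverse reduce_append_left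
        reduce_inv_word)
  show "a + - b = a - b" by (simp add: minus_fgrp_def)
qed

end

definition of_word :: "'x word \<Rightarrow> 'x fgrp" where
  "of_word w = Abs_fgrp (reduce w)"

definition fgen :: "'x \<Rightarrow> 'x fgrp" where
  "fgen x = of_word [(x, True)]"

lemma reduce_Nil [simp]: "reduce [] = []" by (simp add: reduce_def)

lemma Rep_of_word [simp]: "Rep_fgrp (of_word w) = reduce w"
  by (simp add: of_word_def Abs_fgrp_inverse)

lemma of_word_Rep [simp]: "of_word (Rep_fgrp a) = a"
  using Rep_fgrp[of a] by (simp add: of_word_def reduce_eq Rep_fgrp_inverse)

lemma of_word_append: "of_word (u @ v) = of_word u + of_word v"
  by (simp add: of_word_def plus_fgrp_def Abs_fgrp_inverse reduce_append_left reduce_append_right)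

lemma of_word_Nil [simp]: "of_word [] = 0"
  by (simp add: of_word_def zero_fgrp_def)

lemma of_word_inv_word: "of_word (inv_word w) = - of_word w"
proof -
  have "of_word (inv_word w) + of_word w = 0"
    unfolding of_word_append[symmetric] by (simp add: of_word_def reduce_inv_word zero_fgrp_def)
  then show ?thesis by (simp add: eq_neg_iff_add_eq_0)
qed

lemma of_word_eq_iff: "of_word u = of_word v \<longleftrightarrow> reduce u = reduce v"
  by (metis Rep_of_word of_word_def)

definition ev_letter :: "('x \<Rightarrow> 'g::group_add) \<Rightarrow> 'x \<times> bool \<Rightarrow> 'g" where
  "ev_letter f l = (if snd l then f (fst l) else - f (fst l))"

text \<open>Evaluation of a word makes sense before reduction, and agrees before and after it; so
  homomorphisms out of a free group and values of unreduced words are treated alike.\<close>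

primrec ev :: "('x \<Rightarrow> 'g::group_add) \<Rightarrow> 'x word \<Rightarrow> 'g" where
  "ev f [] = 0"
| "ev f (l # w) = ev_letter f l + ev f w"

lemma ev_append: "ev f (u @ v) = ev f u + ev f v"
  by (induction u) (simp_all add: add.assoc)

lemma ev_letter_inv [simp]: "ev_letter f (inv_letter l) = - ev_letter f l"
  by (simp add: ev_letter_def inv_letter_def)

lemma ev_inv_word: "ev f (inv_word w) = - ev f w"
  by (induction w) (simp_all add: inv_word_def ev_append minus_add)

lemma ev_cons_red: "ev f (cons_red l w) = ev_letter f l + ev f w"
  by (cases w) (simp_all add: add.assoc[symmetric])

lemma ev_reduce: "ev f (reduce w) = ev f w"
  by (induction w) (simp_all add: reduce_def ev_cons_red)

lemma ev_mem: "subgrp H \<Longrightarrow> w \<in> words X \<Longrightarrow> (\<And>x. x \<in> X \<Longrightarrow> f x \<in> H) \<Longrightarrow> ev f w \<in> H"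
proof (induction w)
  case (Cons l w)
  then have "ev_letter f l \<in> H"
    using subgrp_uminus[OF Cons.prems(1)] by (auto simp: ev_letter_def words_def)
  then show ?case using Cons subgrp_add by (fastforce simp: words_def)
qed (simp add: subgrp_zero)

definition lift :: "('x \<Rightarrow> 'g::group_add) \<Rightarrow> 'x fgrp \<Rightarrow> 'g" where
  "lift f a = ev f (Rep_fgrp a)"

lemma lift_add: "lift f (a + b) = lift f a + lift f b"
  by (simp add: lift_def plus_fgrp_def Abs_fgrp_inverse ev_reduce ev_append)

lemma lift_of_word: "lift f (of_word w) = ev f w"
  by (simp add: lift_def ev_reduce)

lemma lift_fgen [simp]: "lift f (fgen x) = f x"
  by (simp add: fgen_def lift_of_word ev_letter_def)

lemma of_word_single: "of_word [l] = ev_letter fgen l"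
proof -
  have "of_word [(x, False)] = - fgen x" for x :: 'x
    using of_word_inv_word[of "[(x, True)]"] by (simp add: inv_word_def inv_letter_def fgen_def)
  then show ?thesis by (cases l) (auto simp: ev_letter_def fgen_def)
qed

lemma of_word_eq_ev: "of_word w = ev fgen w"
proof (induction w)
  case (Cons l w)
  have "of_word (l # w) = of_word [l] + of_word w" using of_word_append[of "[l]" w] by simp
  then show ?case using Cons by (simp add: of_word_single)
qed simp

locale ghom =
  fixes h :: "'g::group_add \<Rightarrow> 'h::group_add"
  assumes add: "h (a + b) = h a + h b"
begin

lemma zero [simp]: "h 0 = 0"
proof -
  have "h 0 + h 0 = h 0 + 0" using add[of 0 0] by simp
  then show ?thesis by (rule add_left_imp_eq)
qed

lemma uminus: "h (- a) = - h a"
  using add[of "- a" a] by (simp add: eq_neg_iff_add_eq_0)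

lemma diff: "h (a - b) = h a - h b"
  using add[of a "- b"] by (simp add: uminus)

lemma cj: "h (cj p a) = cj (h p) (h a)"
  by (simp add: cj_def add diff)

lemma subgrp_image: "subgrp A \<Longrightarrow> subgrp (h ` A)"
  unfolding subgrp_def
proof (intro conjI ballI)
  assume A: "0 \<in> A \<and> (\<forall>a\<in>A. \<forall>b\<in>A. a - b \<in> A)"
  then show "0 \<in> h ` A" using imageI[of 0 A h] by simp
  fix x y assume "x \<in> h ` A" "y \<in> h ` A"
  then obtain a b where "a \<in> A" "b \<in> A" "x = h a" "y = h b" by blast
  then show "x - y \<in> h ` A" using A by (metis diff imageI)
qed

definition ker_in :: "'g set \<Rightarrow> 'g set" where
  "ker_in \<Phi> = {a \<in> \<Phi>. h a = 0}"

lemma nsub_ker: "subgrp \<Phi> \<Longrightarrow> nsub \<Phi> (ker_in \<Phi>)"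
  unfolding nsub_def
proof (intro conjI ballI)
  assume \<Phi>: "subgrp \<Phi>"
  show "subgrp (ker_in \<Phi>)"
    using \<Phi> by (simp add: subgrp_def ker_in_def diff)
  fix p n assume "p \<in> \<Phi>" "n \<in> ker_in \<Phi>"
  then show "cj p n \<in> ker_in \<Phi>" using cj_mem[OF \<Phi>] by (simp add: ker_in_def cj)
qed (simp add: ker_in_def)

end

lemma ghom_lift: "ghom (lift f)"
  by unfold_locales (rule lift_add)

section \<open>Subgroups of free groups are projective\<close>

text \<open>\<open>N\<close> is the fundamental
  group of the covering graph whose vertices are the cosets of \<open>N\<close>. Choose a preimage in \<open>M\<close> for every edge
  (more precisely for the element \<open>\<tau> + x - \<tau>'\<close> of \<open>N\<close> that the edge from \<open>\<tau>\<close> with label \<open>x\<close> represents, where \<open>\<tau>\<close> and \<open>\<tau>'\<close>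
  are the chosen representatives of its ends) and the inverse preimage for the inverse edge. Then
  multiply these along the path that a word spells out. Words in \<open>N\<close> give closed paths at the base point,
  and concatenation of paths gives additivity.\<close>

theorem free_subgroup_projective:
  fixes N :: "'x fgrp set" and p :: "'g::group_add \<Rightarrow> 'x fgrp"
  assumes "ghom p" and M: "subgrp M" and pM: "p ` M = N"
  obtains \<sigma> where "\<And>n. n \<in> N \<Longrightarrow> \<sigma> n \<in> M \<and> p (\<sigma> n) = n"
    and "\<And>m n. m \<in> N \<Longrightarrow> n \<in> N \<Longrightarrow> \<sigma> (m + n) = \<sigma> m + \<sigma> n"
proof -
  interpret p: ghom p by fact
  have N: "subgrp N" using p.subgrp_image[OF M] pM by simp
  \<comment> \<open>representatives of the cosets of \<open>N\<close>; the coset \<open>N\<close> itself, the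
    base point, must be represented by \<open>0\<close> so that no conjugation occurs in the section\<close>
  define t where "t u = (if u \<in> N then 0 else SOME v. u - v \<in> N)" for u
  have t: "u - t u \<in> N" for u
  proof (cases "u \<in> N")
    case False
    have "\<exists>v. u - v \<in> N" using subgrp_zero[OF N] by (intro exI[of _ u]) simp
    then show ?thesis using False someI_ex[of "\<lambda>v. u - v \<in> N"] by (simp add: t_def)
  qed (simp add: t_def)
  have t_cong: "t (n + u) = t u" if n: "n \<in> N" for n u
  proof -
    have 1: "n + u - v \<in> N \<longleftrightarrow> u - v \<in> N" for v
    proof
      assume "n + u - v \<in> N"
      then have "- n + (n + u - v) \<in> N" using n by (intro subgrp_add subgrp_uminus N)
      then show "u - v \<in> N" by (simp add: group_add_simps del: add_uminus_conv_diff)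
    next
      assume "u - v \<in> N"
      then have "n + (u - v) \<in> N" using n by (intro subgrp_add N)
      then show "n + u - v \<in> N" by (simp add: group_add_simps del: add_uminus_conv_diff)
    qed
    show ?thesis using 1[of 0] by (simp add: t_def 1)
  qed
  have t_eq: "t (t u + v) = t (u + v)" for u v
  proof -
    have "u + v = (u - t u) + (t u + v)" by (simp add: group_add_simps del: add_uminus_conv_diff)
    then show ?thesis using t_cong[OF t] by metis
  qed
  have t_eq': "t (t u - v) = t (u - v)" for u v using t_eq[of u "- v"] by simp
  have t_0: "t 0 = 0" using subgrp_zero[OF N] by (simp add: t_def)
  have t_idem: "t (t u) = t u" for u using t_eq[of u 0] by simp
  define s where "s n = (SOME m. m \<in> M \<and> p m = n)" for n
  have s: "s n \<in> M \<and> p (s n) = n" if "n \<in> N" for n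
    using someI_ex[of "\<lambda>m. m \<in> M \<and> p m = n"] that pM unfolding s_def by blast
  \<comment> \<open>the preimage chosen for the edge with label \<open>x\<close> at \<open>\<tau>\<close>\<close>
  define e where "e \<tau> x = s (\<tau> + fgen x - t (\<tau> + fgen x))" for \<tau> x
  define d where "d \<tau> l = (if snd l then e \<tau> (fst l) else - e (t (\<tau> - fgen (fst l))) (fst l))" for \<tau> l
  define nx where "nx \<tau> l = t (\<tau> + of_word [l])" for \<tau> l
  \<comment> \<open>the product along the path from \<open>\<tau>\<close> spelled out by a word\<close>
  define \<pi> where "\<pi> = rec_list (\<lambda>\<tau>. 0) (\<lambda>l w r \<tau>. d \<tau> l + r (nx \<tau> l))"
  have \<pi>: "\<pi> [] \<tau> = 0" "\<pi> (l # w) \<tau> = d \<tau> l + \<pi> w (nx \<tau> l)" for \<tau> l w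
    by (simp_all add: \<pi>_def)
  have ofw: "of_word [(x, False)] = - fgen x" "of_word [(x, True)] = fgen x" for x :: 'x
    by (simp_all add: of_word_single ev_letter_def)
  have nx_inv: "nx (nx \<tau> l) (inv_letter l) = \<tau>" if "t \<tau> = \<tau>" for \<tau> l
    using that by (cases l; cases "snd l")
      (auto simp: nx_def t_eq t_eq' ofw inv_letter_def)
  have d_inv: "d (nx \<tau> l) (inv_letter l) = - d \<tau> l" if "t \<tau> = \<tau>" for \<tau> l
    using that nx_inv[OF that, of l]
    by (cases l; cases "snd l") (auto simp: d_def nx_def inv_letter_def ofw)
  have \<pi>_cons_red: "\<pi> (cons_red l w) \<tau> = d \<tau> l + \<pi> w (nx \<tau> l)" if "t \<tau> = \<tau>" for l w \<tau>
  proof (cases w)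
    case (Cons b v)
    then show ?thesis using nx_inv[OF that, of l] d_inv[OF that, of l]
      by (auto simp: \<pi> add.assoc[symmetric])
  qed (simp add: \<pi>)
  have nx_t: "t (nx \<tau> l) = nx \<tau> l" for \<tau> l by (simp add: nx_def t_idem)
  have \<pi>_reduce: "\<pi> (reduce w) \<tau> = \<pi> w \<tau>" if "t \<tau> = \<tau>" for w \<tau>
    using that by (induction w arbitrary: \<tau>) (simp_all add: reduce_def \<pi> \<pi>_cons_red nx_t)
  have of_Cons: "of_word (l # w) = of_word [l] + of_word w" for l and w :: "'x word"
    using of_word_append[of "[l]" w] by simp
  have \<pi>_append: "\<pi> (u @ v) \<tau> = \<pi> u \<tau> + \<pi> v (t (\<tau> + of_word u))" if "t \<tau> = \<tau>" for u v \<tau>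
    using that
  proof (induction u arbitrary: \<tau>)
    case (Cons l u)
    have "t (nx \<tau> l + of_word u) = t (\<tau> + of_word (l # u))"
      by (subst of_Cons) (simp add: nx_def t_eq add.assoc)
    then show ?case using Cons nx_t by (simp add: \<pi> add.assoc)
  qed (simp add: \<pi>)
  have edge: "e \<tau> x \<in> M \<and> p (e \<tau> x) = \<tau> + fgen x - t (\<tau> + fgen x)" for \<tau> x
    unfolding e_def by (rule s[OF t])
  have d_p: "d \<tau> l \<in> M \<and> p (d \<tau> l) = \<tau> + of_word [l] - nx \<tau> l" if "t \<tau> = \<tau>" for \<tau> l
  proof (cases "snd l")
    case True
    then show ?thesis using edge[of \<tau> "fst l"] by (cases l) (simp add: d_def nx_def ofw)
  next
    case False
    obtain x where l: "l = (x, False)" using False by (cases l) auto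
    have "t (t (\<tau> - fgen x) + fgen x) = \<tau>" by (simp add: t_eq that)
    then show ?thesis using edge[of "t (\<tau> - fgen x)" x] subgrp_uminus[OF M]
      by (simp add: l d_def nx_def ofw p.uminus group_add_simps del: add_uminus_conv_diff)
  qed
  have \<pi>_p: "\<pi> w \<tau> \<in> M \<and> p (\<pi> w \<tau>) = \<tau> + of_word w - t (\<tau> + of_word w)" if "t \<tau> = \<tau>" for w \<tau>
    using that
  proof (induction w arbitrary: \<tau>)
    case Nil then show ?case using subgrp_zero[OF M] by (simp add: \<pi>)
  next
    case (Cons l w)
    have 1: "t (nx \<tau> l + of_word w) = t (\<tau> + of_word (l # w))"
      by (subst of_Cons) (simp add: nx_def t_eq add.assoc)
    have "p (\<pi> (l # w) \<tau>) = (\<tau> + of_word [l] - nx \<tau> l) + (nx \<tau> l + of_word w - t (\<tau> + of_word (l # w)))"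
      using Cons d_p[OF Cons.prems] nx_t 1 by (simp add: \<pi> p.add)
    also have "\<dots> = \<tau> + of_word (l # w) - t (\<tau> + of_word (l # w))"
      using of_Cons[of l w] by (simp add: group_add_simps del: add_uminus_conv_diff)
    finally show ?case using Cons.IH[OF nx_t] d_p[OF Cons.prems] subgrp_add[OF M] by (simp add: \<pi>)
  qed
  define \<sigma> where "\<sigma> n = \<pi> (Rep_fgrp n) 0" for n
  have tN: "t n = 0" if "n \<in> N" for n using that by (simp add: t_def)
  show ?thesis
  proof (rule that)
    fix n assume "n \<in> N"
    then show "\<sigma> n \<in> M \<and> p (\<sigma> n) = n" using \<pi>_p[OF t_0, of "Rep_fgrp n"] tN by (simp add: \<sigma>_def)
  next
    fix m n assume m: "m \<in> N" and "n \<in> N"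
    have "\<sigma> (m + n) = \<pi> (Rep_fgrp m @ Rep_fgrp n) 0"
      by (simp add: \<sigma>_def plus_fgrp_def Abs_fgrp_inverse \<pi>_reduce[OF t_0])
    also have "\<dots> = \<sigma> m + \<sigma> n" using tN[OF m] by (simp add: \<pi>_append[OF t_0] \<sigma>_def)
    finally show "\<sigma> (m + n) = \<sigma> m + \<sigma> n" .
  qed
qed

section \<open>Intersections of kernels of maps to free groups\<close>

lemma comm_left_mem:
  assumes "nsub \<Phi> A" "a \<in> A" "p \<in> \<Phi>" shows "cj p a - a \<in> A"
  by (rule subgrp_diff[OF nsubD(1)[OF assms(1)] nsubD(3)[OF assms(1,3,2)] assms(2)])

lemma comm_right_mem:
  assumes "nsub \<Phi> A" "a \<in> A" "p \<in> \<Phi>" shows "cj a p - p \<in> A"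
proof -
  have "cj a p - p = a - cj p a"
    by (simp add: cj_def group_add_simps del: add_uminus_conv_diff)
  then show ?thesis using nsubD(1,3)[OF assms(1)] assms(2,3) subgrp_diff by metis
qed

lemma nsub_Inter: "subgrp \<Phi> \<Longrightarrow> (\<And>N. N \<in> \<N> \<Longrightarrow> nsub \<Phi> N) \<Longrightarrow> nsub \<Phi> (\<Phi> \<inter> \<Inter>\<N>)"
proof -
  assume \<Phi>: "subgrp \<Phi>" and N: "\<And>N. N \<in> \<N> \<Longrightarrow> nsub \<Phi> N"
  show ?thesis unfolding nsub_def
  proof (intro conjI ballI)
    show "subgrp (\<Phi> \<inter> \<Inter>\<N>)"
      using subgrp_closed(1,2)[OF \<Phi>] subgrp_closed(1,2)[OF nsubD(1)[OF N]] by (simp add: subgrp_def)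
    fix p n assume "p \<in> \<Phi>" "n \<in> \<Phi> \<inter> \<Inter>\<N>"
    then show "cj p n \<in> \<Phi> \<inter> \<Inter>\<N>" using cj_mem[OF \<Phi>] nsubD(3)[OF N] by simp
  qed simp
qed

text \<open>The quotient of \<open>\<Phi>\<close> by \<open>K\<close> and the intersection of \<open>\<N>\<close> is nilpotent of class at most the number of members
  of \<open>\<N>\<close>. To pass from \<open>\<N>\<close> to \<open>insert N \<N>\<close>, write an element of \<open>\<Phi>\<close> modulo \<open>K\<close> as an element of \<open>N\<close>; its
  commutator with an element of the intersection of \<open>\<N>\<close> lies in both.\<close>

lemma chain_sum_Inter:
  assumes \<Phi>: "subgrp \<Phi>" and X: "finite X" "gen X = \<Phi>" and K: "nsub \<Phi> K"
    and "finite \<N>" and "\<And>N. N \<in> \<N> \<Longrightarrow> nsub \<Phi> N" and "\<And>N. N \<in> \<N> \<Longrightarrow> \<Phi> \<subseteq> K \<boxplus> N"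
  shows "(cstep \<Phi>)\<^sup>*\<^sup>* (K \<boxplus> (\<Phi> \<inter> \<Inter>\<N>)) \<Phi>"
  using assms(5-7)
proof (induction \<N> rule: finite_induct)
  case empty
  have "K \<boxplus> \<Phi> = \<Phi>"
    using sumset_least[OF \<Phi> nsubD(2)[OF K]] sumset_upper2[OF nsubD(1)[OF K]] by blast
  then show ?case by simp
next
  case (insert N \<N>)
  let ?I = "\<Phi> \<inter> \<Inter>\<N>" and ?J = "\<Phi> \<inter> \<Inter>(insert N \<N>)"
  have N: "nsub \<Phi> N" and I: "nsub \<Phi> ?I" and J: "nsub \<Phi> ?J"
    by (rule insert.prems, simp, (rule nsub_Inter[OF \<Phi>], simp add: insert.prems)+)
  have Z: "nsub \<Phi> (K \<boxplus> ?I)" and Z1: "nsub \<Phi> (K \<boxplus> ?J)"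
    by (intro nsub_sumset K I J \<Phi>)+
  have ch: "(cstep \<Phi>)\<^sup>*\<^sup>* (K \<boxplus> ?I) \<Phi>"
    by (rule insert.IH) (use insert.prems in simp_all)
  have KZ1: "K \<subseteq> K \<boxplus> ?J" by (rule sumset_upper1[OF nsubD(1)[OF J]])
  have JZ1: "?J \<subseteq> K \<boxplus> ?J" by (rule sumset_upper2[OF nsubD(1)[OF K]])
  have "K \<boxplus> ?I \<subseteq> {z \<in> \<Phi>. \<forall>p\<in>N. cj p z - z \<in> K \<boxplus> ?J}"
  proof (rule sumset_least[OF subgrp_centralizer_mod[OF \<Phi> Z1 nsubD(2)[OF N]]])
    show "K \<subseteq> {z \<in> \<Phi>. \<forall>p\<in>N. cj p z - z \<in> K \<boxplus> ?J}"
      using comm_left_mem[OF K] nsubD(2)[OF K] nsubD(2)[OF N] KZ1 by blast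
    show "?I \<subseteq> {z \<in> \<Phi>. \<forall>p\<in>N. cj p z - z \<in> K \<boxplus> ?J}"
    proof clarify
      fix z p assume z: "z \<in> \<Phi>" "z \<in> \<Inter>\<N>" and p: "p \<in> N"
      then have pF: "p \<in> \<Phi>" using nsubD(2)[OF N] by blast
      have "cj p z - z \<in> ?I" using comm_left_mem[OF I _ pF] z by blast
      moreover have "cj p z - z \<in> N" by (rule comm_right_mem[OF N p z(1)])
      ultimately show "cj p z - z \<in> K \<boxplus> ?J" using JZ1 by blast
    qed
  qed
  note 1 = this
  have "K \<boxplus> ?I \<subseteq> central_mod \<Phi> (K \<boxplus> ?J)"
  proof
    fix z assume z: "z \<in> K \<boxplus> ?I"
    then have zF: "z \<in> \<Phi>" using nsubD(2)[OF Z] by blast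
    have "K \<boxplus> N \<subseteq> {p \<in> \<Phi>. cj p z - z \<in> K \<boxplus> ?J}"
    proof (rule sumset_least[OF subgrp_commutes_mod[OF \<Phi> Z1]])
      show "K \<subseteq> {p \<in> \<Phi>. cj p z - z \<in> K \<boxplus> ?J}"
        using comm_right_mem[OF K _ zF] KZ1 nsubD(2)[OF K] by blast
      show "N \<subseteq> {p \<in> \<Phi>. cj p z - z \<in> K \<boxplus> ?J}" using 1 z nsubD(2)[OF N] by blast
    qed
    then show "z \<in> central_mod \<Phi> (K \<boxplus> ?J)"
      using insert.prems(2)[of N] zF by (auto simp: central_mod_def)
  qed
  moreover have "K \<boxplus> ?J \<subseteq> K \<boxplus> ?I" by (rule sumset_mono) auto
  ultimately have "(cstep \<Phi>)\<^sup>*\<^sup>* (K \<boxplus> ?J) (K \<boxplus> ?I)"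
    using chain_of_central[OF \<Phi> fng_chain_down[OF \<Phi> X ch] Z1] by blast
  then show ?case using ch by simp
qed

text \<open>The conclusion says that \<open>K\<close> has finitely generated image in the product of the \<open>\<Phi> / N\<close>. In the inductive step
  the kernel \<open>L\<close> of the projection that forgets \<open>N\<close> is, modulo \<open>N\<close>, the normal closure of finitely many
  elements, by \<open>chain_sum_Inter\<close>. As \<open>K\<close> maps onto \<open>\<Phi> / N\<close>, it suffices to conjugate these by elements of the
  subgroup generated by lifts to \<open>K\<close> of the generators of \<open>\<Phi>\<close>; the group \<open>H\<close> is generated by everything needed.\<close>

lemma normal_fg_mod_Inter:
  assumes \<Phi>: "subgrp \<Phi>" and X: "finite X" "gen X = \<Phi>" and K: "nsub \<Phi> K"
    and "finite \<N>" and "\<And>N. N \<in> \<N> \<Longrightarrow> nsub \<Phi> N" and "\<And>N. N \<in> \<N> \<Longrightarrow> \<Phi> \<subseteq> N \<boxplus> K"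
    and "\<And>N N'. N \<in> \<N> \<Longrightarrow> N' \<in> \<N> \<Longrightarrow> N \<noteq> N' \<Longrightarrow> \<Phi> \<subseteq> N \<boxplus> N'"
  shows "\<exists>Y. finite Y \<and> Y \<subseteq> K \<and> K \<subseteq> (K \<inter> \<Inter>\<N>) \<boxplus> gen Y"
  using assms(5-8)
proof (induction \<N> rule: finite_induct)
  case empty
  have "K \<subseteq> (K \<inter> \<Inter>{}) \<boxplus> gen {}" using sumset_upper1[OF subgrp_gen, of K] by simp
  then show ?case by blast
next
  case (insert N \<N>)
  let ?L = "K \<inter> \<Inter>\<N>"
  have "\<exists>Y. finite Y \<and> Y \<subseteq> K \<and> K \<subseteq> ?L \<boxplus> gen Y"
    by (rule insert.IH) (use insert.prems in simp_all)
  then obtain Y where Y: "finite Y" "Y \<subseteq> K" "K \<subseteq> ?L \<boxplus> gen Y" by blast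
  have N: "nsub \<Phi> N" using insert.prems by blast
  have KF: "K \<subseteq> \<Phi>" using nsubD(2)[OF K] .
  have Leq: "?L = \<Phi> \<inter> \<Inter>(insert K \<N>)" using KF by blast
  have KN: "nsub \<Phi> N'" if "N' \<in> insert K \<N>" for N'
    using that K insert.prems(1)[of N'] by (elim insertE) simp_all
  have L: "nsub \<Phi> ?L" unfolding Leq by (rule nsub_Inter[OF \<Phi> KN])
  have "(cstep \<Phi>)\<^sup>*\<^sup>* (N \<boxplus> ?L) \<Phi>" unfolding Leq
  proof (rule chain_sum_Inter[OF \<Phi> X N])
    show "\<Phi> \<subseteq> N \<boxplus> N'" if "N' \<in> insert K \<N>" for N'
    proof (cases "N' = K")
      case True then show ?thesis using insert.prems(2)[of N] by simp
    next
      case False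
      then have "N' \<in> \<N>" "N \<noteq> N'" using that insert.hyps(2) by auto
      then show ?thesis using insert.prems(3)[of N N'] by simp
    qed
  qed (use insert.hyps(1) KN in simp_all)
  then have "fng \<Phi> (N \<boxplus> ?L)" by (rule fng_chain_down[OF \<Phi> X])
  then obtain Y2 where Y2: "finite Y2" "Y2 \<subseteq> N \<boxplus> ?L" "N \<boxplus> ?L = ncl \<Phi> Y2"
    by (auto simp: fng_def)
  have "\<forall>y\<in>Y2. \<exists>l. l \<in> ?L \<and> (\<exists>n\<in>N. y = n + l)" using Y2(2) unfolding sumset_def by blast
  from bchoice[OF this] obtain l where l: "\<forall>y\<in>Y2. l y \<in> ?L \<and> (\<exists>n\<in>N. y = n + l y)" ..
  have XF: "X \<subseteq> \<Phi>" using X(2) gen_incl by blast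
  then have "\<forall>x\<in>X. \<exists>k. k \<in> K \<and> (\<exists>n\<in>N. x = n + k)"
    using insert.prems(2)[of N] unfolding sumset_def by blast
  from bchoice[OF this] obtain k where k: "\<forall>x\<in>X. k x \<in> K \<and> (\<exists>n\<in>N. x = n + k x)" ..
  define Y' where "Y' = Y \<union> l ` Y2 \<union> k ` X"
  have Y': "finite Y'" "Y' \<subseteq> K" using Y Y2(1) X(1) l k by (auto simp: Y'_def)
  define H where "H = gen Y'"
  have H: "subgrp H" "H \<subseteq> K" "Y' \<subseteq> H"
    unfolding H_def using gen_least[OF Y'(2) nsubD(1)[OF K]] by (simp_all add: subgrp_gen gen_incl subsetI)
  have NH: "subgrp (N \<boxplus> H)"
    by (rule subgrp_sumset[OF nsubD(1)[OF N] H(1)]) (use nsubD(3)[OF N] H(2) KF in blast)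
  have "X \<subseteq> N \<boxplus> H"
  proof
    fix x assume x: "x \<in> X"
    then obtain n where "n \<in> N" "x = n + k x" using k by blast
    moreover have "k x \<in> H" using x H(3) by (auto simp: Y'_def)
    ultimately show "x \<in> N \<boxplus> H" using sumsetI by metis
  qed
  then have FNH: "\<Phi> \<subseteq> N \<boxplus> H" using X(2) gen_least[OF _ NH] by blast
  let ?Q = "N \<boxplus> (H \<inter> ?L)"
  have HL: "subgrp (H \<inter> ?L)" by (intro subgrp_Int H nsubD(1)[OF L])
  have HLF: "H \<inter> ?L \<subseteq> \<Phi>" using KF by blast
  have Q: "nsub \<Phi> ?Q"
    unfolding nsub_def
  proof (intro conjI ballI)
    show sQ: "subgrp ?Q"
      by (rule subgrp_sumset[OF nsubD(1)[OF N] HL]) (use nsubD(3)[OF N] HLF in blast)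
    show "?Q \<subseteq> \<Phi>" by (rule sumset_least[OF \<Phi> nsubD(2)[OF N] HLF])
    fix p q assume p: "p \<in> \<Phi>" and q: "q \<in> ?Q"
    from subsetD[OF FNH p] obtain n h where nh: "n \<in> N" "h \<in> H" "p = n + h" by (rule sumsetE)
    from q obtain n' h' where q': "n' \<in> N" "h' \<in> H \<inter> ?L" "q = n' + h'" by (rule sumsetE)
    have hF: "h \<in> \<Phi>" using nh H(2) KF by blast
    have hh: "cj h h' \<in> H \<inter> ?L"
      using cj_mem[OF H(1) nh(2)] nsubD(3)[OF L hF] q'(2) by blast
    have "cj h q = cj h n' + cj h h'" by (simp add: q' cj_add)
    then have "cj h q \<in> ?Q" using hh nsubD(3)[OF N hF q'(1)] by (auto intro: sumsetI)
    moreover have "cj n (cj h q) - cj h q \<in> N"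
      using nsubD(3)[OF N] \<open>cj h q \<in> ?Q\<close> \<open>?Q \<subseteq> \<Phi>\<close> by (intro comm_right_mem[OF N nh(1)]) blast
    then have "cj n (cj h q) - cj h q \<in> ?Q" using sumset_upper1[OF HL] by blast
    ultimately have "(cj n (cj h q) - cj h q) + cj h q \<in> ?Q" by (intro subgrp_add[OF sQ])
    then show "cj p q \<in> ?Q" by (simp add: nh cj_cj)
  qed
  have "Y2 \<subseteq> ?Q"
  proof
    fix y assume y: "y \<in> Y2"
    then obtain n where "n \<in> N" "y = n + l y" using l by blast
    moreover have "l y \<in> H \<inter> ?L" using y l H(3) by (auto simp: Y'_def)
    ultimately show "y \<in> ?Q" using sumsetI by metis
  qed
  then have LQ: "?L \<subseteq> ?Q"
    using ncl_least[OF _ Q] Y2(3) sumset_upper2[OF nsubD(1)[OF N], of ?L] by blast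
  have "K \<subseteq> (K \<inter> \<Inter>(insert N \<N>)) \<boxplus> gen Y'"
  proof
    fix x assume "x \<in> K"
    from subsetD[OF Y(3) this] obtain a g where ag: "a \<in> ?L" "g \<in> gen Y" "x = a + g" by (rule sumsetE)
    from subsetD[OF LQ ag(1)] obtain n h where nh: "n \<in> N" "h \<in> H \<inter> ?L" "a = n + h" by (rule sumsetE)
    have "n = a - h" using nh by simp
    then have "n \<in> ?L" using ag nh subgrp_diff[OF nsubD(1)[OF L]] by blast
    moreover have "h + g \<in> gen Y'"
      using nh ag gen_mono[of Y Y'] by (intro subgrp_add[OF subgrp_gen]) (auto simp: H_def Y'_def)
    moreover have "x = n + (h + g)" using ag nh by (simp add: add.assoc)
    ultimately show "x \<in> (K \<inter> \<Inter>(insert N \<N>)) \<boxplus> gen Y'" using nh by (auto intro: sumsetI)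
  qed
  then show ?case using Y' by blast
qed

lemma free_section:
  fixes p :: "'g::group_add \<Rightarrow> 'x fgrp"
  assumes p: "ghom p" and M: "subgrp M"
  obtains \<sigma> where "\<And>m. m \<in> M \<Longrightarrow> \<sigma> (p m) \<in> M \<and> p (\<sigma> (p m)) = p m" "\<sigma> 0 = 0"
    and "\<And>m n. m \<in> M \<Longrightarrow> n \<in> M \<Longrightarrow> \<sigma> (p m + p n) = \<sigma> (p m) + \<sigma> (p n)"
    and "\<And>m n. m \<in> M \<Longrightarrow> n \<in> M \<Longrightarrow> \<sigma> (p m - p n) = \<sigma> (p m) - \<sigma> (p n)"
proof -
  interpret p: ghom p by fact
  obtain \<sigma> where \<sigma>: "\<And>n. n \<in> p ` M \<Longrightarrow> \<sigma> n \<in> M \<and> p (\<sigma> n) = n"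
    and add: "\<And>m n. m \<in> p ` M \<Longrightarrow> n \<in> p ` M \<Longrightarrow> \<sigma> (m + n) = \<sigma> m + \<sigma> n"
    using free_subgroup_projective[OF p M refl] by metis
  have 0: "0 \<in> p ` M" using subgrp_zero[OF p.subgrp_image[OF M]] .
  have \<sigma>0: "\<sigma> 0 = 0"
  proof -
    have "\<sigma> 0 + \<sigma> 0 = \<sigma> 0 + 0" using add[OF 0 0] by simp
    then show ?thesis by (rule add_left_imp_eq)
  qed
  have diff: "\<sigma> (p m - p n) = \<sigma> (p m) - \<sigma> (p n)" if "m \<in> M" "n \<in> M" for m n
  proof -
    have "p m - p n \<in> p ` M" using that subgrp_diff[OF p.subgrp_image[OF M]] by blast
    then have "\<sigma> (p m - p n) + \<sigma> (p n) = \<sigma> (p m - p n + p n)" using that by (subst add) simp_all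
    then have "\<sigma> (p m - p n) + \<sigma> (p n) = \<sigma> (p m)" by simp
    then show ?thesis by (simp add: eq_diff_eq)
  qed
  show ?thesis by (rule that[of \<sigma>]) (use \<sigma> add \<sigma>0 diff in auto)
qed

text \<open>The image of \<open>p\<close> is projective, so it has a section \<open>\<sigma>\<close>, and the relations saying
  that every generator \<open>x\<close> equals \<open>\<sigma> (p x)\<close> suffice.\<close>

lemma fng_kernel_to_free:
  fixes p :: "'g::group_add \<Rightarrow> 'x fgrp"
  assumes p: "ghom p" and \<Phi>: "subgrp \<Phi>" and X: "finite X" "gen X = \<Phi>"
  shows "fng \<Phi> (ghom.ker_in p \<Phi>)"
proof -
  interpret p: ghom p by fact
  obtain \<sigma> where \<sigma>: "\<And>m. m \<in> \<Phi> \<Longrightarrow> \<sigma> (p m) \<in> \<Phi> \<and> p (\<sigma> (p m)) = p m" "\<sigma> 0 = 0"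
    and diff: "\<And>m n. m \<in> \<Phi> \<Longrightarrow> n \<in> \<Phi> \<Longrightarrow> \<sigma> (p m - p n) = \<sigma> (p m) - \<sigma> (p n)"
    using free_section[OF p \<Phi>] by metis
  define R where "R = (\<lambda>x. x - \<sigma> (p x)) ` X"
  have XF: "X \<subseteq> \<Phi>" using X(2) gen_incl by blast
  have RK: "R \<subseteq> p.ker_in \<Phi>"
    using XF \<sigma> subgrp_diff[OF \<Phi>] by (auto simp: R_def p.ker_in_def p.diff)
  then have RF: "R \<subseteq> \<Phi>" by (auto simp: p.ker_in_def)
  note Q = nsub_ncl[OF \<Phi> RF]
  have "subgrp {a \<in> \<Phi>. a - \<sigma> (p a) \<in> ncl \<Phi> R}"
    unfolding subgrp_def
  proof (intro conjI ballI)
    show "0 \<in> {a \<in> \<Phi>. a - \<sigma> (p a) \<in> ncl \<Phi> R}"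
      using subgrp_zero[OF \<Phi>] subgrp_zero[OF nsubD(1)[OF Q]] by (simp add: \<sigma>)
    fix a b assume "a \<in> {a \<in> \<Phi>. a - \<sigma> (p a) \<in> ncl \<Phi> R}" "b \<in> {a \<in> \<Phi>. a - \<sigma> (p a) \<in> ncl \<Phi> R}"
    then have ab: "a \<in> \<Phi>" "b \<in> \<Phi>" "a - \<sigma> (p a) \<in> ncl \<Phi> R" "b - \<sigma> (p b) \<in> ncl \<Phi> R" by auto
    have "\<sigma> (p (a - b)) = \<sigma> (p a) - \<sigma> (p b)" using ab by (simp add: p.diff diff)
    then have "a - b - \<sigma> (p (a - b)) = cj (a - \<sigma> (p b)) (- (b - \<sigma> (p b))) + (a - \<sigma> (p a))"
      by (simp add: cj_def group_add_simps del: add_uminus_conv_diff)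
    moreover have "\<dots> \<in> ncl \<Phi> R"
      by (intro subgrp_add subgrp_uminus nsubD(1,3)[OF Q] ab subgrp_diff[OF \<Phi>]) (use ab \<sigma> in auto)
    ultimately show "a - b \<in> {a \<in> \<Phi>. a - \<sigma> (p a) \<in> ncl \<Phi> R}"
      using subgrp_diff[OF \<Phi> ab(1,2)] by simp
  qed
  moreover have "X \<subseteq> {a \<in> \<Phi>. a - \<sigma> (p a) \<in> ncl \<Phi> R}"
    using XF ncl_incl[OF \<Phi>, of R] by (auto simp: R_def)
  ultimately have "\<Phi> \<subseteq> {a \<in> \<Phi>. a - \<sigma> (p a) \<in> ncl \<Phi> R}" using X(2) gen_least by blast
  then have all: "a - \<sigma> (p a) \<in> ncl \<Phi> R" if "a \<in> \<Phi>" for a using that by blast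
  have "p.ker_in \<Phi> \<subseteq> ncl \<Phi> R"
  proof
    fix a assume "a \<in> p.ker_in \<Phi>"
    then have "a \<in> \<Phi>" "p a = 0" by (simp_all add: p.ker_in_def)
    then show "a \<in> ncl \<Phi> R" using all[of a] by (simp add: \<sigma>)
  qed
  then have eq: "p.ker_in \<Phi> = ncl \<Phi> R" by (rule subset_antisym[OF _ ncl_least[OF RK p.nsub_ker[OF \<Phi>]]])
  have "finite R" using X(1) by (simp add: R_def)
  then show ?thesis unfolding fng_def using RK eq by (intro exI[of _ R] conjI)
qed

text \<open>If \<open>K\<close> and \<open>M\<close> commute modulo \<open>D\<close>, the factors \<open>a\<close> and \<open>b\<close> from
  \<open>K\<close> drop out of a commutator modulo \<open>D\<close>.\<close>

lemma commutators_of_almost_central: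
  assumes \<Phi>: "subgrp \<Phi>" and D: "nsub \<Phi> D" and M: "subgrp M" "M \<subseteq> \<Phi>" and K: "K \<subseteq> \<Phi>"
    and KM: "\<And>\<kappa> m. \<kappa> \<in> K \<Longrightarrow> m \<in> M \<Longrightarrow> cj \<kappa> m - m \<in> D"
    and a: "a \<in> K" "a' \<in> M" and b: "b \<in> K" "b' \<in> M" "b \<in> M"
  shows "\<exists>d\<in>D. cj (a + a') (b + b') - (b + b') = d + (cj a' b' - b')"
proof -
  have MK: "cj m \<kappa> - \<kappa> \<in> D" if "\<kappa> \<in> K" "m \<in> M" for m \<kappa>
  proof -
    have "cj m \<kappa> - \<kappa> = - (cj \<kappa> m - m)"
      by (simp add: cj_def group_add_simps del: add_uminus_conv_diff)
    then show ?thesis using subgrp_uminus[OF nsubD(1)[OF D] KM[OF that]] by simp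
  qed
  have bM: "b + b' \<in> M" using b subgrp_add[OF M(1)] by blast
  define d1 where "d1 = cj a (cj a' (b + b')) - cj a' (b + b')"
  define d2 where "d2 = cj a' b - b"
  define d3 where "d3 = cj b (cj a' b' - b') - (cj a' b' - b')"
  have "d1 \<in> D" unfolding d1_def by (intro KM a cj_mem M(1) bM)
  moreover have "d2 \<in> D" unfolding d2_def by (intro MK b a)
  moreover have "d3 \<in> D" unfolding d3_def by (intro KM b subgrp_diff cj_mem M(1) a)
  ultimately have "d1 + d2 + d3 \<in> D" using subgrp_add[OF nsubD(1)[OF D]] by simp
  moreover have "cj (a + a') (b + b') - (b + b') = d1 + d2 + d3 + (cj a' b' - b')"
    by (simp add: d1_def d2_def d3_def cj_def group_add_simps del: add_uminus_conv_diff)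
  ultimately show ?thesis by blast
qed

text \<open>Modulo \<open>D\<close>, the kernel of \<open>p\<close> on \<open>M\<close> is central, and it is a direct factor because the image of \<open>p\<close> is
  projective: \<open>m - \<sigma> (p m)\<close> is the projection onto it. Hence it meets the commutator subgroup trivially. The set
  \<open>U\<close> is the kernel of this projection; it contains all commutators.\<close>

lemma commutator_Int_kernel:
  fixes p :: "'g::group_add \<Rightarrow> 'x fgrp"
  assumes p: "ghom p" and \<Phi>: "subgrp \<Phi>" and D: "nsub \<Phi> D" and M: "nsub \<Phi> M"
    and DM: "D \<subseteq> M" and Dp: "\<And>d. d \<in> D \<Longrightarrow> p d = 0"
    and KM: "\<And>\<kappa> m. \<kappa> \<in> \<Phi> \<Longrightarrow> p \<kappa> = 0 \<Longrightarrow> m \<in> M \<Longrightarrow> cj \<kappa> m - m \<in> D"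
    and m: "m \<in> gen (D \<union> {cj a b - b | a b. a \<in> M \<and> b \<in> M})" "p m = 0"
  shows "m \<in> D"
proof -
  interpret p: ghom p by fact
  note sM = nsubD(1)[OF M] and sD = nsubD(1)[OF D] and MF = nsubD(2)[OF M]
  obtain \<sigma> where \<sigma>: "\<And>m. m \<in> M \<Longrightarrow> \<sigma> (p m) \<in> M \<and> p (\<sigma> (p m)) = p m" and \<sigma>0: "\<sigma> 0 = 0"
    and add: "\<And>m n. m \<in> M \<Longrightarrow> n \<in> M \<Longrightarrow> \<sigma> (p m + p n) = \<sigma> (p m) + \<sigma> (p n)"
    and diff: "\<And>m n. m \<in> M \<Longrightarrow> n \<in> M \<Longrightarrow> \<sigma> (p m - p n) = \<sigma> (p m) - \<sigma> (p n)"
    using free_section[OF p sM] by metis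
  define U where "U = {m \<in> M. m - \<sigma> (p m) \<in> D}"
  have "subgrp U"
    unfolding subgrp_def
  proof (intro conjI ballI)
    show "0 \<in> U" using subgrp_zero[OF sM] subgrp_zero[OF sD] by (simp add: U_def \<sigma>0)
    fix a b assume "a \<in> U" "b \<in> U"
    then have ab: "a \<in> M" "b \<in> M" "a - \<sigma> (p a) \<in> D" "b - \<sigma> (p b) \<in> D" by (auto simp: U_def)
    have "\<sigma> (p (a - b)) = \<sigma> (p a) - \<sigma> (p b)" using ab by (simp add: p.diff diff)
    then have "a - b - \<sigma> (p (a - b)) = cj (a - \<sigma> (p b)) (- (b - \<sigma> (p b))) + (a - \<sigma> (p a))"
      by (simp add: cj_def group_add_simps del: add_uminus_conv_diff)
    moreover have "\<dots> \<in> D"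
      by (intro subgrp_add subgrp_uminus sD nsubD(3)[OF D] ab subgrp_diff[OF \<Phi>]) (use ab \<sigma> MF in auto)
    ultimately show "a - b \<in> U" using subgrp_diff[OF sM ab(1,2)] by (simp add: U_def)
  qed
  moreover have "D \<subseteq> U" using DM by (auto simp: U_def Dp \<sigma>0)
  moreover have "cj a b - b \<in> U" if a: "a \<in> M" and b: "b \<in> M" for a b
  proof -
    let ?a = "\<sigma> (p a)" and ?b = "\<sigma> (p b)"
    have cM: "cj a b \<in> M" "cj a b - b \<in> M" using a b by (simp_all add: cj_mem sM subgrp_diff)
    have "\<sigma> (p (cj a b)) = cj ?a ?b"
    proof -
      have "\<sigma> (p (a + b) - p a) = \<sigma> (p (a + b)) - ?a" by (intro diff subgrp_add sM a b)
      then show ?thesis using add[OF a b] by (simp add: cj_def p.add p.diff)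
    qed
    then have c: "\<sigma> (p (cj a b - b)) = cj ?a ?b - ?b" using diff[OF cM(1) b] by (simp add: p.diff)
    let ?K = "{\<kappa> \<in> \<Phi>. p \<kappa> = 0}"
    have ker: "x - \<sigma> (p x) \<in> M" "x - \<sigma> (p x) \<in> ?K" if "x \<in> M" for x
      using that \<sigma>[OF that] subgrp_diff[OF sM] MF by (auto simp: p.diff)
    have "\<exists>d\<in>D. cj ((a - ?a) + ?a) ((b - ?b) + ?b) - ((b - ?b) + ?b) = d + (cj ?a ?b - ?b)"
      by (rule commutators_of_almost_central[OF \<Phi> D sM MF, of ?K]) (use ker a b \<sigma> KM in auto)
    then obtain d where "d \<in> D" "cj a b - b = d + (cj ?a ?b - ?b)" by auto
    then show ?thesis using cM(2) c by (simp add: U_def)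
  qed
  ultimately have "gen (D \<union> {cj a b - b | a b. a \<in> M \<and> b \<in> M}) \<subseteq> U" by (intro gen_least) auto
  then show ?thesis using m by (auto simp: U_def \<sigma>0)
qed

text \<open>The inductive step. The normal closure \<open>D\<close> of the finite set \<open>d\<close> lies in \<open>K \<inter> M'\<close>, and its elements are
  chosen such that modulo \<open>D\<close> the group \<open>K\<close> is generated by \<open>Y\<close> and commutes with \<open>M'\<close>. It
  remains to generate \<open>K \<inter> M'\<close> modulo \<open>D\<close>, where it embeds into the abelianization \<open>M' / V\<close> of \<open>M'\<close>. There \<open>K\<close>
  and \<open>M'\<close> act trivially, so that Hall's theorem applies along the chain from \<open>K \<boxplus> M'\<close> to \<open>\<Phi>\<close>.\<close>

lemma fng_Int_step:
  fixes p :: "'g::group_add \<Rightarrow> 'x fgrp"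
  assumes p: "ghom p" and \<Phi>: "subgrp \<Phi>" and X: "finite X" "gen X = \<Phi>"
    and Kdef: "K = {a \<in> \<Phi>. p a = 0}"
    and M': "nsub \<Phi> M'" "fng \<Phi> M'"
    and Y: "finite Y" "Y \<subseteq> K" "K \<subseteq> (K \<inter> M') \<boxplus> gen Y"
    and ch: "(cstep \<Phi>)\<^sup>*\<^sup>* (K \<boxplus> M') \<Phi>"
  shows "fng \<Phi> (K \<inter> M')"
proof -
  interpret p: ghom p by fact
  have K: "nsub \<Phi> K" using p.nsub_ker[OF \<Phi>] by (simp add: Kdef p.ker_in_def)
  define M where "M = K \<inter> M'"
  have M: "nsub \<Phi> M" unfolding M_def by (rule nsub_Int[OF K M'(1)])
  note KF = nsubD(2)[OF K] and MF = nsubD(2)[OF M]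
  have XF: "X \<subseteq> \<Phi>" using X(2) gen_incl by blast
  obtain s where s: "finite s" "s \<subseteq> M'" "M' = ncl \<Phi> s" using M'(2) by (auto simp: fng_def)
  have "fng \<Phi> K" using fng_kernel_to_free[OF p \<Phi> X] by (simp add: Kdef p.ker_in_def)
  then obtain \<rho> where \<rho>: "finite \<rho>" "\<rho> \<subseteq> K" "K = ncl \<Phi> \<rho>" by (auto simp: fng_def)
  have "\<forall>k\<in>K. \<exists>\<mu>. \<mu> \<in> M \<and> (\<exists>g\<in>gen Y. k = \<mu> + g)"
    using Y(3) unfolding sumset_def M_def by blast
  from bchoice[OF this] obtain \<mu> where \<mu>: "\<forall>k\<in>K. \<mu> k \<in> M \<and> (\<exists>g\<in>gen Y. k = \<mu> k + g)" ..
  \<comment> \<open>the elements of \<open>K\<close> that have to become words in \<open>Y\<close>: normal generators of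
    \<open>K\<close>, and the conjugates of \<open>Y\<close> by generators of \<open>\<Phi>\<close> and by their inverses\<close>
  define T where "T = \<rho> \<union> (\<lambda>(x, y). cj x y) ` (X \<times> Y) \<union> (\<lambda>(x, y). cj (- x) y) ` (X \<times> Y)"
  define d where "d = \<mu> ` T \<union> (\<lambda>(y, a). cj y a - a) ` (Y \<times> s)"
  have Xm: "- x \<in> \<Phi>" if "x \<in> X" for x using that XF subgrp_uminus[OF \<Phi>] by blast
  have TK: "T \<subseteq> K"
    unfolding T_def using \<rho>(2) nsubD(3)[OF K subsetD[OF XF] subsetD[OF Y(2)]]
      nsubD(3)[OF K Xm subsetD[OF Y(2)]] by auto
  have fd: "finite d" using \<rho>(1) X(1) Y(1) s(1) by (simp add: d_def T_def)
  have dM: "d \<subseteq> M"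
  proof -
    have "cj y a - a \<in> M" if "y \<in> Y" "a \<in> s" for y a
    proof -
      have y: "y \<in> K" "y \<in> \<Phi>" and a: "a \<in> M'" "a \<in> \<Phi>"
        using that Y(2) s(2) KF nsubD(2)[OF M'(1)] by blast+
      show ?thesis unfolding M_def
        using comm_right_mem[OF K y(1) a(2)] comm_left_mem[OF M'(1) a(1) y(2)] by blast
    qed
    then show ?thesis using \<mu> TK by (auto simp: d_def)
  qed
  define D where "D = ncl \<Phi> d"
  have D: "nsub \<Phi> D" unfolding D_def by (rule nsub_ncl[OF \<Phi>]) (use dM MF in blast)
  have dD: "d \<subseteq> D" unfolding D_def by (rule ncl_incl[OF \<Phi>])
  have DM: "D \<subseteq> M" unfolding D_def by (rule ncl_least[OF dM M])
  note sD = nsubD(1)[OF D] and DF = nsubD(2)[OF D]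
  have YF: "gen Y \<subseteq> \<Phi>" using Y(2) KF by (intro gen_least \<Phi>) blast
  define Q where "Q = D \<boxplus> gen Y"
  have sQ: "subgrp Q" unfolding Q_def
    by (rule subgrp_sumset[OF sD subgrp_gen]) (use nsubD(3)[OF D] YF in blast)
  have TQ: "T \<subseteq> Q"
  proof
    fix k assume k: "k \<in> T"
    then obtain g where "g \<in> gen Y" "k = \<mu> k + g" using \<mu> TK by blast
    moreover have "\<mu> k \<in> D" using k dD by (auto simp: d_def)
    ultimately show "k \<in> Q" unfolding Q_def using sumsetI by metis
  qed
  have QF: "Q \<subseteq> \<Phi>" unfolding Q_def by (rule sumset_least[OF \<Phi> DF YF])
  have cjQ: "cj x q \<in> Q" if x: "x \<in> \<Phi>" and xY: "\<And>y. y \<in> Y \<Longrightarrow> cj x y \<in> Q" and q: "q \<in> Q" for x q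
  proof -
    from q obtain \<delta> g where q': "\<delta> \<in> D" "g \<in> gen Y" "q = \<delta> + g" unfolding Q_def by (rule sumsetE)
    from q'(2) have "cj x g \<in> Q"
      by induction (auto simp: cj_diff subgrp_zero[OF sQ] subgrp_diff[OF sQ] xY)
    moreover have "cj x \<delta> \<in> Q"
      using nsubD(3)[OF D x q'(1)] sumset_upper1[OF subgrp_gen] unfolding Q_def by blast
    ultimately show ?thesis by (simp add: q' cj_add subgrp_add[OF sQ])
  qed
  have Q: "nsub \<Phi> Q"
    unfolding nsub_def
  proof (intro conjI ballI sQ QF)
    fix x q assume x: "x \<in> \<Phi>" and q: "q \<in> Q"
    have "cj x q \<in> Q \<and> cj (- x) q \<in> Q" if "x \<in> X" "q \<in> Q" for x q
    proof
      have 1: "cj x y \<in> Q" "cj (- x) y \<in> Q" if "y \<in> Y" for y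
        using that \<open>x \<in> X\<close> TQ by (auto simp: T_def)
      show "cj x q \<in> Q" by (rule cjQ[OF _ 1(1) that(2)]) (use that XF in auto)
      show "cj (- x) q \<in> Q" by (rule cjQ[OF Xm[OF that(1)] 1(2) that(2)])
    qed
    then show "cj x q \<in> Q" using gen_invariant[of X Q x] x q X(2) by blast
  qed
  have "\<rho> \<subseteq> Q" using TQ by (auto simp: T_def)
  then have KQ: "K \<subseteq> Q" using \<rho>(3) ncl_least[OF _ Q] by blast
  have sc: "cj \<kappa> a - a \<in> D" if a: "a \<in> s" and "\<kappa> \<in> K" for a \<kappa>
  proof -
    have aF: "a \<in> \<Phi>" using a s(2) nsubD(2)[OF M'(1)] by blast
    let ?C = "{p \<in> \<Phi>. cj p a - a \<in> D}"
    note C = subgrp_commutes_mod[OF \<Phi> D, of a]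
    have "D \<subseteq> ?C" using comm_right_mem[OF D _ aF] DF by blast
    moreover have "Y \<subseteq> ?C" using Y(2) KF dD a by (auto simp: d_def)
    then have "gen Y \<subseteq> ?C" by (rule gen_least[OF _ C])
    ultimately have "Q \<subseteq> ?C" unfolding Q_def by (intro sumset_least[OF C])
    then show ?thesis using KQ that by blast
  qed
  have KM: "cj \<kappa> m - m \<in> D" if \<kappa>: "\<kappa> \<in> K" and m: "m \<in> M'" for \<kappa> m
  proof -
    let ?C = "{a \<in> \<Phi>. \<forall>p\<in>K. cj p a - a \<in> D}"
    have "{cj q a |q a. q \<in> \<Phi> \<and> a \<in> s} \<subseteq> ?C"
    proof clarify
      fix q a assume q: "q \<in> \<Phi>" and a: "a \<in> s"
      have aF: "a \<in> \<Phi>" using a s(2) nsubD(2)[OF M'(1)] by blast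
      have "cj k (cj q a) - cj q a \<in> D" if "k \<in> K" for k
      proof -
        have "cj k (cj q a) - cj q a = cj q (cj (cj (- q) k) a - a)"
          by (simp add: cj_def group_add_simps del: add_uminus_conv_diff)
        moreover have "cj (- q) k \<in> K" by (intro nsubD(3)[OF K] subgrp_uminus \<Phi> q that)
        ultimately show ?thesis using nsubD(3)[OF D q sc[OF a]] by simp
      qed
      then show "cj q a \<in> \<Phi> \<and> (\<forall>p\<in>K. cj p (cj q a) - cj q a \<in> D)"
        using cj_mem[OF \<Phi> q aF] by blast
    qed
    then have "M' \<subseteq> ?C" unfolding s(3) ncl_def
      by (rule gen_least[OF _ subgrp_centralizer_mod[OF \<Phi> D KF]])
    then show ?thesis using that by blast
  qed
  define R where "R = D \<union> {cj a b - b | a b. a \<in> M' \<and> b \<in> M'}"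
  define V where "V = gen R"
  have M'F: "M' \<subseteq> \<Phi>" using nsubD(2)[OF M'(1)] .
  have RM: "R \<subseteq> M'"
    using DM comm_left_mem[OF M'(1)] M'F by (auto simp: R_def M_def)
  have V: "nsub \<Phi> V"
    unfolding nsub_def
  proof (intro conjI ballI)
    show "subgrp V" by (simp add: V_def subgrp_gen)
    show "V \<subseteq> \<Phi>" unfolding V_def by (rule gen_least[OF subset_trans[OF RM M'F] \<Phi>])
    fix q v assume q: "q \<in> \<Phi>" and "v \<in> V"
    have "cj q r \<in> R" if r: "r \<in> R" for r
    proof (cases "r \<in> D")
      case False
      then obtain a b where ab: "a \<in> M'" "b \<in> M'" "r = cj a b - b" using r by (auto simp: R_def)
      have "cj q r = cj (cj q a) (cj q b) - cj q b"
        unfolding ab(3) by (simp add: cj_def group_add_simps del: add_uminus_conv_diff)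
      then show ?thesis using nsubD(3)[OF M'(1) q] ab by (auto simp: R_def)
    next
      case True
      then have "cj q r \<in> D" by (rule nsubD(3)[OF D q])
      then show ?thesis by (simp add: R_def)
    qed
    then have "cj q r \<in> gen R" if "r \<in> R" for r using that by (intro gen_incl)
    then show "cj q v \<in> V" using \<open>v \<in> V\<close> unfolding V_def by (rule gen_cj_closed)
  qed
  have VM': "V \<subseteq> M'" unfolding V_def by (rule gen_least[OF RM nsubD(1)[OF M'(1)]])
  interpret A: abelian_section \<Phi> V M'
  proof
    show "cj a b - b \<in> V" if "a \<in> M'" "b \<in> M'" for a b
      unfolding V_def by (rule gen_incl) (use that in \<open>auto simp: R_def\<close>)
  qed (fact \<Phi> V M'(1) VM')+
  have Z: "nsub \<Phi> (K \<boxplus> M')" by (rule nsub_sumset[OF K M'(1) \<Phi>])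
  have triv: "cj z w - w \<in> V" if "z \<in> K \<boxplus> M'" "w \<in> M'" for z w
  proof -
    have "K \<boxplus> M' \<subseteq> {p \<in> \<Phi>. cj p w - w \<in> V}"
    proof (rule sumset_least[OF subgrp_commutes_mod[OF \<Phi> V]])
      have "D \<subseteq> V" unfolding V_def R_def by (auto intro: gen_incl)
      then show "K \<subseteq> {p \<in> \<Phi>. cj p w - w \<in> V}" using KM[OF _ that(2)] KF by blast
      show "M' \<subseteq> {p \<in> \<Phi>. cj p w - w \<in> V}" using A.abelian[OF _ that(2)] M'F by blast
    qed
    then show ?thesis using that by blast
  qed
  have "A.noeth (K \<boxplus> M')" by (rule A.noeth_trivial_action[OF nsubD(1,2)[OF Z] triv])
  then have noeth: "A.noeth \<Phi>" using A.noeth_chain[OF ch Z] by blast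
  have VM: "nsub \<Phi> (V \<boxplus> M)" by (rule nsub_sumset[OF V M \<Phi>])
  have sub: "A.submod \<Phi> (V \<boxplus> M)"
    unfolding A.submod_def
    using nsubD(1,3)[OF VM] sumset_upper1[OF nsubD(1)[OF M], of V]
      sumset_least[OF nsubD(1)[OF M'(1)] VM', of M] by (auto simp: M_def)
  have "M' \<subseteq> A.modspan \<Phi> s"
    unfolding s(3) ncl_def A.modspan_def by (rule gen_mono) blast
  then have "V \<boxplus> M \<subseteq> A.modspan \<Phi> s" using A.submodD(3)[OF sub] by blast
  then obtain z where z: "finite z" "z \<subseteq> V \<boxplus> M" "V \<boxplus> M = A.modspan \<Phi> z"
    by (rule A.noethD[OF noeth s(1,2) sub])
  have "\<forall>x\<in>z. \<exists>e. e \<in> M \<and> (\<exists>v\<in>V. x = v + e)" using z(2) unfolding sumset_def by blast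
  from bchoice[OF this] obtain e where e: "\<forall>x\<in>z. e x \<in> M \<and> (\<exists>v\<in>V. x = v + e x)" ..
  define E where "E = ncl \<Phi> (e ` z)"
  have eM: "e ` z \<subseteq> M" using e by blast
  have E: "nsub \<Phi> E" unfolding E_def by (rule nsub_ncl[OF \<Phi>]) (use eM MF in blast)
  have EM: "E \<subseteq> M" unfolding E_def by (rule ncl_least[OF eM M])
  have eE: "e ` z \<subseteq> E" unfolding E_def by (rule ncl_incl[OF \<Phi>])
  have VE: "nsub \<Phi> (V \<boxplus> E)" by (rule nsub_sumset[OF V E \<Phi>])
  have "z \<subseteq> V \<boxplus> E"
  proof
    fix x assume x: "x \<in> z"
    then obtain v where "v \<in> V" "x = v + e x" using e by blast
    moreover have "e x \<in> E" using x eE by blast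
    ultimately show "x \<in> V \<boxplus> E" using sumsetI by metis
  qed
  moreover have "A.submod \<Phi> (V \<boxplus> E)"
    unfolding A.submod_def
    using nsubD(1,3)[OF VE] sumset_upper1[OF nsubD(1)[OF E], of V]
      sumset_least[OF nsubD(1)[OF M'(1)] VM', of E] EM by (auto simp: M_def)
  ultimately have "V \<boxplus> M \<subseteq> V \<boxplus> E" unfolding z(3) by (intro A.modspan_least)
  then have MVE: "M \<subseteq> V \<boxplus> E" using sumset_upper2[OF nsubD(1)[OF V], of M] by blast
  define G where "G = d \<union> e ` z"
  have GM: "G \<subseteq> M" using dM eM by (simp add: G_def)
  have "M \<subseteq> ncl \<Phi> G"
  proof
    fix m assume m: "m \<in> M"
    from subsetD[OF MVE m] obtain v c where vc: "v \<in> V" "c \<in> E" "m = v + c" by (rule sumsetE)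
    have "v = m - c" using vc by simp
    then have vM: "v \<in> M" using m vc EM subgrp_diff[OF nsubD(1)[OF M]] by blast
    have "v \<in> D"
    proof (rule commutator_Int_kernel[OF p \<Phi> D M'(1)])
      show "v \<in> gen (D \<union> {cj a b - b |a b. a \<in> M' \<and> b \<in> M'})" using vc by (simp add: V_def R_def)
    qed (use DM vM KM in \<open>auto simp: M_def Kdef\<close>)
    then have "v \<in> ncl \<Phi> G" using ncl_mono[of d G \<Phi>] by (auto simp: D_def G_def)
    moreover have "c \<in> ncl \<Phi> G" using vc ncl_mono[of "e ` z" G \<Phi>] by (auto simp: E_def G_def)
    ultimately show "m \<in> ncl \<Phi> G"
      unfolding vc(3) ncl_def by (intro subgrp_add[OF subgrp_gen])
  qed
  then have "M = ncl \<Phi> G" using ncl_least[OF GM M] by blast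
  moreover have "finite G" using fd z(1) by (simp add: G_def)
  ultimately show ?thesis using GM unfolding fng_def M_def[symmetric] by (intro exI[of _ G] conjI)
qed

text \<open>In terms of quotients: the image of \<open>\<Phi>\<close> in a finite direct product of free groups has
  finitely many relators over \<open>\<Phi>\<close> if it projects onto the product of the images of any two factors.\<close>

theorem fng_Inter_kernels:
  fixes \<N> :: "'g::group_add set set"
  assumes \<Phi>: "subgrp \<Phi>" and X: "finite X" "gen X = \<Phi>" and "finite \<N>"
    and "\<And>N. N \<in> \<N> \<Longrightarrow> \<exists>p :: 'g \<Rightarrow> 'x fgrp. ghom p \<and> N = {a \<in> \<Phi>. p a = 0}"
    and "\<And>N N'. N \<in> \<N> \<Longrightarrow> N' \<in> \<N> \<Longrightarrow> N \<noteq> N' \<Longrightarrow> \<Phi> \<subseteq> N \<boxplus> N'"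
  shows "fng \<Phi> (\<Phi> \<inter> \<Inter>\<N>)"
  using assms(4-6)
proof (induction \<N> rule: finite_induct)
  case empty
  show ?case using fng_chain_down[OF \<Phi> X rtranclp.rtrancl_refl] by simp
next
  case (insert K \<N>)
  have nsub: "nsub \<Phi> N" if N: "N \<in> insert K \<N>" for N
  proof -
    obtain p :: "'g \<Rightarrow> 'x fgrp" where p: "ghom p" "N = {a \<in> \<Phi>. p a = 0}" using insert.prems(1)[OF N] by blast
    then show ?thesis using ghom.nsub_ker[OF p(1) \<Phi>] by (simp add: ghom.ker_in_def)
  qed
  obtain p :: "'g \<Rightarrow> 'x fgrp" where p: "ghom p" "K = {a \<in> \<Phi>. p a = 0}"
    using insert.prems(1)[of K] by blast
  have KF: "K \<subseteq> \<Phi>" using p by blast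
  have pair: "\<Phi> \<subseteq> K \<boxplus> N" "\<Phi> \<subseteq> N \<boxplus> K" if "N \<in> \<N>" for N
  proof -
    have "N \<noteq> K" using that insert.hyps(2) by blast
    then show "\<Phi> \<subseteq> K \<boxplus> N" "\<Phi> \<subseteq> N \<boxplus> K"
      using insert.prems(2)[of K N] insert.prems(2)[of N K] that by simp_all
  qed
  let ?M' = "\<Phi> \<inter> \<Inter>\<N>"
  have M': "nsub \<Phi> ?M'" by (rule nsub_Inter[OF \<Phi>]) (use nsub in simp)
  have f: "fng \<Phi> ?M'" by (rule insert.IH) (use insert.prems in simp_all)
  have KI: "K \<inter> \<Inter>\<N> = K \<inter> ?M'" using KF by blast
  have ch: "(cstep \<Phi>)\<^sup>*\<^sup>* (K \<boxplus> ?M') \<Phi>"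
    by (rule chain_sum_Inter[OF \<Phi> X]) (use nsub pair insert.hyps(1) in simp_all)
  have "\<exists>Y. finite Y \<and> Y \<subseteq> K \<and> K \<subseteq> (K \<inter> \<Inter>\<N>) \<boxplus> gen Y"
    by (rule normal_fg_mod_Inter[OF \<Phi> X]) (use nsub pair insert.hyps(1) insert.prems(2) in simp_all)
  then obtain Y where "finite Y" "Y \<subseteq> K" "K \<subseteq> (K \<inter> ?M') \<boxplus> gen Y" unfolding KI by blast
  then have "fng \<Phi> (K \<inter> ?M')" by (rule fng_Int_step[OF p(1) \<Phi> X p(2) M' f _ _ _ ch])
  moreover have "K \<inter> ?M' = \<Phi> \<inter> \<Inter>(insert K \<N>)" using KF by blast
  ultimately show ?case by simp
qed

section \<open>Presentations\<close>

definition fgrp_on :: "'x set \<Rightarrow> 'x fgrp set" where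
  "fgrp_on X = {a. Rep_fgrp a \<in> words X}"

lemma of_word_in_fgrp_on: "w \<in> words X \<Longrightarrow> of_word w \<in> fgrp_on X"
  by (simp add: fgrp_on_def reduce_words)

lemma subgrp_fgrp_on: "subgrp (fgrp_on X)"
  unfolding subgrp_def
proof (intro conjI ballI)
  show "0 \<in> fgrp_on X" using of_word_in_fgrp_on[of "[]" X] by simp
  fix a b assume "a \<in> fgrp_on X" "b \<in> fgrp_on X"
  then have "of_word (Rep_fgrp a @ inv_word (Rep_fgrp b)) \<in> fgrp_on X"
    by (intro of_word_in_fgrp_on) (simp add: fgrp_on_def inv_word_words)
  then show "a - b \<in> fgrp_on X" by (simp add: of_word_append of_word_inv_word)
qed

lemma fgen_in_fgrp_on: "x \<in> X \<Longrightarrow> fgen x \<in> fgrp_on X"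
  unfolding fgen_def by (rule of_word_in_fgrp_on) (simp add: words_def)

lemma gen_fgen: "gen (fgen ` X) = fgrp_on X"
proof
  show "gen (fgen ` X) \<subseteq> fgrp_on X"
    by (rule gen_least[OF _ subgrp_fgrp_on]) (auto intro: fgen_in_fgrp_on)
  show "fgrp_on X \<subseteq> gen (fgen ` X)"
  proof
    fix a assume "a \<in> fgrp_on X"
    then have "ev fgen (Rep_fgrp a) \<in> gen (fgen ` X)"
      by (intro ev_mem[OF subgrp_gen, of _ X]) (auto simp: fgrp_on_def intro: gen_incl)
    then show "a \<in> gen (fgen ` X)" by (simp add: of_word_eq_ev[symmetric])
  qed
qed

lemma carrier_free_group: "carrier (free_group X) = Rep_fgrp ` fgrp_on X"
proof
  show "carrier (free_group X) \<subseteq> Rep_fgrp ` fgrp_on X"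
  proof
    fix w assume "w \<in> carrier (free_group X)"
    then have "w = Rep_fgrp (of_word w)" "of_word w \<in> fgrp_on X"
      by (auto simp: free_group_def reduce_eq intro: of_word_in_fgrp_on)
    then show "w \<in> Rep_fgrp ` fgrp_on X" by blast
  qed
qed (use Rep_fgrp in \<open>auto simp: free_group_def fgrp_on_def\<close>)

lemma Rep_add: "Rep_fgrp (a + b) = Rep_fgrp a \<otimes>\<^bsub>free_group X\<^esub> Rep_fgrp b"
  by (simp add: free_group_def plus_fgrp_def Abs_fgrp_inverse)

lemma Rep_zero: "Rep_fgrp 0 = \<one>\<^bsub>free_group X\<^esub>"
  by (simp add: free_group_def zero_fgrp_def Abs_fgrp_inverse)

lemma Rep_in_carrier: "a \<in> fgrp_on X \<Longrightarrow> Rep_fgrp a \<in> carrier (free_group X)"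
  by (simp add: carrier_free_group)

lemma Rep_uminus:
  assumes "a \<in> fgrp_on X" shows "Rep_fgrp (- a) = inv\<^bsub>free_group X\<^esub> Rep_fgrp a"
proof -
  interpret F: group "free_group X" by (rule group_free_group)
  have "Rep_fgrp (- a) \<otimes>\<^bsub>free_group X\<^esub> Rep_fgrp a = \<one>\<^bsub>free_group X\<^esub>"
    using Rep_add[of "- a" a X] Rep_zero[of X] by simp
  then show ?thesis
    using F.inv_equality Rep_in_carrier[OF assms] Rep_in_carrier[OF subgrp_uminus[OF subgrp_fgrp_on assms]]
    by metis
qed

lemma Rep_cj:
  assumes "p \<in> fgrp_on X"
  shows "Rep_fgrp (cj p a) = Rep_fgrp p \<otimes>\<^bsub>free_group X\<^esub> Rep_fgrp a \<otimes>\<^bsub>free_group X\<^esub> inv\<^bsub>free_group X\<^esub> Rep_fgrp p"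
proof -
  have "cj p a = p + a + - p" by (simp add: cj_def)
  then show ?thesis by (simp only: Rep_uminus[OF assms] Rep_add[of _ _ X])
qed

lemma normal_closure_free_group:
  assumes "R \<subseteq> words X"
  shows "normal_closure (free_group X) (reduce ` R) = Rep_fgrp ` ncl (fgrp_on X) (of_word ` R)"
    (is "?N = Rep_fgrp ` ?M")
proof
  interpret F: group "free_group X" by (rule group_free_group)
  let ?C = "{g \<otimes>\<^bsub>free_group X\<^esub> s \<otimes>\<^bsub>free_group X\<^esub> inv\<^bsub>free_group X\<^esub> g | g s. g \<in> carrier (free_group X) \<and> s \<in> reduce ` R}"
  have RF: "of_word ` R \<subseteq> fgrp_on X" using assms of_word_in_fgrp_on by blast
  note M = nsub_ncl[OF subgrp_fgrp_on RF]
  have CC: "?C \<subseteq> carrier (free_group X)"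
  proof -
    have "reduce ` R \<subseteq> carrier (free_group X)"
      using assms by (auto simp: free_group_def reduce_words)
    then show ?thesis by auto
  qed
  have C: "?C \<subseteq> Rep_fgrp ` ?M"
  proof clarify
    fix g s assume g: "g \<in> carrier (free_group X)" and s: "s \<in> R"
    then obtain p where p: "p \<in> fgrp_on X" "g = Rep_fgrp p" by (auto simp: carrier_free_group)
    have "cj p (of_word s) \<in> ?M" unfolding ncl_def using p s by (intro gen_incl) blast
    then show "g \<otimes>\<^bsub>free_group X\<^esub> reduce s \<otimes>\<^bsub>free_group X\<^esub> inv\<^bsub>free_group X\<^esub> g \<in> Rep_fgrp ` ?M"
      using Rep_cj[OF p(1), of "of_word s"] p(2) by (metis Rep_of_word imageI)
  qed
  show "?N \<subseteq> Rep_fgrp ` ?M"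
  proof
    fix h assume "h \<in> ?N"
    then have "h \<in> generate (free_group X) ?C" by (simp add: normal_closure_def)
    then show "h \<in> Rep_fgrp ` ?M"
    proof induction
      case one
      then show ?case using subgrp_zero[OF nsubD(1)[OF M]] Rep_zero by (metis imageI)
    next
      case (incl h) then show ?case using C by blast
    next
      case (inv h)
      then obtain a where "a \<in> ?M" "h = Rep_fgrp a" using C by blast
      then show ?case
        using Rep_uminus[of a X] nsubD(2)[OF M] subgrp_uminus[OF nsubD(1)[OF M]] by (metis imageI subsetD)
    next
      case (eng h1 h2)
      then obtain a b where "a \<in> ?M" "h1 = Rep_fgrp a" "b \<in> ?M" "h2 = Rep_fgrp b" by blast
      then show ?case using Rep_add[of a b X] subgrp_add[OF nsubD(1)[OF M]] by (metis imageI)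
    qed
  qed
  show "Rep_fgrp ` ?M \<subseteq> ?N"
  proof clarify
    fix a assume "a \<in> ?M"
    then have "a \<in> gen {cj p s |p s. p \<in> fgrp_on X \<and> s \<in> of_word ` R}" by (simp add: ncl_def)
    then show "Rep_fgrp a \<in> ?N"
    proof induction
      case gen_zero
      then show ?case unfolding normal_closure_def Rep_zero[of X] by (rule generate.one)
    next
      case (gen_incl a)
      then obtain p s where p: "p \<in> fgrp_on X" and s: "s \<in> R" and a: "a = cj p (of_word s)" by blast
      show ?case unfolding normal_closure_def a Rep_cj[OF p]
        by (rule generate.incl) (use Rep_in_carrier[OF p] s in \<open>auto intro: imageI\<close>)
    next
      case (gen_diff a b)
      have b: "b \<in> fgrp_on X" using gen_diff.hyps(2) nsubD(2)[OF M] by (auto simp: ncl_def)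
      have "subgroup ?N (free_group X)"
        unfolding normal_closure_def by (rule F.generate_is_subgroup[OF CC])
      then have "Rep_fgrp a \<otimes>\<^bsub>free_group X\<^esub> inv\<^bsub>free_group X\<^esub> Rep_fgrp b \<in> ?N"
        using gen_diff.IH by (simp add: subgroup.m_closed subgroup.m_inv_closed)
      moreover have "Rep_fgrp (a - b) = Rep_fgrp a \<otimes>\<^bsub>free_group X\<^esub> inv\<^bsub>free_group X\<^esub> Rep_fgrp b"
        using Rep_add[of a "- b" X] Rep_uminus[OF b] by simp
      ultimately show ?case by simp
    qed
  qed
qed

definition relator_closure :: "'x set \<Rightarrow> 'x word set \<Rightarrow> 'x fgrp set" where
  "relator_closure X R = ncl (fgrp_on X) (of_word ` R)"

definition pres_class :: "'x set \<Rightarrow> 'x word set \<Rightarrow> 'x fgrp \<Rightarrow> 'x word set" where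
  "pres_class X R a = normal_closure (free_group X) (reduce ` R) #>\<^bsub>free_group X\<^esub> Rep_fgrp a"

context
  fixes X :: "'x set" and R :: "'x word set"
  assumes R: "R \<subseteq> words X"
begin

lemma nsub_relator_closure: "nsub (fgrp_on X) (relator_closure X R)"
  unfolding relator_closure_def using R of_word_in_fgrp_on
  by (intro nsub_ncl subgrp_fgrp_on) blast

lemma normal_relators: "normal_closure (free_group X) (reduce ` R) \<lhd> free_group X"
  using R by (intro normal_normal_closure group_free_group) (auto simp: free_group_def reduce_words)

lemma carrier_presented_group: "carrier (presented_group X R) = pres_class X R ` fgrp_on X"
  by (auto simp: presented_group_def FactGroup_def RCOSETS_def pres_class_def carrier_free_group)

lemma pres_class_add:
  assumes "a \<in> fgrp_on X" "b \<in> fgrp_on X"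
  shows "pres_class X R (a + b) = pres_class X R a \<otimes>\<^bsub>presented_group X R\<^esub> pres_class X R b"
  unfolding pres_class_def presented_group_def FactGroup_def
  using normal.rcos_sum[OF normal_relators] Rep_in_carrier[OF assms(1)] Rep_in_carrier[OF assms(2)]
  by (simp add: Rep_add[of a b X])

lemma one_presented_group: "\<one>\<^bsub>presented_group X R\<^esub> = normal_closure (free_group X) (reduce ` R)"
  by (simp add: presented_group_def FactGroup_def)

lemma pres_class_eq_one_iff:
  assumes "a \<in> fgrp_on X"
  shows "pres_class X R a = \<one>\<^bsub>presented_group X R\<^esub> \<longleftrightarrow> a \<in> relator_closure X R"
proof -
  interpret F: group "free_group X" by (rule group_free_group)
  let ?N = "normal_closure (free_group X) (reduce ` R)"
  have sub: "subgroup ?N (free_group X)" using normal_relators by (rule normal_imp_subgroup)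
  have "pres_class X R a = \<one>\<^bsub>presented_group X R\<^esub> \<longleftrightarrow> Rep_fgrp a \<in> ?N"
    unfolding pres_class_def one_presented_group
    using F.coset_join1[OF _ Rep_in_carrier[OF assms] sub] F.coset_join2[OF Rep_in_carrier[OF assms] sub]
    by blast
  also have "\<dots> \<longleftrightarrow> a \<in> relator_closure X R"
    unfolding normal_closure_free_group[OF R] relator_closure_def
    by (auto simp: Rep_fgrp_inject)
  finally show ?thesis .
qed

lemma pres_class_diff_eq:
  assumes "a \<in> fgrp_on X" "b \<in> fgrp_on X"
  shows "pres_class X R a = pres_class X R b \<longleftrightarrow> a - b \<in> relator_closure X R"
proof -
  interpret H: group "presented_group X R" using R by (rule group_presented_group)
  have ab: "a - b \<in> fgrp_on X" using assms subgrp_diff[OF subgrp_fgrp_on] by blast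
  have c: "pres_class X R x \<in> carrier (presented_group X R)" if "x \<in> fgrp_on X" for x
    using that by (simp add: carrier_presented_group)
  have "pres_class X R a = pres_class X R (a - b) \<otimes>\<^bsub>presented_group X R\<^esub> pres_class X R b"
    using pres_class_add[OF ab assms(2)] by simp
  then show ?thesis
    using c[OF ab] c[OF assms(1)] c[OF assms(2)] pres_class_eq_one_iff[OF ab]
    by (metis H.l_one H.r_cancel_one')
qed

lemma null_homotopic_iff:
  "null_homotopic X R w \<longleftrightarrow> w \<in> words X \<and> of_word w \<in> relator_closure X R"
  using pres_class_eq_one_iff[OF of_word_in_fgrp_on, of w]
  by (auto simp: null_homotopic_def pres_class_def)

text \<open>A homomorphism that kills the relators descends to the quotient.\<close>

lemma residually_free_presented_group:
  assumes sep: "\<And>a. a \<in> fgrp_on X \<Longrightarrow> a \<notin> relator_closure X R \<Longrightarrow>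
      \<exists>h :: 'x fgrp \<Rightarrow> nat fgrp. ghom h \<and> h ` fgrp_on X \<subseteq> fgrp_on {0, 1} \<and>
        (\<forall>b\<in>relator_closure X R. h b = 0) \<and> h a \<noteq> 0"
  shows "residually_free (presented_group X R)"
  unfolding residually_free_def
proof (intro ballI impI)
  fix g assume g: "g \<in> carrier (presented_group X R)" "g \<noteq> \<one>\<^bsub>presented_group X R\<^esub>"
  then obtain a where a: "a \<in> fgrp_on X" "g = pres_class X R a" by (auto simp: carrier_presented_group)
  then have "a \<notin> relator_closure X R" using g(2) pres_class_eq_one_iff by blast
  then obtain h :: "'x fgrp \<Rightarrow> nat fgrp" where h: "ghom h" "h ` fgrp_on X \<subseteq> fgrp_on {0, 1}"
      "\<And>b. b \<in> relator_closure X R \<Longrightarrow> h b = 0" "h a \<noteq> 0"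
    using sep[OF a(1)] by blast
  interpret h: ghom h by fact
  define \<phi> where "\<phi> c = Rep_fgrp (h (SOME b. b \<in> fgrp_on X \<and> pres_class X R b = c))" for c
  have \<phi>: "\<phi> (pres_class X R b) = Rep_fgrp (h b)" if b: "b \<in> fgrp_on X" for b
  proof -
    let ?b = "SOME b'. b' \<in> fgrp_on X \<and> pres_class X R b' = pres_class X R b"
    have "?b \<in> fgrp_on X \<and> pres_class X R ?b = pres_class X R b"
      using someI_ex[of "\<lambda>b'. b' \<in> fgrp_on X \<and> pres_class X R b' = pres_class X R b"] b by blast
    then have "h (?b - b) = 0" using h(3) pres_class_diff_eq b by blast
    then show ?thesis by (simp add: \<phi>_def h.diff)
  qed
  have "\<phi> \<in> hom (presented_group X R) (free_group {0, 1})"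
  proof (rule homI)
    fix x assume "x \<in> carrier (presented_group X R)"
    then obtain b where "b \<in> fgrp_on X" "x = pres_class X R b" by (auto simp: carrier_presented_group)
    then show "\<phi> x \<in> carrier (free_group {0, 1})" using \<phi> h(2) Rep_in_carrier by fastforce
  next
    fix x y assume "x \<in> carrier (presented_group X R)" "y \<in> carrier (presented_group X R)"
    then obtain b c where b: "b \<in> fgrp_on X" "x = pres_class X R b"
      and c: "c \<in> fgrp_on X" "y = pres_class X R c" by (auto simp: carrier_presented_group)
    have "x \<otimes>\<^bsub>presented_group X R\<^esub> y = pres_class X R (b + c)" using b c pres_class_add by simp
    then show "\<phi> (x \<otimes>\<^bsub>presented_group X R\<^esub> y) = \<phi> x \<otimes>\<^bsub>free_group {0, 1}\<^esub> \<phi> y"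
      using b c \<phi> subgrp_add[OF subgrp_fgrp_on b(1) c(1)] by (simp add: h.add Rep_add[of _ _ "{0,1}"])
  qed
  moreover have "\<phi> g \<noteq> \<one>\<^bsub>free_group {0, 1}\<^esub>"
    using \<phi>[OF a(1)] a(2) h(4) Rep_zero[of "{0, 1 :: nat}"] by (metis Rep_fgrp_inject)
  ultimately show "\<exists>\<phi>\<in>hom (presented_group X R) (free_group {0, 1}). \<phi> g \<noteq> \<one>\<^bsub>free_group {0, 1 :: nat}\<^esub>"
    by blast
qed

end

lemma residually_free_iso:
  assumes "group G" "group H" "G \<cong> H" "residually_free H"
  shows "residually_free G"
  unfolding residually_free_def
proof (intro ballI impI)
  fix g assume g: "g \<in> carrier G" "g \<noteq> \<one>\<^bsub>G\<^esub>"
  obtain \<theta> where \<theta>: "\<theta> \<in> iso G H" using assms(3) by (auto simp: is_iso_def)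
  then have hom: "\<theta> \<in> hom G H" and inj: "inj_on \<theta> (carrier G)" by (auto simp: iso_def bij_betw_def)
  have "\<theta> \<one>\<^bsub>G\<^esub> = \<one>\<^bsub>H\<^esub>" using hom_one[OF hom assms(1,2)] .
  then have "\<theta> g \<noteq> \<one>\<^bsub>H\<^esub>" using g inj assms(1) by (metis group.is_monoid inj_on_def monoid.one_closed)
  moreover have "\<theta> g \<in> carrier H" using hom g(1) by (auto simp: hom_def)
  ultimately obtain \<phi> where "\<phi> \<in> hom H (free_group {0, 1})" "\<phi> (\<theta> g) \<noteq> \<one>\<^bsub>free_group {0, 1 :: nat}\<^esub>"
    using assms(4) unfolding residually_free_def by blast
  then show "\<exists>\<phi>\<in>hom G (free_group {0, 1}). \<phi> g \<noteq> \<one>\<^bsub>free_group {0, 1 :: nat}\<^esub>"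
    using hom_compose[OF hom] by (intro bexI[of _ "\<phi> \<circ> \<theta>"]) auto
qed

lemma countable_group_nat_copy:
  assumes H: "group H" and c: "countable (carrier H)"
  obtains G :: "nat monoid" where "group G" "H \<cong> G"
proof -
  interpret H: group H by fact
  define f where "f = to_nat_on (carrier H)"
  have inj: "inj_on f (carrier H)" unfolding f_def by (rule inj_on_to_nat_on[OF c])
  define G where "G = \<lparr>carrier = f ` carrier H,
     monoid.mult = (\<lambda>a b. f (inv_into (carrier H) f a \<otimes>\<^bsub>H\<^esub> inv_into (carrier H) f b)), one = f \<one>\<^bsub>H\<^esub>\<rparr>"
  have iso: "f \<in> iso H G"
    unfolding iso_def hom_def bij_betw_def using inj by (auto simp: G_def)
  have "group (G\<lparr>one := f \<one>\<^bsub>H\<^esub>\<rparr>)" by (rule H.iso_imp_img_group[OF iso])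
  then have "group G" by (simp add: G_def)
  then show ?thesis using iso that by (auto simp: is_iso_def)
qed

lemma countable_presented_group:
  fixes X :: "nat set" assumes "R \<subseteq> words X" shows "countable (carrier (presented_group X R))"
proof -
  have "countable (Rep_fgrp ` fgrp_on X)" by simp
  then have "countable (fgrp_on X)"
    using countable_image_inj_on[of Rep_fgrp "fgrp_on X"] by (simp add: inj_on_def Rep_fgrp_inject)
  then show ?thesis using carrier_presented_group[OF assms] by simp
qed

text \<open>Lifting the images of the generators of one presentation to words of the other. The lift \<open>\<psi>\<close> turns questions about
  an unknown presentation of a group into questions about the known one; it is not canonical, and only determined
  modulo relators.\<close>

lemma presentation_comparison:
  fixes X :: "'x set" and Y :: "'y set"
  assumes S: "S \<subseteq> words X" and T: "T \<subseteq> words Y"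
    and iso: "presented_group Y T \<cong> presented_group X S"
  obtains \<psi> :: "'y \<Rightarrow> 'x fgrp" where "\<And>y. y \<in> Y \<Longrightarrow> \<psi> y \<in> fgrp_on X"
    and "\<And>w. w \<in> words Y \<Longrightarrow> null_homotopic Y T w \<longleftrightarrow> ev \<psi> w \<in> relator_closure X S"
    and "\<And>a. a \<in> fgrp_on X \<Longrightarrow> \<exists>w\<in>words Y. ev \<psi> w - a \<in> relator_closure X S"
proof -
  obtain \<theta> where \<theta>: "\<theta> \<in> iso (presented_group Y T) (presented_group X S)" using iso by (auto simp: is_iso_def)
  then have hom: "\<theta> \<in> hom (presented_group Y T) (presented_group X S)"
    and bij: "bij_betw \<theta> (carrier (presented_group Y T)) (carrier (presented_group X S))"
    by (auto simp: iso_def)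
  interpret G: group "presented_group Y T" using T by (rule group_presented_group)
  interpret H: group "presented_group X S" using S by (rule group_presented_group)
  let ?c = "pres_class Y T" and ?d = "pres_class X S"
  have cY: "?c a \<in> carrier (presented_group Y T)" if "a \<in> fgrp_on Y" for a
    using that carrier_presented_group[OF T] by blast
  have dX: "?d a \<in> carrier (presented_group X S)" if "a \<in> fgrp_on X" for a
    using that carrier_presented_group[OF S] by blast
  have one: "\<theta> \<one>\<^bsub>presented_group Y T\<^esub> = \<one>\<^bsub>presented_group X S\<^esub>"
    by (rule hom_one[OF hom G.is_group H.is_group])
  have "\<exists>b. b \<in> fgrp_on X \<and> ?d b = \<theta> (?c (fgen y))" if "y \<in> Y" for y
  proof -
    have "\<theta> (?c (fgen y)) \<in> carrier (presented_group X S)"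
      using hom cY[OF fgen_in_fgrp_on[OF that]] by (auto simp: hom_def)
    then show ?thesis using carrier_presented_group[OF S] by auto
  qed
  then have "\<forall>y\<in>Y. \<exists>b. b \<in> fgrp_on X \<and> ?d b = \<theta> (?c (fgen y))" by blast
  from bchoice[OF this] obtain \<psi> where \<psi>: "\<forall>y\<in>Y. \<psi> y \<in> fgrp_on X \<and> ?d (\<psi> y) = \<theta> (?c (fgen y))" ..
  have evF: "ev \<psi> w \<in> fgrp_on X" if "w \<in> words Y" for w
    by (rule ev_mem[OF subgrp_fgrp_on that]) (use \<psi> in blast)
  have zero: "?d 0 = \<one>\<^bsub>presented_group X S\<^esub>" "?c 0 = \<one>\<^bsub>presented_group Y T\<^esub>"
    using pres_class_eq_one_iff[OF S subgrp_zero[OF subgrp_fgrp_on]]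
      subgrp_zero[OF nsubD(1)[OF nsub_relator_closure[OF S]]]
      pres_class_eq_one_iff[OF T subgrp_zero[OF subgrp_fgrp_on]]
      subgrp_zero[OF nsubD(1)[OF nsub_relator_closure[OF T]]] by auto
  have letter: "?d (ev_letter \<psi> l) = \<theta> (?c (ev_letter fgen l)) \<and> ev_letter \<psi> l \<in> fgrp_on X
      \<and> ev_letter fgen l \<in> fgrp_on Y" if "fst l \<in> Y" for l
  proof -
    obtain y b where l: "l = (y, b)" by force
    then have y: "y \<in> Y" using that by simp
    have \<psi>y: "\<psi> y \<in> fgrp_on X" "?d (\<psi> y) = \<theta> (?c (fgen y))" using \<psi> y by auto
    have fy: "fgen y \<in> fgrp_on Y" by (rule fgen_in_fgrp_on[OF y])
    have m: "- \<psi> y \<in> fgrp_on X" "- fgen y \<in> fgrp_on Y"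
      using subgrp_uminus[OF subgrp_fgrp_on] \<psi>y fy by auto
    have "\<theta> (?c (- fgen y)) \<otimes>\<^bsub>presented_group X S\<^esub> \<theta> (?c (fgen y)) = \<theta> (?c (- fgen y + fgen y))"
      using pres_class_add[OF T m(2) fy] hom_mult[OF hom cY[OF m(2)] cY[OF fy]] by simp
    then have 1: "\<theta> (?c (- fgen y)) \<otimes>\<^bsub>presented_group X S\<^esub> ?d (\<psi> y) = \<one>\<^bsub>presented_group X S\<^esub>"
      by (simp add: \<psi>y zero one)
    have 2: "?d (- \<psi> y) \<otimes>\<^bsub>presented_group X S\<^esub> ?d (\<psi> y) = \<one>\<^bsub>presented_group X S\<^esub>"
      using pres_class_add[OF S m(1) \<psi>y(1)] by (simp add: zero)
    have "\<theta> (?c (- fgen y)) \<in> carrier (presented_group X S)"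
      using hom cY[OF m(2)] by (auto simp: hom_def)
    then have "?d (- \<psi> y) = \<theta> (?c (- fgen y))"
      using 1 2 dX[OF m(1)] dX[OF \<psi>y(1)] by (metis H.inv_equality)
    then show ?thesis using \<psi>y fy m by (simp add: l ev_letter_def)
  qed
  have word: "?d (ev \<psi> w) = \<theta> (?c (of_word w))" if "w \<in> words Y" for w
    using that
  proof (induction w)
    case Nil then show ?case by (simp add: zero one)
  next
    case (Cons l w)
    then have w: "w \<in> words Y" and l: "fst l \<in> Y" by (auto simp: words_def)
    have ow: "of_word (l # w) = ev_letter fgen l + of_word w" by (simp add: of_word_eq_ev)
    have "?d (ev \<psi> (l # w)) = ?d (ev_letter \<psi> l) \<otimes>\<^bsub>presented_group X S\<^esub> ?d (ev \<psi> w)"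
      using pres_class_add[OF S] letter[OF l] evF[OF w] by simp
    also have "\<dots> = \<theta> (?c (ev_letter fgen l)) \<otimes>\<^bsub>presented_group X S\<^esub> \<theta> (?c (of_word w))"
      using Cons.IH[OF w] letter[OF l] by simp
    also have "\<dots> = \<theta> (?c (of_word (l # w)))"
      using hom_mult[OF hom cY cY] pres_class_add[OF T] letter[OF l] of_word_in_fgrp_on[OF w]
      by (simp add: ow)
    finally show ?case .
  qed
  show ?thesis
  proof (rule that)
    show "\<psi> y \<in> fgrp_on X" if "y \<in> Y" for y using \<psi> that by blast
    show "null_homotopic Y T w \<longleftrightarrow> ev \<psi> w \<in> relator_closure X S" if w: "w \<in> words Y" for w
    proof -
      have "null_homotopic Y T w \<longleftrightarrow> ?c (of_word w) = \<one>\<^bsub>presented_group Y T\<^esub>"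
        using null_homotopic_iff[OF T] pres_class_eq_one_iff[OF T of_word_in_fgrp_on[OF w]] w by blast
      also have "\<dots> \<longleftrightarrow> \<theta> (?c (of_word w)) = \<theta> \<one>\<^bsub>presented_group Y T\<^esub>"
        using bij cY[OF of_word_in_fgrp_on[OF w]] G.one_closed
        by (auto simp: bij_betw_def inj_on_def)
      also have "\<dots> \<longleftrightarrow> ev \<psi> w \<in> relator_closure X S"
        using word[OF w] one pres_class_eq_one_iff[OF S evF[OF w]] by simp
      finally show ?thesis .
    qed
    show "\<exists>w\<in>words Y. ev \<psi> w - a \<in> relator_closure X S" if a: "a \<in> fgrp_on X" for a
    proof -
      have "?d a \<in> \<theta> ` carrier (presented_group Y T)" using bij dX[OF a] by (simp add: bij_betw_def)
      then obtain b where b: "b \<in> fgrp_on Y" "?d a = \<theta> (?c b)" using carrier_presented_group[OF T] by auto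
      have w: "Rep_fgrp b \<in> words Y" using b(1) by (simp add: fgrp_on_def)
      have "?d (ev \<psi> (Rep_fgrp b)) = ?d a" using word[OF w] b(2) by simp
      then have "ev \<psi> (Rep_fgrp b) - a \<in> relator_closure X S"
        using pres_class_diff_eq[OF S evF[OF w] a] by simp
      then show ?thesis using w by blast
    qed
  qed
qed

section \<open>Area\<close>

definition conjugates_word :: "('x word \<times> 'x word) list \<Rightarrow> 'x word" where
  "conjugates_word ps = concat (map (\<lambda>(\<theta>, r). \<theta> @ r @ inv_word \<theta>) ps)"

lemma inv_word_inv_word [simp]: "inv_word (inv_word w) = w"
  by (simp add: inv_word_def rev_map[symmetric] o_def)

lemma inv_word_append: "inv_word (u @ v) = inv_word v @ inv_word u"
  by (simp add: inv_word_def)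

lemma conjugates_word_inverse:
  "inv_word (conjugates_word ps) = conjugates_word (map (\<lambda>(\<theta>, r). (\<theta>, inv_word r)) (rev ps))"
  by (induction ps) (auto simp: conjugates_word_def inv_word_append, simp add: inv_word_def)

text \<open>The area is defined as a least number, so it is only meaningful once some product of
  conjugates of relators is known to exist.\<close>

lemma area_decomposition:
  assumes T: "T \<subseteq> words Y" and w: "null_homotopic Y T w"
  obtains ps where "length ps = area Y T w" "\<forall>(\<theta>, r) \<in> set ps. \<theta> \<in> words Y \<and> r \<in> T \<union> inv_word ` T"
    "of_word w = of_word (conjugates_word ps)"
proof -
  let ?ok = "\<lambda>ps. \<forall>(\<theta>, r) \<in> set ps. \<theta> \<in> words Y \<and> r \<in> T \<union> inv_word ` T"
  have "\<exists>ps. ?ok ps \<and> a = of_word (conjugates_word ps)"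
    if "a \<in> gen {cj p s |p s. p \<in> fgrp_on Y \<and> s \<in> of_word ` T}" for a
    using that
  proof induction
    case gen_zero
    then show ?case by (intro exI[of _ "[]"]) (simp add: conjugates_word_def)
  next
    case (gen_incl a)
    then obtain p r where "p \<in> fgrp_on Y" "r \<in> T" "a = cj p (of_word r)" by blast
    then show ?case
      by (intro exI[of _ "[(Rep_fgrp p, r)]"])
         (simp add: conjugates_word_def fgrp_on_def of_word_append of_word_inv_word cj_def
           group_add_simps del: add_uminus_conv_diff)
  next
    case (gen_diff a b)
    then obtain ps qs where ps: "?ok ps" "a = of_word (conjugates_word ps)"
      and qs: "?ok qs" "b = of_word (conjugates_word qs)" by blast
    let ?qs = "map (\<lambda>(\<theta>, r). (\<theta>, inv_word r)) (rev qs)"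
    have "a - b = of_word (conjugates_word (ps @ ?qs))"
    proof -
      have "conjugates_word (ps @ ?qs) = conjugates_word ps @ inv_word (conjugates_word qs)"
        by (simp add: conjugates_word_inverse) (simp add: conjugates_word_def)
      then show ?thesis by (simp add: ps(2) qs(2) of_word_append of_word_inv_word)
    qed
    moreover have "?ok (ps @ ?qs)" using ps(1) qs(1) by fastforce
    ultimately show ?case by blast
  qed
  note ex = this
  have "of_word w \<in> gen {cj p s |p s. p \<in> fgrp_on Y \<and> s \<in> of_word ` T}"
    using w null_homotopic_iff[OF T, of w] by (simp add: relator_closure_def ncl_def)
  from ex[OF this] obtain ps where "?ok ps" "of_word w = of_word (conjugates_word ps)" by blast
  then have "\<exists>k ps. length ps = k \<and> ?ok ps \<and> reduce w = reduce (conjugates_word ps)"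
    by (auto simp: of_word_eq_iff)
  from LeastI_ex[OF this] that show ?thesis
    unfolding area_def conjugates_word_def[symmetric] by (auto simp: of_word_eq_iff)
qed

text \<open>A relator counts at most \<open>B\<close> in absolute value, whatever it is conjugated by. This is the principle that a
  central extension of a group bounds its Dehn function from below.\<close>

lemma area_lower_bound:
  fixes c :: "'g::group_add \<Rightarrow> real"
  assumes \<Phi>: "subgrp \<Phi>" and M: "nsub \<Phi> M"
    and c_add: "\<And>a b. a \<in> M \<Longrightarrow> b \<in> M \<Longrightarrow> c (a + b) = c a + c b"
    and c_cj: "\<And>p a. p \<in> \<Phi> \<Longrightarrow> a \<in> M \<Longrightarrow> c (cj p a) = c a"
    and T: "finite T" "T \<subseteq> words Y" and \<psi>: "\<And>y. y \<in> Y \<Longrightarrow> \<psi> y \<in> \<Phi>" and \<psi>T: "\<And>r. r \<in> T \<Longrightarrow> ev \<psi> r \<in> M"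
  obtains B where "B \<ge> 0" "\<And>w. null_homotopic Y T w \<Longrightarrow> \<bar>c (ev \<psi> w)\<bar> \<le> B * real (area Y T w)"
proof -
  define B where "B = (\<Sum>r\<in>T. \<bar>c (ev \<psi> r)\<bar>)"
  have B: "B \<ge> 0" by (simp add: B_def sum_nonneg)
  have c0: "c 0 = 0" using c_add[of 0 0] subgrp_zero[OF nsubD(1)[OF M]] by simp
  have rB: "ev \<psi> r \<in> M \<and> \<bar>c (ev \<psi> r)\<bar> \<le> B" if "r \<in> T \<union> inv_word ` T" for r
  proof -
    have 1: "\<bar>c (ev \<psi> r)\<bar> \<le> B" if "r \<in> T" for r
      unfolding B_def using that T(1) by (intro member_le_sum) auto
    have "c (- a) = - c a" if "a \<in> M" for a
      using c_add[of a "- a"] that subgrp_uminus[OF nsubD(1)[OF M] that] c0 by simp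
    then show ?thesis using that 1 \<psi>T subgrp_uminus[OF nsubD(1)[OF M]]
      by (auto simp: ev_inv_word)
  qed
  have prod: "ev \<psi> (conjugates_word ps) \<in> M \<and> \<bar>c (ev \<psi> (conjugates_word ps))\<bar> \<le> B * real (length ps)"
    if "\<forall>(\<theta>, r) \<in> set ps. \<theta> \<in> words Y \<and> r \<in> T \<union> inv_word ` T" for ps
    using that
  proof (induction ps)
    case Nil
    then show ?case using subgrp_zero[OF nsubD(1)[OF M]] by (simp add: conjugates_word_def c0)
  next
    case (Cons p ps)
    obtain \<theta> r where p: "p = (\<theta>, r)" by force
    then have \<theta>: "\<theta> \<in> words Y" and r: "r \<in> T \<union> inv_word ` T" using Cons.prems by auto
    have e\<theta>: "ev \<psi> \<theta> \<in> \<Phi>" by (rule ev_mem[OF \<Phi> \<theta> \<psi>])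
    have IH: "ev \<psi> (conjugates_word ps) \<in> M" "\<bar>c (ev \<psi> (conjugates_word ps))\<bar> \<le> B * real (length ps)"
      using Cons by auto
    have eq: "ev \<psi> (conjugates_word (p # ps)) = cj (ev \<psi> \<theta>) (ev \<psi> r) + ev \<psi> (conjugates_word ps)"
      by (simp add: conjugates_word_def p ev_append ev_inv_word cj_def group_add_simps
          del: add_uminus_conv_diff)
    have cM: "cj (ev \<psi> \<theta>) (ev \<psi> r) \<in> M" using nsubD(3)[OF M e\<theta>] rB[OF r] by blast
    have "c (ev \<psi> (conjugates_word (p # ps))) = c (ev \<psi> r) + c (ev \<psi> (conjugates_word ps))"
      unfolding eq using c_add[OF cM IH(1)] c_cj[OF e\<theta>] rB[OF r] by simp
    then have "\<bar>c (ev \<psi> (conjugates_word (p # ps)))\<bar> \<le> B + B * real (length ps)"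
      using rB[OF r] IH(2) by linarith
    then show ?case using subgrp_add[OF nsubD(1)[OF M] cM IH(1)] eq by (simp add: algebra_simps)
  qed
  show ?thesis
  proof (rule that[OF B])
    fix w assume w: "null_homotopic Y T w"
    obtain ps where ps: "length ps = area Y T w"
        "\<forall>(\<theta>, r) \<in> set ps. \<theta> \<in> words Y \<and> r \<in> T \<union> inv_word ` T"
        "of_word w = of_word (conjugates_word ps)"
      by (rule area_decomposition[OF T(2) w])
    have "ev \<psi> w = ev \<psi> (conjugates_word ps)"
      using ps(3) lift_of_word[of \<psi>] by metis
    then show "\<bar>c (ev \<psi> w)\<bar> \<le> B * real (area Y T w)" using prod[OF ps(2)] ps(1) by simp
  qed
qed

section \<open>Cube groups\<close>

text \<open>The letter \<open>2 * i + e\<close> with \<open>e < 2\<close> stands for \<open>x_e ^ t_i\<close>, where \<open>t_0\<close> is the constant \<open>1\<close>. A vertex of the cube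
  is the set \<open>v\<close> of those \<open>i\<close> at which its coordinate \<open>t_i\<close> is \<open>1\<close>.\<close>

definition vertex_gen :: "nat set \<Rightarrow> nat \<Rightarrow> nat fgrp" where
  "vertex_gen v g = (if g div 2 = 0 \<or> g div 2 \<in> v then fgen (g mod 2) else 0)"

definition vertex :: "nat set \<Rightarrow> nat fgrp \<Rightarrow> nat fgrp" where
  "vertex v = lift (vertex_gen v)"

definition cube_grp :: "nat \<Rightarrow> nat fgrp set" where
  "cube_grp m = fgrp_on {..<2 * m + 2}"

text \<open>The kernel of the map from \<open>cube_grp m\<close> to the product of copies of the free group over
  all vertices except the top vertex \<open>{1..m}\<close>.\<close>

definition corner_ker :: "nat \<Rightarrow> nat fgrp set" where
  "corner_ker m = {a \<in> cube_grp m. \<forall>v. v \<subset> {1..m} \<longrightarrow> vertex v a = 0}"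

interpretation vertex: ghom "vertex v" for v
  unfolding vertex_def by (rule ghom_lift)

lemma vertex_fgen: "vertex v (fgen g) = vertex_gen v g"
  by (simp add: vertex_def)

lemma subgrp_cube_grp: "subgrp (cube_grp m)"
  by (simp add: cube_grp_def subgrp_fgrp_on)

lemma gen_cube_grp: "gen (fgen ` {..<2 * m + 2}) = cube_grp m"
  by (simp only: cube_grp_def gen_fgen)

lemma fgen_in_cube_grp: "i \<le> m \<Longrightarrow> e < 2 \<Longrightarrow> fgen (2 * i + e) \<in> cube_grp m"
  unfolding cube_grp_def by (rule fgen_in_fgrp_on) simp

lemma vertex_in_fgrp_on: "vertex v a \<in> fgrp_on {0, 1}"
proof -
  have "vertex_gen v g \<in> fgrp_on {0, 1}" for g
    unfolding vertex_gen_def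
    by (auto intro!: fgen_in_fgrp_on subgrp_zero[OF subgrp_fgrp_on])
  then show ?thesis
    unfolding vertex_def lift_def by (intro ev_mem[OF subgrp_fgrp_on, of _ UNIV]) (auto simp: words_def)
qed

text \<open>If \<open>i\<close> lies in exactly one of \<open>v\<close> and \<open>w\<close>, then \<open>x ^ t_i\<close> takes the value \<open>x\<close> at one of the two vertices and is
  trivial at the other, so generators can be split into a part in either kernel.\<close>

lemma vertex_kernels_span:
  assumes v: "v \<subseteq> {1..m}" and w: "w \<subseteq> {1..m}" and neq: "v \<noteq> w"
  shows "cube_grp m \<subseteq> vertex.ker_in v (cube_grp m) \<boxplus> vertex.ker_in w (cube_grp m)"
proof -
  let ?C = "cube_grp m"
  have n: "nsub ?C (vertex.ker_in u ?C)" for u by (rule vertex.nsub_ker[OF subgrp_cube_grp])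
  note sC = subgrp_cube_grp[of m]
  have dec: "\<exists>a b. a \<in> ?C \<and> b \<in> ?C \<and> vertex v a = 0 \<and> vertex w b = 0 \<and> fgen g = a + b"
    if g: "g < 2 * m + 2" for g
  proof -
    have "g div 2 \<le> m" using g by linarith
    have x: "fgen g \<in> ?C" unfolding cube_grp_def by (rule fgen_in_fgrp_on) (use g in simp)
    have z: "0 \<in> ?C" by (rule subgrp_zero[OF sC])
    have "vertex u (fgen g) = 0 \<or> vertex u (fgen g) = fgen (g mod 2)" for u
      by (simp add: vertex_fgen vertex_gen_def)
    from this[of v] this[of w] consider "vertex w (fgen g) = 0" | "vertex v (fgen g) = 0"
      | "vertex w (fgen g) = fgen (g mod 2)" "vertex v (fgen g) = fgen (g mod 2)"
      by blast
    then show ?thesis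
    proof cases
      case 1 then show ?thesis using x z by (intro exI[of _ 0] exI[of _ "fgen g"]) simp
    next
      case 2 then show ?thesis using x z by (intro exI[of _ "fgen g"] exI[of _ 0]) simp
    next
      case 3
      from neq obtain i where i: "i \<in> v \<and> i \<notin> w \<or> i \<in> w \<and> i \<notin> v" by blast
      then have i1: "i \<ge> 1" "i \<le> m" using v w by auto
      let ?y = "fgen (2 * i + g mod 2) :: nat fgrp"
      have y: "?y \<in> ?C" by (rule fgen_in_cube_grp[OF i1(2)]) simp
      have vy: "vertex u ?y = (if i \<in> u then fgen (g mod 2) else 0)" for u
        using i1 by (simp add: vertex_fgen vertex_gen_def)
      from i show ?thesis
      proof
        assume "i \<in> v \<and> i \<notin> w"
        then show ?thesis using x y 3 subgrp_diff[OF sC x y]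
          by (intro exI[of _ "fgen g - ?y"] exI[of _ ?y]) (simp add: vertex.diff vy)
      next
        assume "i \<in> w \<and> i \<notin> v"
        then show ?thesis using x y 3 subgrp_add[OF sC subgrp_uminus[OF sC y] x]
          by (intro exI[of _ ?y] exI[of _ "- ?y + fgen g"])
             (simp add: vertex.add vertex.uminus vy add.assoc[symmetric])
      qed
    qed
  qed
  have "fgen ` {..<2 * m + 2} \<subseteq> vertex.ker_in v ?C \<boxplus> vertex.ker_in w ?C"
  proof clarify
    fix g assume "g < 2 * m + 2"
    from dec[OF this] obtain a b where "a \<in> vertex.ker_in v ?C" "b \<in> vertex.ker_in w ?C" "fgen g = a + b"
      by (auto simp: vertex.ker_in_def)
    then show "fgen g \<in> vertex.ker_in v ?C \<boxplus> vertex.ker_in w ?C" by (simp add: sumsetI)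
  qed
  then have "gen (fgen ` {..<2 * m + 2}) \<subseteq> vertex.ker_in v ?C \<boxplus> vertex.ker_in w ?C"
    by (rule gen_least) (rule nsubD(1)[OF nsub_sumset[OF n n sC]])
  then show ?thesis by (simp only: gen_cube_grp)
qed

lemma corner_ker_eq:
  "corner_ker m = cube_grp m \<inter> \<Inter>((\<lambda>v. vertex.ker_in v (cube_grp m)) ` {v. v \<subset> {1..m}})"
  by (auto simp: corner_ker_def vertex.ker_in_def)

lemma nsub_corner_ker: "nsub (cube_grp m) (corner_ker m)"
  unfolding corner_ker_eq
  by (intro nsub_Inter subgrp_cube_grp) (auto intro!: vertex.nsub_ker subgrp_cube_grp)

lemma fng_corner_ker: "fng (cube_grp m) (corner_ker m)"
  unfolding corner_ker_eq
proof (rule fng_Inter_kernels[OF subgrp_cube_grp _ gen_cube_grp])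
  let ?\<N> = "(\<lambda>v. vertex.ker_in v (cube_grp m)) ` {v. v \<subset> {1..m}}"
  have "finite {v. v \<subset> {1..m}}" by (rule finite_subset[of _ "Pow {1..m}"]) auto
  then show "finite ?\<N>" by (rule finite_imageI)
  show "\<exists>p :: nat fgrp \<Rightarrow> nat fgrp. ghom p \<and> N = {a \<in> cube_grp m. p a = 0}" if N: "N \<in> ?\<N>" for N
  proof -
    from N obtain v where "N = vertex.ker_in v (cube_grp m)" by blast
    then show ?thesis using vertex.ghom_axioms by (intro exI[of _ "vertex v"]) (simp add: vertex.ker_in_def)
  qed
  show "cube_grp m \<subseteq> N \<boxplus> N'" if N: "N \<in> ?\<N>" "N' \<in> ?\<N>" "N \<noteq> N'" for N N'
  proof -
    from N obtain v w where "v \<subset> {1..m}" "N = vertex.ker_in v (cube_grp m)"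
      "w \<subset> {1..m}" "N' = vertex.ker_in w (cube_grp m)" by blast
    moreover from this have "v \<noteq> w" using N(3) by blast
    ultimately show ?thesis using vertex_kernels_span[of v m w] by blast
  qed
qed simp

lemma cube_presentation:
  obtains S where "finite S" "S \<subseteq> words {..<2 * m + 2}"
    "relator_closure {..<2 * m + 2} S = corner_ker m"
proof -
  obtain R where R: "finite R" "R \<subseteq> corner_ker m" "corner_ker m = ncl (cube_grp m) R"
    using fng_corner_ker[of m] unfolding fng_def by blast
  let ?S = "Rep_fgrp ` R"
  have "?S \<subseteq> words {..<2 * m + 2}"
    using R(2) by (auto simp: corner_ker_def cube_grp_def fgrp_on_def)
  moreover have "of_word ` ?S = R" by (simp add: image_image)
  then have "relator_closure {..<2 * m + 2} ?S = corner_ker m"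
    using R(3) by (simp add: relator_closure_def cube_grp_def)
  ultimately show ?thesis using R(1) that by blast
qed

lemma cube_quotient_residually_free:
  assumes "S \<subseteq> words {..<2 * m + 2}" "relator_closure {..<2 * m + 2} S = corner_ker m"
  shows "residually_free (presented_group {..<2 * m + 2} S)"
proof (rule residually_free_presented_group[OF assms(1)])
  fix a assume "a \<in> fgrp_on {..<2 * m + 2}" "a \<notin> relator_closure {..<2 * m + 2} S"
  then have "a \<in> cube_grp m" "a \<notin> corner_ker m" unfolding assms(2) cube_grp_def .
  then obtain v where v: "v \<subset> {1..m}" "vertex v a \<noteq> 0" unfolding corner_ker_def by blast
  have "\<forall>b\<in>corner_ker m. vertex v b = 0" using v(1) unfolding corner_ker_def by blast
  then show "\<exists>h :: nat fgrp \<Rightarrow> nat fgrp. ghom h \<and> h ` fgrp_on {..<2 * m + 2} \<subseteq> fgrp_on {0, 1} \<and>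
        (\<forall>b\<in>relator_closure {..<2 * m + 2} S. h b = 0) \<and> h a \<noteq> 0"
    unfolding assms(2) using vertex.ghom_axioms vertex_in_fgrp_on v(2)
    by (intro exI[of _ "vertex v"] conjI) blast+
qed

unbundle fps_syntax

section \<open>An affine action of the free group of rank two\<close>

text \<open>The pair \<open>(a, b)\<close> stands for the affine map \<open>z \<mapsto> a z + b\<close>, and \<open>aff_mult\<close> is composition. The generator \<open>0\<close> acts
  by \<open>z \<mapsto> z + 1\<close> and every other generator by \<open>z \<mapsto> (1 + X) z\<close>.\<close>

definition aff_mult :: "real fps \<times> real fps \<Rightarrow> real fps \<times> real fps \<Rightarrow> real fps \<times> real fps" where
  "aff_mult f g = (fst f * fst g, fst f * snd g + snd f)"

definition aff_letter :: "nat \<times> bool \<Rightarrow> real fps \<times> real fps" where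
  "aff_letter l = (if fst l = 0 then (1, if snd l then 1 else - 1)
     else (if snd l then 1 + fps_X else inverse (1 + fps_X), 0))"

primrec aff_word :: "nat word \<Rightarrow> real fps \<times> real fps" where
  "aff_word [] = (1, 0)"
| "aff_word (l # w) = aff_mult (aff_letter l) (aff_word w)"

definition aff :: "nat fgrp \<Rightarrow> real fps \<times> real fps" where
  "aff a = aff_word (Rep_fgrp a)"

lemma aff_mult_assoc: "aff_mult (aff_mult f g) h = aff_mult f (aff_mult g h)"
  by (simp add: aff_mult_def algebra_simps)

lemma aff_mult_one [simp]: "aff_mult (1, 0) f = f" "aff_mult f (1, 0) = f"
  by (simp_all add: aff_mult_def)

lemma aff_word_append: "aff_word (u @ v) = aff_mult (aff_word u) (aff_word v)"
  by (induction u) (simp_all add: aff_mult_assoc)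

lemma aff_letter_inverse: "aff_mult (aff_letter l) (aff_letter (inv_letter l)) = (1, 0)"
proof -
  have "(1 + fps_X) * inverse (1 + fps_X) = (1 :: real fps)"
    by (simp add: inverse_mult_eq_1')
  then show ?thesis by (auto simp: aff_letter_def inv_letter_def aff_mult_def mult.commute)
qed

lemma aff_word_cons_red: "aff_word (cons_red l w) = aff_mult (aff_letter l) (aff_word w)"
  by (cases w) (simp_all add: aff_mult_assoc[symmetric] aff_letter_inverse)

lemma aff_word_reduce: "aff_word (reduce w) = aff_word w"
  by (induction w) (simp_all add: reduce_def aff_word_cons_red)

lemma aff_of_word: "aff (of_word w) = aff_word w"
  by (simp add: aff_def aff_word_reduce)

lemma aff_zero [simp]: "aff 0 = (1, 0)"
  using aff_of_word[of "[]"] by simp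

lemma aff_add: "aff (a + b) = aff_mult (aff a) (aff b)"
  by (simp add: aff_def plus_fgrp_def Abs_fgrp_inverse aff_word_reduce aff_word_append)

lemma aff_ev_letter: "aff (ev_letter fgen l) = aff_letter l"
  using aff_of_word[of "[l]"] by (simp add: of_word_single)

lemma aff_fgen: "aff (fgen x) = aff_letter (x, True)"
  using aff_ev_letter[of "(x, True)"] by (simp add: ev_letter_def)

lemma aff_unipotent: "fst (aff a) $ 0 = 1"
proof -
  have "fst (aff_word w) $ 0 = 1" for w
    by (induction w) (auto simp: aff_mult_def aff_letter_def)
  then show ?thesis by (simp add: aff_def)
qed

lemma aff_commutator:
  assumes u: "aff u = (a, b)" and v: "aff v = (a', b')"
  shows "aff (cj u v - v) = (1, (a - 1) * b' - (a' - 1) * b)"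
proof -
  obtain g d where c: "aff (cj u v - v) = (g, d)" by force
  have "cj u v - v + (v + u) = u + v"
    by (simp add: cj_def group_add_simps del: add_uminus_conv_diff)
  then have "aff_mult (g, d) (aff_mult (a', b') (a, b)) = aff_mult (a, b) (a', b')"
    using c u v by (metis aff_add)
  then have 1: "g * (a' * a) = a * a'" and 2: "g * (a' * b + b') + d = a * b' + b"
    by (simp_all add: aff_mult_def)
  have "a \<noteq> 0" "a' \<noteq> 0" using aff_unipotent[of u] aff_unipotent[of v] u v by auto
  then have "g = 1" using 1 by (simp add: mult.commute)
  then show ?thesis using 2 c by (simp add: algebra_simps)
qed

section \<open>Polynomial functions on the cube\<close>

text \<open>The power series \<open>c I\<close> is the coefficient of the monomial \<open>\<Prod>i\<in>I. t_i\<close>, whose value at the vertex \<open>v\<close> is \<open>1\<close> if \<open>I \<subseteq> v\<close> and \<open>0\<close>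
  otherwise. The condition is that monomials of degree \<open>d\<close> have coefficients divisible by \<open>X ^ (d - k)\<close>. The linear
  parts of the affine maps satisfy it with \<open>k = 0\<close>, the translation parts with \<open>k = 1\<close>.\<close>

definition cube_poly :: "nat \<Rightarrow> nat set \<Rightarrow> (nat set \<Rightarrow> real fps) \<Rightarrow> bool" where
  "cube_poly k U f \<longleftrightarrow> (\<exists>c. (\<forall>I\<subseteq>U. fps_X ^ (card I - k) dvd c I) \<and> (\<forall>v\<subseteq>U. f v = sum c (Pow v)))"

lemma cube_poly_add:
  assumes "cube_poly k U f" "cube_poly k U g"
  shows "cube_poly k U (\<lambda>v. f v + g v)"
proof -
  obtain c d where "\<forall>I\<subseteq>U. fps_X ^ (card I - k) dvd c I" "\<forall>v\<subseteq>U. f v = sum c (Pow v)"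
    "\<forall>I\<subseteq>U. fps_X ^ (card I - k) dvd d I" "\<forall>v\<subseteq>U. g v = sum d (Pow v)"
    using assms by (auto simp: cube_poly_def)
  then show ?thesis unfolding cube_poly_def
    by (intro exI[of _ "\<lambda>I. c I + d I"]) (simp add: sum.distrib)
qed

text \<open>Since \<open>t_i\<close> is idempotent, the monomials of \<open>I\<close> and \<open>J\<close> multiply to that of \<open>I \<union> J\<close>, whose
  degree is at most the sum of the degrees.\<close>

lemma cube_poly_mult:
  assumes U: "finite U" and f: "cube_poly 0 U f" and g: "cube_poly k U g"
  shows "cube_poly k U (\<lambda>v. f v * g v)"
proof -
  obtain c d where c: "\<And>I. I \<subseteq> U \<Longrightarrow> fps_X ^ card I dvd c I" "\<And>v. v \<subseteq> U \<Longrightarrow> f v = sum c (Pow v)"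
    and d: "\<And>I. I \<subseteq> U \<Longrightarrow> fps_X ^ (card I - k) dvd d I" "\<And>v. v \<subseteq> U \<Longrightarrow> g v = sum d (Pow v)"
    using f g by (auto simp: cube_poly_def)
  define P where "P K = {p \<in> Pow K \<times> Pow K. fst p \<union> snd p = K}" for K :: "nat set"
  define e where "e K = (\<Sum>p\<in>P K. c (fst p) * d (snd p))" for K
  have "fps_X ^ (card K - k) dvd e K" if K: "K \<subseteq> U" for K
    unfolding e_def
  proof (rule dvd_sum)
    fix p assume p: "p \<in> P K"
    then have I: "fst p \<subseteq> U" "snd p \<subseteq> U" and un: "fst p \<union> snd p = K" using K by (auto simp: P_def)
    have "fps_X ^ (card (fst p) + (card (snd p) - k)) dvd c (fst p) * d (snd p)"
      unfolding power_add by (rule mult_dvd_mono[OF c(1)[OF I(1)] d(1)[OF I(2)]])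
    moreover have "card K - k \<le> card (fst p) + (card (snd p) - k)"
      using card_Un_le[of "fst p" "snd p"] un by simp
    ultimately show "fps_X ^ (card K - k) dvd c (fst p) * d (snd p)"
      using le_imp_power_dvd dvd_trans by blast
  qed
  moreover have "f v * g v = sum e (Pow v)" if v: "v \<subseteq> U" for v
  proof -
    have fv: "finite v" using v U finite_subset by blast
    have "f v * g v = (\<Sum>p\<in>Pow v \<times> Pow v. c (fst p) * d (snd p))"
      using c(2)[OF v] d(2)[OF v] by (simp add: sum_product sum.cartesian_product case_prod_beta)
    also have "\<dots> = (\<Sum>K\<in>Pow v. \<Sum>p\<in>{p \<in> Pow v \<times> Pow v. fst p \<union> snd p = K}. c (fst p) * d (snd p))"
      by (rule sum.group[symmetric]) (use fv in auto)
    also have "\<dots> = sum e (Pow v)"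
      unfolding e_def P_def by (intro sum.cong refl) auto
    finally show ?thesis .
  qed
  ultimately show ?thesis unfolding cube_poly_def by blast
qed

lemma cube_poly_face:
  assumes U: "finite U" and i: "i \<in> U" and dvd: "fps_X ^ (1 - k) dvd b - a"
  shows "cube_poly k U (\<lambda>v. if i \<in> v then b else a)"
  unfolding cube_poly_def
proof (intro exI conjI allI impI)
  let ?c = "\<lambda>I. if I = {} then a else if I = {i} then b - a else 0"
  show "fps_X ^ (card I - k) dvd ?c I" for I using dvd by auto
  fix v assume v: "v \<subseteq> U"
  then have fv: "finite (Pow v)" using U finite_subset by auto
  have "sum ?c (Pow v) = sum ?c ({{}} \<union> (if i \<in> v then {{i}} else {}))"
    by (rule sum.mono_neutral_right[OF fv]) auto
  then show "(if i \<in> v then b else a) = sum ?c (Pow v)" by auto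
qed

lemma cube_poly_const: "finite U \<Longrightarrow> cube_poly k U (\<lambda>v. a)"
  unfolding cube_poly_def
proof (intro exI conjI allI impI)
  assume U: "finite U"
  let ?c = "\<lambda>I. if I = {} then a else 0"
  show "fps_X ^ (card I - k) dvd ?c I" for I :: "nat set" by auto
  fix v assume "v \<subseteq> U"
  then have "finite (Pow v)" using U finite_subset by auto
  then show "a = sum ?c (Pow v)" by (simp add: sum.delta)
qed

text \<open>A polynomial that is constant off the top vertex has no monomials between the constant
  one and the monomial of top degree.\<close>

lemma cube_poly_top:
  assumes U: "finite U" "U \<noteq> {}" and f: "cube_poly k U f" and const: "\<And>v. v \<subset> U \<Longrightarrow> f v = a"
  shows "fps_X ^ (card U - k) dvd f U - a"
proof -
  obtain c where c: "\<And>I. I \<subseteq> U \<Longrightarrow> fps_X ^ (card I - k) dvd c I" "\<And>v. v \<subseteq> U \<Longrightarrow> f v = sum c (Pow v)"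
    using f by (auto simp: cube_poly_def)
  have c0: "c {} = a" using const[of "{}"] c(2)[of "{}"] U(2) by auto
  have low: "c I = 0" if "finite I" "I \<noteq> {}" "I \<subset> U" for I
    using that
  proof (induction I rule: finite_psubset_induct)
    case (psubset I)
    have "f I = sum c (Pow I)" using c(2) psubset.prems by blast
    also have "\<dots> = sum c ({{}, I})"
      by (rule sum.mono_neutral_right) (use psubset in auto)
    finally show ?case using const[of I] psubset.prems c0 by simp
  qed
  have "f U = sum c (Pow U)" using c(2) by blast
  also have "\<dots> = sum c {{}, U}"
  proof (rule sum.mono_neutral_right)
    show "\<forall>I\<in>Pow U - {{}, U}. c I = 0"
    proof
      fix I assume "I \<in> Pow U - {{}, U}"
      then have "I \<noteq> {}" "I \<subset> U" by blast+
      then show "c I = 0" using low finite_subset[of I U] U(1) by blast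
    qed
  qed (use U in simp_all)
  finally have "f U - a = c U" using U(2) c0 by auto
  then show ?thesis using c(1)[of U] by simp
qed

lemma aff_vertex_ev_letter:
  "aff (ev_letter (vertex_gen v) (g, s)) =
     (if g div 2 = 0 \<or> g div 2 \<in> v then aff_letter (g mod 2, s) else (1, 0))"
proof -
  have "ev_letter (vertex_gen v) (g, s) =
      (if g div 2 = 0 \<or> g div 2 \<in> v then ev_letter fgen (g mod 2, s) else 0)"
    by (auto simp: ev_letter_def vertex_gen_def)
  then show ?thesis by (simp add: aff_ev_letter)
qed

lemma cube_poly_vertex:
  assumes a: "a \<in> cube_grp m"
  shows "cube_poly 0 {1..m} (\<lambda>v. fst (aff (vertex v a)))" "cube_poly 1 {1..m} (\<lambda>v. snd (aff (vertex v a)))"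
proof -
  let ?U = "{1..m}"
  have letter: "cube_poly 0 ?U (\<lambda>v. fst (aff (ev_letter (vertex_gen v) (g, s)))) \<and>
      cube_poly 1 ?U (\<lambda>v. snd (aff (ev_letter (vertex_gen v) (g, s))))" if g: "g < 2 * m + 2" for g s
  proof (cases "g div 2 = 0")
    case True
    then show ?thesis by (simp add: aff_vertex_ev_letter cube_poly_const)
  next
    case False
    then have i: "g div 2 \<in> ?U" using g by auto
    have inv: "(inverse (1 + fps_X) :: real fps) - 1 = fps_X * (- inverse (1 + fps_X))"
    proof -
      have "(1 + fps_X) * inverse (1 + fps_X) = (1 :: real fps)" by (simp add: inverse_mult_eq_1')
      then show ?thesis by (simp add: algebra_simps)
    qed
    have d: "fps_X ^ (1 - 0) dvd fst (aff_letter (e, s)) - 1" for e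
      by (auto simp: aff_letter_def inv)
    have "fst (aff (ev_letter (vertex_gen v) (g, s))) = (if g div 2 \<in> v then fst (aff_letter (g mod 2, s)) else 1)"
      "snd (aff (ev_letter (vertex_gen v) (g, s))) = (if g div 2 \<in> v then snd (aff_letter (g mod 2, s)) else 0)" for v
      using False by (simp_all add: aff_vertex_ev_letter)
    then show ?thesis
      using cube_poly_face[OF _ i d] cube_poly_face[OF _ i, of 1 "snd (aff_letter (g mod 2, s))" 0] by simp
  qed
  have word: "cube_poly 0 ?U (\<lambda>v. fst (aff (ev (vertex_gen v) w))) \<and> cube_poly 1 ?U (\<lambda>v. snd (aff (ev (vertex_gen v) w)))"
    if "w \<in> words {..<2 * m + 2}" for w
    using that
  proof (induction w)
    case Nil then show ?case by (simp add: cube_poly_const)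
  next
    case (Cons l w)
    obtain g s where l: "l = (g, s)" by force
    then have g: "g < 2 * m + 2" and w: "w \<in> words {..<2 * m + 2}" using Cons.prems by (auto simp: words_def)
    show ?case
      using letter[OF g, of s] Cons.IH[OF w]
      by (simp add: l aff_add aff_mult_def cube_poly_mult cube_poly_add)
  qed
  have "vertex v a = ev (vertex_gen v) (Rep_fgrp a)" for v by (simp add: vertex_def lift_def)
  then show "cube_poly 0 ?U (\<lambda>v. fst (aff (vertex v a)))" "cube_poly 1 ?U (\<lambda>v. snd (aff (vertex v a)))"
    using word[of "Rep_fgrp a"] a by (simp_all add: cube_grp_def fgrp_on_def)
qed

lemma corner_ker_top:
  assumes m: "m \<ge> 1" and a: "a \<in> corner_ker m"
  shows "fps_X ^ m dvd fst (aff (vertex {1..m} a)) - 1" "fps_X ^ (m - 1) dvd snd (aff (vertex {1..m} a))"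
proof -
  have a': "a \<in> cube_grp m" and z: "\<And>v. v \<subset> {1..m} \<Longrightarrow> vertex v a = 0"
    using a by (auto simp: corner_ker_def)
  have U: "finite {1..m}" "{1..m} \<noteq> {}" using m by auto
  show "fps_X ^ m dvd fst (aff (vertex {1..m} a)) - 1"
    using cube_poly_top[OF U cube_poly_vertex(1)[OF a'], of 1] z by simp
  show "fps_X ^ (m - 1) dvd snd (aff (vertex {1..m} a))"
    using cube_poly_top[OF U cube_poly_vertex(2)[OF a'], of 0] z by simp
qed

section \<open>The corner invariant\<close>

definition corner_inv :: "nat \<Rightarrow> nat fgrp \<Rightarrow> real" where
  "corner_inv m a = snd (aff (vertex {1..m} a)) $ (m - 1)"

lemma nth_mult_dvd:
  fixes f g :: "real fps"
  assumes "fps_X ^ k dvd g" shows "(f * g) $ k = f $ 0 * g $ k"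
proof -
  obtain h where h: "g = fps_X ^ k * h" using assms by (auto simp: dvd_def)
  have "f * g = fps_X ^ k * (f * h)" by (simp add: h mult.left_commute)
  then show ?thesis by (simp only: h fps_X_power_mult_nth) simp
qed

lemma nth_dvd_zero:
  fixes f :: "real fps" assumes "fps_X ^ k dvd f" "n < k" shows "f $ n = 0"
  using assms by (auto simp: dvd_def fps_X_power_mult_nth)

text \<open>The translation part of \<open>b\<close> is divisible by \<open>X ^ (m - 1)\<close>, so multiplying it by the
  linear part of \<open>a\<close>, whose constant coefficient is \<open>1\<close>, does not change its coefficient of \<open>X ^ (m - 1)\<close>.\<close>

lemma corner_inv_add:
  assumes m: "m \<ge> 1" and a: "a \<in> corner_ker m" and b: "b \<in> corner_ker m"
  shows "corner_inv m (a + b) = corner_inv m a + corner_inv m b"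
proof -
  let ?a = "aff (vertex {1..m} a)" and ?b = "aff (vertex {1..m} b)"
  have "(fst ?a * snd ?b) $ (m - 1) = snd ?b $ (m - 1)"
    using nth_mult_dvd[OF corner_ker_top(2)[OF m b]] aff_unipotent by simp
  then show ?thesis by (simp add: corner_inv_def vertex.add aff_add aff_mult_def)
qed

lemma corner_inv_cj:
  assumes m: "m \<ge> 1" and p: "p \<in> cube_grp m" and a: "a \<in> corner_ker m"
  shows "corner_inv m (cj p a) = corner_inv m a"
proof -
  let ?c = "aff (vertex {1..m} (cj p a))" and ?a = "aff (vertex {1..m} a)" and ?p = "aff (vertex {1..m} p)"
  have c: "cj p a \<in> corner_ker m" by (rule nsubD(3)[OF nsub_corner_ker p a])
  have "vertex {1..m} (cj p a + p) = vertex {1..m} (p + a)"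
    by (rule arg_cong[OF cj_add_swap[symmetric]])
  then have "aff_mult ?c ?p = aff_mult ?p ?a"
    unfolding vertex.add aff_add[symmetric] by simp
  then have "snd ?c = fst ?p * snd ?a + (1 - fst ?c) * snd ?p"
    by (simp add: aff_mult_def algebra_simps)
  moreover have "fps_X ^ m dvd (1 - fst ?c) * snd ?p"
    using corner_ker_top(1)[OF m c] by (metis dvd_mult2 dvd_minus_iff minus_diff_eq)
  then have "((1 - fst ?c) * snd ?p) $ (m - 1) = 0" by (rule nth_dvd_zero) (use m in simp)
  moreover have "(fst ?p * snd ?a) $ (m - 1) = snd ?a $ (m - 1)"
    using nth_mult_dvd[OF corner_ker_top(2)[OF m a]] aff_unipotent by simp
  ultimately show ?thesis by (simp add: corner_inv_def)
qed

section \<open>Iterated commutators\<close>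

primrec icomm :: "(nat \<Rightarrow> 'g::group_add) \<Rightarrow> nat \<Rightarrow> nat \<Rightarrow> 'g" where
  "icomm g n 0 = nmul n (g 0)"
| "icomm g n (Suc i) = cj (icomm g n i) (nmul n (g (Suc i))) - nmul n (g (Suc i))"

primrec icomm_word :: "(nat \<Rightarrow> 'x word) \<Rightarrow> nat \<Rightarrow> nat \<Rightarrow> 'x word" where
  "icomm_word W n 0 = concat (replicate n (W 0))"
| "icomm_word W n (Suc i) = (let u = icomm_word W n i; v = concat (replicate n (W (Suc i)))
     in u @ v @ inv_word u @ inv_word v)"

lemma ev_power_word: "ev f (concat (replicate n w)) = nmul n (ev f w)"
  by (induction n) (simp_all add: ev_append)

lemma ev_icomm_word: "ev f (icomm_word W n i) = icomm (\<lambda>j. ev f (W j)) n i"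
  by (induction i)
     (simp_all add: ev_power_word ev_append ev_inv_word Let_def cj_def group_add_simps
        del: add_uminus_conv_diff)

lemma power_word_words: "w \<in> words X \<Longrightarrow> concat (replicate n w) \<in> words X"
  by (induction n) simp_all

lemma icomm_word_words: "(\<And>j. j \<le> i \<Longrightarrow> W j \<in> words X) \<Longrightarrow> icomm_word W n i \<in> words X"
  by (induction i) (simp_all add: power_word_words Let_def inv_word_words)

lemma length_inv_word [simp]: "length (inv_word w) = length w"
  by (simp add: inv_word_def)

lemma length_icomm_word: "length (icomm_word W n i) = n * length (icomm_word W 1 i)"
proof (induction i)
  case 0
  then show ?case by (simp add: length_concat sum_list_replicate)
next
  case (Suc i)
  then show ?case by (simp add: Let_def length_concat sum_list_replicate algebra_simps)
qed

lemma (in ghom) nmul: "h (nmul n a) = nmul n (h a)"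
  by (induction n) (simp_all add: add)

lemma (in ghom) icomm: "h (icomm g n i) = icomm (\<lambda>j. h (g j)) n i"
  by (induction i) (simp_all add: nmul cj diff)

lemma nmul_zero [simp]: "nmul n 0 = 0"
  by (induction n) simp_all

lemma icomm_zero: "j \<le> i \<Longrightarrow> g j = 0 \<Longrightarrow> icomm g n i = 0"
  by (induction i) (auto simp: le_Suc_eq cj_def)

lemma aff_nmul:
  "fst (aff (nmul n a)) $ 1 = real n * fst (aff a) $ 1" "snd (aff (nmul n a)) $ 0 = real n * snd (aff a) $ 0"
  by (induction n) (simp_all add: aff_add aff_mult_def aff_unipotent algebra_simps)

lemma dvd_if_nth_zero:
  fixes f :: "real fps" shows "f $ 0 = 0 \<Longrightarrow> fps_X dvd f" "f $ 0 = 0 \<Longrightarrow> f $ 1 = 0 \<Longrightarrow> fps_X ^ 2 dvd f"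
proof -
  have shift: "f $ 0 = 0 \<Longrightarrow> f = fps_X * fps_shift 1 f" for f :: "real fps"
    by (simp add: fps_eq_iff)
  show "f $ 0 = 0 \<Longrightarrow> fps_X dvd f" using shift dvd_triv_left by metis
  assume 0: "f $ 0 = 0" and 1: "f $ 1 = 0"
  have "fps_shift 1 f = fps_X * fps_shift 1 (fps_shift 1 f)" by (rule shift) (use 1 in simp)
  then have "f = fps_X ^ 2 * fps_shift 1 (fps_shift 1 f)"
    using shift[OF 0] by (metis mult.assoc power2_eq_square)
  then show "fps_X ^ 2 dvd f" by (metis dvd_triv_left)
qed

text \<open>By \<open>aff_commutator\<close>, a commutator with an element \<open>(a', b')\<close> turns a translation by \<open>b\<close> into one by
  \<open>- (a' - 1) b\<close>. Here \<open>a' - 1\<close> is \<open>n X\<close> up to higher order, so every step contributes a factor \<open>- n X\<close>. In the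
  first step the linear part of the other element is \<open>1\<close> only modulo \<open>X ^ 2\<close>, which is precise enough. The
  hypotheses fix only the lowest coefficients of the \<open>e j\<close>, because lifts of generators to an arbitrary presentation
  are determined only up to elements of \<open>corner_ker\<close>.\<close>

lemma aff_icomm:
  assumes e0: "fst (aff (e 0)) $ 1 = 0" "snd (aff (e 0)) $ 0 = 1"
    and e: "\<And>j. 1 \<le> j \<Longrightarrow> j \<le> i \<Longrightarrow> fst (aff (e j)) $ 1 = 1"
  shows "fps_X ^ (i + 2) dvd fst (aff (icomm e n i)) - 1 \<and> fps_X ^ i dvd snd (aff (icomm e n i)) \<and>
    snd (aff (icomm e n i)) $ i = (- 1) ^ i * real n ^ (i + 1)"
  using e
proof (induction i)
  case 0
  have "fps_X ^ 2 dvd fst (aff (nmul n (e 0))) - 1"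
    by (rule dvd_if_nth_zero(2)) (use aff_nmul(1)[of n "e 0"] e0 aff_unipotent in simp_all)
  then show ?case using aff_nmul(2)[of n "e 0"] e0 by (simp add: numeral_2_eq_2)
next
  case (Suc i)
  obtain a b where ab: "aff (icomm e n i) = (a, b)" by force
  obtain a' b' where ab': "aff (nmul n (e (Suc i))) = (a', b')" by force
  have IH: "fps_X ^ (i + 2) dvd a - 1" "fps_X ^ i dvd b" "b $ i = (- 1) ^ i * real n ^ (i + 1)"
    using Suc.IH Suc.prems ab by auto
  have eq: "aff (icomm e n (Suc i)) = (1, (a - 1) * b' - (a' - 1) * b)"
    using aff_commutator[OF ab ab'] by simp
  have a0: "(a' - 1) $ 0 = 0" using aff_unipotent[of "nmul n (e (Suc i))"] ab' by simp
  have a1: "(a' - 1) $ 1 = real n"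
    using aff_nmul(1)[of n "e (Suc i)"] Suc.prems[of "Suc i"] ab' by simp
  obtain w where w: "b = fps_X ^ i * w" using IH(2) by (auto simp: dvd_def)
  obtain u where u: "a' - 1 = fps_X * u" using dvd_if_nth_zero(1)[OF a0] by (auto simp: dvd_def)
  have w0: "w $ 0 = (- 1) ^ i * real n ^ (i + 1)" using IH(3) by (simp add: w fps_X_power_mult_nth)
  have u0: "u $ 0 = real n" using a1 by (simp add: u)
  have prod: "(a' - 1) * b = fps_X ^ Suc i * (u * w)" by (simp add: u w mult_ac)
  have d1: "fps_X ^ (i + 2) dvd (a - 1) * b'" using IH(1) by (rule dvd_mult2)
  have "fps_X ^ Suc i dvd (a - 1) * b'"
    by (rule dvd_trans[OF le_imp_power_dvd d1]) simp
  then have "fps_X ^ Suc i dvd (a - 1) * b' - (a' - 1) * b" unfolding prod by (intro dvd_diff) simp_all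
  moreover have "((a - 1) * b' - (a' - 1) * b) $ Suc i = (- 1) ^ Suc i * real n ^ (Suc i + 1)"
  proof -
    have "((a - 1) * b') $ Suc i = 0" by (rule nth_dvd_zero[OF d1]) simp
    moreover have "((a' - 1) * b) $ Suc i = u $ 0 * w $ 0"
      unfolding prod fps_X_power_mult_nth by simp
    ultimately show ?thesis by (simp add: u0 w0)
  qed
  ultimately show ?case unfolding eq by simp
qed

text \<open>The generators \<open>x^t_1, y^t_2, \<dots>, y^t_m\<close>, which are numbered from \<open>0\<close>; the one with number
  \<open>j\<close> is trivial at the vertices \<open>v\<close> with \<open>Suc j \<notin> v\<close>.\<close>

definition side_gen :: "nat \<Rightarrow> nat fgrp" where
  "side_gen j = fgen (2 * Suc j + (if j = 0 then 0 else 1))"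

lemma vertex_side_gen:
  "vertex v (side_gen j) = (if Suc j \<in> v then fgen (if j = 0 then 0 else 1) else 0)"
  by (auto simp: side_gen_def vertex_fgen vertex_gen_def)

text \<open>A vertex other than the top one misses some \<open>Suc j\<close>, which makes one entry of the commutator trivial. At the top,
  \<open>m \<ge> 2\<close> guarantees that changing the generators by elements of \<open>corner_ker m\<close> does not change the coefficients on
  which \<open>aff_icomm\<close> depends.\<close>

lemma icomm_side_gens:
  assumes m: "m \<ge> 2" and d: "\<And>j. j < m \<Longrightarrow> d j - side_gen j \<in> corner_ker m"
    and dC: "\<And>j. j < m \<Longrightarrow> d j \<in> cube_grp m"
  shows "icomm d n (m - 1) \<in> corner_ker m" "\<bar>corner_inv m (icomm d n (m - 1))\<bar> = real n ^ m"
proof -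
  have inC: "icomm d n i \<in> cube_grp m" if "i < m" for i
    using that
    by (induction i) (simp_all add: dC nmul_mem subgrp_cube_grp subgrp_diff cj_mem)
  have low: "vertex v (icomm d n (m - 1)) = 0" if v: "v \<subset> {1..m}" for v
  proof -
    obtain i where i: "i \<in> {1..m}" "i \<notin> v" using v by blast
    let ?j = "i - 1"
    have j: "?j < m" "Suc ?j \<notin> v" using i by auto
    have "vertex v (d ?j - side_gen ?j) = 0" using d[OF j(1)] v by (simp add: corner_ker_def)
    then have "vertex v (d ?j) = 0" using j(2) by (simp add: vertex.diff vertex_side_gen)
    then show ?thesis unfolding vertex.icomm using j(1) by (intro icomm_zero[of ?j]) auto
  qed
  show "icomm d n (m - 1) \<in> corner_ker m"
    using inC[of "m - 1"] m low by (simp add: corner_ker_def)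
  let ?U = "{1..m}"
  have top: "fst (aff (vertex ?U (d j))) $ 1 = (if j = 0 then 0 else 1) \<and>
      (j = 0 \<longrightarrow> snd (aff (vertex ?U (d j))) $ 0 = 1)" if j: "j < m" for j
  proof -
    obtain a b where ab: "aff (vertex ?U (d j - side_gen j)) = (a, b)" by force
    have a: "fps_X ^ m dvd a - 1" and b: "fps_X ^ (m - 1) dvd b"
      using corner_ker_top[OF _ d[OF j]] m ab by auto
    have "(a - 1) $ 1 = 0" by (rule nth_dvd_zero[OF a]) (use m in simp)
    then have a1: "a $ 1 = 0" by simp
    have a0: "a $ 0 = 1" using aff_unipotent[of "vertex ?U (d j - side_gen j)"] ab by simp
    have b0: "b $ 0 = 0" by (rule nth_dvd_zero[OF b]) (use m in simp)
    have "aff (vertex ?U (d j)) = aff_mult (a, b) (aff (vertex ?U (side_gen j)))"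
      unfolding ab[symmetric] aff_add[symmetric] vertex.add[symmetric] by simp
    also have "vertex ?U (side_gen j) = fgen (if j = 0 then 0 else 1)"
      using j by (simp add: vertex_side_gen)
    finally show ?thesis using a0 a1 b0 by (auto simp: aff_mult_def aff_fgen aff_letter_def)
  qed
  have "snd (aff (icomm (\<lambda>j. vertex ?U (d j)) n (m - 1))) $ (m - 1) = (- 1) ^ (m - 1) * real n ^ (m - 1 + 1)"
    using aff_icomm[of "\<lambda>j. vertex ?U (d j)" "m - 1" n] top m by fastforce
  then show "\<bar>corner_inv m (icomm d n (m - 1))\<bar> = real n ^ m"
    using m by (simp add: corner_inv_def vertex.icomm abs_mult power_abs)
qed

section \<open>Growth of the Dehn function\<close>

lemma area_le_dehn:
  assumes "finite X" "null_homotopic X R w" "length w \<le> n"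
  shows "area X R w \<le> dehn X R n"
proof -
  have "finite {area X R w | w. null_homotopic X R w \<and> length w \<le> n}"
    using finite_imageI[OF finite_null_homotopic[OF assms(1)], of "area X R" R n]
    by (simp add: setcompr_eq_image)
  then show ?thesis unfolding dehn_def using assms by (intro Max_ge) auto
qed

text \<open>The words \<open>W j\<close> in the given presentation represent the side generators; \<open>L\<close> is the length of
  the iterated commutator for \<open>n = 1\<close>, and the length for \<open>n\<close> is \<open>L * n\<close>.\<close>

lemma dehn_cube_lower_bound:
  fixes Y :: "'y set"
  assumes m: "m \<ge> 2" and S: "S \<subseteq> words {..<2 * m + 2}" "relator_closure {..<2 * m + 2} S = corner_ker m"
    and Y: "finite Y" "finite T" "T \<subseteq> words Y"
    and iso: "presented_group Y T \<cong> presented_group {..<2 * m + 2} S"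
  obtains B :: real and L :: nat where "\<And>n. real n ^ m \<le> B * real (dehn Y T (L * n))" "B \<ge> 0"
proof -
  obtain \<psi> where \<psi>: "\<And>y. y \<in> Y \<Longrightarrow> \<psi> y \<in> cube_grp m"
    and null: "\<And>w. w \<in> words Y \<Longrightarrow> null_homotopic Y T w \<longleftrightarrow> ev \<psi> w \<in> corner_ker m"
    and onto: "\<And>a. a \<in> cube_grp m \<Longrightarrow> \<exists>w\<in>words Y. ev \<psi> w - a \<in> corner_ker m"
    using presentation_comparison[OF S(1) Y(3) iso] unfolding S(2) cube_grp_def by metis
  have \<psi>T: "ev \<psi> r \<in> corner_ker m" if r: "r \<in> T" for r
  proof -
    have "of_word r \<in> relator_closure Y T"
      unfolding relator_closure_def using r ncl_incl[OF subgrp_fgrp_on] by blast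
    then have "null_homotopic Y T r" using null_homotopic_iff[OF Y(3)] Y(3) r by blast
    then show ?thesis using null Y(3) r by blast
  qed
  have m1: "m \<ge> 1" using m by simp
  obtain B where B: "B \<ge> 0" "\<And>w. null_homotopic Y T w \<Longrightarrow> \<bar>corner_inv m (ev \<psi> w)\<bar> \<le> B * real (area Y T w)"
  proof (rule area_lower_bound[OF subgrp_cube_grp nsub_corner_ker])
    show "corner_inv m (a + b) = corner_inv m a + corner_inv m b"
      if "a \<in> corner_ker m" "b \<in> corner_ker m" for a b by (rule corner_inv_add[OF m1 that])
    show "corner_inv m (cj p a) = corner_inv m a" if "p \<in> cube_grp m" "a \<in> corner_ker m" for p a
      by (rule corner_inv_cj[OF m1 that])
  qed (use Y(2,3) \<psi> \<psi>T that in blast)+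
  have "\<exists>w. w \<in> words Y \<and> (j < m \<longrightarrow> ev \<psi> w - side_gen j \<in> corner_ker m)" for j
  proof (cases "j < m")
    case True
    then have "side_gen j \<in> cube_grp m" unfolding side_gen_def by (intro fgen_in_cube_grp) auto
    then show ?thesis using onto by blast
  qed (use words_Nil in blast)
  then obtain W where W: "\<And>j. W j \<in> words Y" "\<And>j. j < m \<Longrightarrow> ev \<psi> (W j) - side_gen j \<in> corner_ker m"
    by metis
  have WC: "ev \<psi> (W j) \<in> cube_grp m" for j by (rule ev_mem[OF subgrp_cube_grp W(1) \<psi>])
  define L where "L = length (icomm_word W 1 (m - 1))"
  have "real n ^ m \<le> B * real (dehn Y T (L * n))" for n
  proof -
    let ?w = "icomm_word W n (m - 1)"
    have w: "?w \<in> words Y" by (rule icomm_word_words[OF W(1)])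
    note ic = icomm_side_gens[OF m W(2) WC, of n]
    have nh: "null_homotopic Y T ?w" using null[OF w] ic(1) by (simp add: ev_icomm_word)
    have "real n ^ m = \<bar>corner_inv m (ev \<psi> ?w)\<bar>" using ic(2) by (simp add: ev_icomm_word)
    also have "\<dots> \<le> B * real (area Y T ?w)" by (rule B(2)[OF nh])
    also have "\<dots> \<le> B * real (dehn Y T (L * n))"
    proof (rule mult_left_mono[OF _ B(1)])
      have "length ?w \<le> L * n" using length_icomm_word[of W n "m - 1"] by (simp add: L_def)
      then show "real (area Y T ?w) \<le> real (dehn Y T (L * n))" using area_le_dehn[OF Y(1) nh] by simp
    qed
    finally show ?thesis .
  qed
  then show ?thesis using that B(1) by blast
qed

lemma not_monomial_le_poly:
  fixes q :: "real poly"
  assumes "degree q < m" shows "\<exists>n :: nat. real n ^ m > poly q (real n)"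
proof -
  let ?d = "monom 1 m - q"
  have "coeff ?d m = 1" using assms by (simp add: coeff_eq_0)
  moreover have "degree ?d = m"
    using degree_add_eq_left[of "- q" "monom 1 m"] assms by (simp add: degree_monom_eq)
  ultimately have lc: "lead_coeff ?d = 1" by simp
  obtain x where x: "\<And>y. y \<ge> x \<Longrightarrow> poly ?d y \<ge> lead_coeff ?d" using poly_pinfty_gt_lc[of ?d] lc by auto
  obtain n :: nat where "real n \<ge> x" using real_arch_simple by blast
  then have "poly ?d (real n) \<ge> 1" using x lc by metis
  then show ?thesis by (intro exI[of _ n]) (simp add: poly_monom)
qed

theorem corollary1p2:
  shows "\<not> (\<exists>p :: real poly. \<forall>G :: nat monoid.
           group G \<and> finitely_presented G \<and> residually_free G \<longrightarrow>
           (\<exists>\<delta>. is_dehn_function G \<delta> \<and>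
                (\<lambda>n. real (\<delta> n)) \<preceq>\<^sub>D (\<lambda>n. poly p (real n))))"
proof
  assume "\<exists>p :: real poly. \<forall>G :: nat monoid.
           group G \<and> finitely_presented G \<and> residually_free G \<longrightarrow>
           (\<exists>\<delta>. is_dehn_function G \<delta> \<and>
                (\<lambda>n. real (\<delta> n)) \<preceq>\<^sub>D (\<lambda>n. poly p (real n)))"
  then obtain p :: "real poly" where p: "\<And>G :: nat monoid. group G \<Longrightarrow> finitely_presented G \<Longrightarrow> residually_free G \<Longrightarrow>
           \<exists>\<delta>. is_dehn_function G \<delta> \<and> (\<lambda>n. real (\<delta> n)) \<preceq>\<^sub>D (\<lambda>n. poly p (real n))"
    by blast
  define m where "m = degree p + 2"
  have m: "m \<ge> 2" by (simp add: m_def)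
  let ?X = "{..<2 * m + 2}"
  obtain S where S: "finite S" "S \<subseteq> words ?X" "relator_closure ?X S = corner_ker m"
    by (rule cube_presentation)
  let ?H = "presented_group ?X S"
  have H: "group ?H" using S(2) by (rule group_presented_group)
  obtain G :: "nat monoid" where G: "group G" "?H \<cong> G"
    by (rule countable_group_nat_copy[OF H countable_presented_group[OF S(2)]])
  have GH: "G \<cong> ?H" using group.iso_sym[OF H G(2)] .
  have fp: "finitely_presented G"
    unfolding finitely_presented_def finite_presentation_def using S G(2) by blast
  have rf: "residually_free G"
    by (rule residually_free_iso[OF G(1) H GH cube_quotient_residually_free[OF S(2,3)]])
  obtain Y :: "nat set" and T where YT: "finite_presentation G Y T"
    and dom: "(\<lambda>n. real (dehn Y T n)) \<preceq>\<^sub>D (\<lambda>n. poly p (real n))"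
    using p[OF G(1) fp rf] unfolding is_dehn_function_def by blast
  have Y: "finite Y" "finite T" "T \<subseteq> words Y" "presented_group Y T \<cong> G"
    using YT by (auto simp: finite_presentation_def)
  have iso: "presented_group Y T \<cong> ?H" by (rule iso_trans[OF Y(4) GH])
  obtain B :: real and L :: nat where BL: "\<And>n. real n ^ m \<le> B * real (dehn Y T (L * n))" "B \<ge> 0"
    using dehn_cube_lower_bound[OF m S(2,3) Y(1-3) iso] by metis
  obtain C :: nat where C: "\<And>n. real (dehn Y T n) \<le> real C * poly p (real (C * n)) + real C * real n + real C"
    using dom unfolding dominated_def by blast
  \<comment> \<open>the bound that domination by \<open>p\<close> would give, as a polynomial in \<open>n\<close>\<close>
  define q where "q = smult B (smult (real C) (pcompose p [:0, real (C * L):]) + [:real C, real (C * L):])"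
  have "degree (pcompose p [:0, real (C * L):]) \<le> degree p"
    using degree_pcompose_le[of p "[:0, real (C * L):]"] by (auto split: if_splits)
  then have "degree q \<le> max (degree p) 1"
    unfolding q_def
    by (intro order.trans[OF degree_smult_le] degree_add_le) (auto intro: order.trans[OF degree_smult_le])
  then have "degree q < m" by (simp add: m_def)
  then obtain n :: nat where n: "real n ^ m > poly q (real n)" using not_monomial_le_poly by blast
  have "real n ^ m \<le> B * (real C * poly p (real (C * (L * n))) + real C * real (L * n) + real C)"
    using BL(1)[of n] mult_left_mono[OF C[of "L * n"] BL(2)] by linarith
  also have "\<dots> = poly q (real n)" by (simp add: q_def poly_pcompose algebra_simps)
  finally show False using n by simp
qed

end
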